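(* Let $v\in\mathcal V$ and $L=\{\beta=(\beta_0,\beta_1)\in\mathbb C^2:\beta_0-\alpha\beta_1=0\}$ for some $\alpha\in\mathbb R\setminus\{0\}$. Then $h_L(v)$ has discrete spectrum, all its eigenfunctions are almost everywhere non-vanishing, and its eigenvalues $\{\lambda_k\}_{k\in\mathbb N}$, listed in non-decreasing order counting multiplicity, satisfy for every $k\in\mathbb N$: $\lambda_{2k-1}<\lambda_{2k}$ if $\alpha\ge0$, and $\lambda_{2k}<\lambda_{2k+1}$ if $\alpha\le0$. Moreover, if $L$ is one of the sets $\{0\}\times\mathbb C$, $\mathbb C\times\{0\}$, $\{(0,0)\}$, or $\mathbb C^2$, then $h_L(v)$ has discrete spectrum, all its eigenfunctions are almost everywhere non-vanishing, and all its eigenvalues are simple.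
   Context: Let $I=(0,1)$, $\mathrm H^{-1}(I)$ the dual of $\mathrm H^1(I)$, and $\mathcal V=\{v\in\mathrm H^{-1}(I): v(\phi)\in\mathbb R\text{ for all real-valued }\phi\in\mathrm H^1(I)\}$. For a subspace $L\subset\mathbb C^2$ let $\mathrm H^1_L(I)=\{\psi\in\mathrm H^1(I):(\psi(0),\psi(1))\in L\}$, and let $h_L(v)=-\Delta_L+v$ be the self-adjoint operator on $\mathrm L^2(I)$ associated to the closed semibounded form $a_v(\psi,\psi)=\int_I|\psi'(x)|^2dx+v(|\psi|^2)$ with form domain $\mathrm H^1_L(I)$. *)

theory Defs
  imports "HOL-Analysis.Analysis"
begin

text \<open>Functions on I = (0,1) are modelled as maps real => complex; only their values on
  [0,1] matter.  Elements of L2(I) are identified up to a.e. equality on I.\<close>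

definition L2I :: "(real \<Rightarrow> complex) \<Rightarrow> bool" where
  "L2I f \<longleftrightarrow> set_borel_measurable lebesgue {0..1} f \<and>
     set_integrable lebesgue {0..1} (\<lambda>x. (cmod (f x))\<^sup>2)"

definition l2inner :: "(real \<Rightarrow> complex) \<Rightarrow> (real \<Rightarrow> complex) \<Rightarrow> complex" where
  "l2inner f g = (LINT x:{0..1}|lebesgue. f x * cnj (g x))"

definition ae_zero_I :: "(real \<Rightarrow> complex) \<Rightarrow> bool" where
  "ae_zero_I f \<longleftrightarrow> (AE x in lebesgue. x \<in> {0<..<1} \<longrightarrow> f x = 0)"

text \<open>g is a weak derivative of psi: g in L2(I) and psi (continuous representative on [0,1])
  is the primitive of g.  H1(I) = functions admitting such a g.\<close>

definition is_wderiv :: "(real \<Rightarrow> complex) \<Rightarrow> (real \<Rightarrow> complex) \<Rightarrow> bool" where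
  "is_wderiv g \<psi> \<longleftrightarrow> L2I g \<and>
     (\<forall>x\<in>{0..1}. \<psi> x = \<psi> 0 + (LINT t:{0..x}|lebesgue. g t))"

definition H1 :: "(real \<Rightarrow> complex) set" where
  "H1 = {\<psi>. \<exists>g. is_wderiv g \<psi>}"

definition wderiv :: "(real \<Rightarrow> complex) \<Rightarrow> (real \<Rightarrow> complex)" where
  "wderiv \<psi> = (SOME g. is_wderiv g \<psi>)"

definition H1_norm :: "(real \<Rightarrow> complex) \<Rightarrow> real" where
  "H1_norm \<psi> = sqrt ((LINT x:{0..1}|lebesgue. (cmod (\<psi> x))\<^sup>2)
                     + (LINT x:{0..1}|lebesgue. (cmod (wderiv \<psi> x))\<^sup>2))"

definition Hminus1 :: "((real \<Rightarrow> complex) \<Rightarrow> complex) set" where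
  "Hminus1 = {v. (\<forall>\<psi>\<in>H1. \<forall>\<phi>\<in>H1. v (\<lambda>x. \<psi> x + \<phi> x) = v \<psi> + v \<phi>) \<and>
                 (\<forall>\<psi>\<in>H1. \<forall>c. v (\<lambda>x. c * \<psi> x) = c * v \<psi>) \<and>
                 (\<exists>C. \<forall>\<psi>\<in>H1. cmod (v \<psi>) \<le> C * H1_norm \<psi>)}"

definition Vpot :: "((real \<Rightarrow> complex) \<Rightarrow> complex) set" where
  "Vpot = {v\<in>Hminus1. \<forall>\<phi>\<in>H1. (\<forall>x\<in>{0..1}. \<phi> x \<in> \<real>) \<longrightarrow> v \<phi> \<in> \<real>}"

definition H1_L :: "(complex \<times> complex) set \<Rightarrow> (real \<Rightarrow> complex) set" where
  "H1_L L = {\<psi>\<in>H1. (\<psi> 0, \<psi> 1) \<in> L}"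

text \<open>Sesquilinear form obtained by polarization of
  a_v(psi,psi) = int |psi'|^2 + v(|psi|^2).\<close>

definition form_a :: "((real \<Rightarrow> complex) \<Rightarrow> complex) \<Rightarrow> (real \<Rightarrow> complex) \<Rightarrow> (real \<Rightarrow> complex) \<Rightarrow> complex" where
  "form_a v \<psi> \<phi> = (LINT x:{0..1}|lebesgue. wderiv \<psi> x * cnj (wderiv \<phi> x))
                    + v (\<lambda>x. \<psi> x * cnj (\<phi> x))"

text \<open>Graph of the operator h_L(v) associated with the form (Kato's representation theorem):
  psi in dom h and h psi = f iff psi in the form domain, f in L2 and a(psi,phi) = <f,phi>
  for all phi in the form domain.\<close>

definition hL_graph :: "(complex \<times> complex) set \<Rightarrow> ((real \<Rightarrow> complex) \<Rightarrow> complex) \<Rightarrow>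
    (real \<Rightarrow> complex) \<Rightarrow> (real \<Rightarrow> complex) \<Rightarrow> bool" where
  "hL_graph L v \<psi> f \<longleftrightarrow> \<psi> \<in> H1_L L \<and> L2I f \<and>
     (\<forall>\<phi>\<in>H1_L L. form_a v \<psi> \<phi> = l2inner f \<phi>)"

text \<open>Spectrum: complement of the resolvent set, i.e. of those mu for which h - mu is a
  bijection from dom h onto L2 (modulo a.e. equality).\<close>

definition spectrum_h :: "(complex \<times> complex) set \<Rightarrow> ((real \<Rightarrow> complex) \<Rightarrow> complex) \<Rightarrow> complex set" where
  "spectrum_h L v = {\<mu>. \<not> (\<forall>f. L2I f \<longrightarrow>
       (\<exists>\<psi>. hL_graph L v \<psi> (\<lambda>x. f x + \<mu> * \<psi> x)) \<and>
       (\<forall>\<psi>1 \<psi>2. hL_graph L v \<psi>1 (\<lambda>x. f x + \<mu> * \<psi>1 x) \<longrightarrow>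
                 hL_graph L v \<psi>2 (\<lambda>x. f x + \<mu> * \<psi>2 x) \<longrightarrow>
                 ae_zero_I (\<lambda>x. \<psi>1 x - \<psi>2 x)))}"

definition is_eigenfunction :: "(complex \<times> complex) set \<Rightarrow> ((real \<Rightarrow> complex) \<Rightarrow> complex) \<Rightarrow>
    complex \<Rightarrow> (real \<Rightarrow> complex) \<Rightarrow> bool" where
  "is_eigenfunction L v \<mu> \<psi> \<longleftrightarrow> hL_graph L v \<psi> (\<lambda>x. \<mu> * \<psi> x) \<and> \<not> ae_zero_I \<psi>"

definition is_eigenvalue :: "(complex \<times> complex) set \<Rightarrow> ((real \<Rightarrow> complex) \<Rightarrow> complex) \<Rightarrow> complex \<Rightarrow> bool" where
  "is_eigenvalue L v \<mu> \<longleftrightarrow> (\<exists>\<psi>. is_eigenfunction L v \<mu> \<psi>)"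

definition eigdim_ge :: "(complex \<times> complex) set \<Rightarrow> ((real \<Rightarrow> complex) \<Rightarrow> complex) \<Rightarrow> complex \<Rightarrow> nat \<Rightarrow> bool" where
  "eigdim_ge L v \<mu> n \<longleftrightarrow> (\<exists>\<psi>s :: nat \<Rightarrow> real \<Rightarrow> complex.
      (\<forall>i<n. hL_graph L v (\<psi>s i) (\<lambda>x. \<mu> * \<psi>s i x)) \<and>
      (\<forall>c :: nat \<Rightarrow> complex. ae_zero_I (\<lambda>x. \<Sum>i<n. c i * \<psi>s i x) \<longrightarrow> (\<forall>i<n. c i = 0)))"

definition multiplicity_h :: "(complex \<times> complex) set \<Rightarrow> ((real \<Rightarrow> complex) \<Rightarrow> complex) \<Rightarrow> complex \<Rightarrow> nat \<Rightarrow> bool" where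
  "multiplicity_h L v \<mu> n \<longleftrightarrow> eigdim_ge L v \<mu> n \<and> \<not> eigdim_ge L v \<mu> (Suc n)"

definition discrete_spectrum :: "(complex \<times> complex) set \<Rightarrow> ((real \<Rightarrow> complex) \<Rightarrow> complex) \<Rightarrow> bool" where
  "discrete_spectrum L v \<longleftrightarrow> (\<forall>\<mu>\<in>spectrum_h L v.
      \<not> \<mu> islimpt spectrum_h L v \<and> is_eigenvalue L v \<mu> \<and> (\<exists>n. multiplicity_h L v \<mu> n))"

definition eigenfunctions_ae_nonvanishing :: "(complex \<times> complex) set \<Rightarrow> ((real \<Rightarrow> complex) \<Rightarrow> complex) \<Rightarrow> bool" where
  "eigenfunctions_ae_nonvanishing L v \<longleftrightarrow> (\<forall>\<mu> \<psi>. is_eigenfunction L v \<mu> \<psi> \<longrightarrow>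
      (AE x in lebesgue. x \<in> {0<..<1} \<longrightarrow> \<psi> x \<noteq> 0))"

text \<open>lam 1, lam 2, ... (indices k >= 1) lists all eigenvalues in non-decreasing order, each
  eigenvalue mu repeated exactly dim ker(h - mu) times (and non-eigenvalues never).\<close>

definition eigenvalue_list :: "(complex \<times> complex) set \<Rightarrow> ((real \<Rightarrow> complex) \<Rightarrow> complex) \<Rightarrow> (nat \<Rightarrow> real) \<Rightarrow> bool" where
  "eigenvalue_list L v lam \<longleftrightarrow> (\<forall>k\<ge>1. lam k \<le> lam (Suc k)) \<and>
     (\<forall>\<mu>::complex. finite {k. k \<ge> 1 \<and> complex_of_real (lam k) = \<mu>} \<and>
        multiplicity_h L v \<mu> (card {k. k \<ge> 1 \<and> complex_of_real (lam k) = \<mu>}))"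

definition robin_L :: "real \<Rightarrow> (complex \<times> complex) set" where
  "robin_L \<alpha> = {\<beta>. fst \<beta> - complex_of_real \<alpha> * snd \<beta> = 0}"

end

theory Submission
  imports Defs
begin

text \<open>A potential \<open>v \<in> V\<close> has the form \<open>v \<phi> = c \<integral>\<phi> + \<integral>w \<phi>'\<close> with a real \<open>w \<in> L\<^sup>2\<close> (Riesz). A ground-state
  type substitution \<open>\<psi> = exp (- h) y\<close> turns the form into the form of a regular Sturm--Liouville
  problem with continuous coefficients, \<open>y' = s / P\<close> and \<open>s' = - (q + \<Lambda> P) y\<close>, where \<open>\<Lambda>\<close> is the
  spectral parameter up to a shift. Eigenfunctions therefore have finitely many zeros, and the spectrum
  consists of the \<open>\<Lambda>\<close> for which some solution satisfies the boundary conditions; orthogonality of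
  eigenfunctions and compactness of the set of initial values exclude accumulation.

  For the coupled condition, \<open>\<Lambda>\<close> is an eigenvalue iff the discriminant \<open>D\<close>, the trace of
  \<open>diag(\<beta>, 1/\<beta>)\<close> times the monodromy matrix, equals 2. At a simple eigenvalue \<open>D - 2\<close> changes sign; at
  a double one \<open>D < 2\<close> on both sides; for very negative \<open>\<Lambda>\<close> the sign of \<open>D - 2\<close> is that of \<open>\<beta>\<close>.
  Hence the number of eigenvalues below a double eigenvalue has a parity prescribed by the sign of \<open>\<beta>\<close>,
  which is the assertion on the gaps.\<close>

subsection \<open>Primitives of integrable functions\<close>

text \<open>The obstacle is that \<open>v\<close> is a distribution: the natural quasi-derivative
  \<open>\<psi>' + w \<psi>\<close> leads to a system with the merely integrable coefficient
  \<open>w^2\<close>. The function \<open>n\<close> absorbs it: \<open>w^2\<close> is replaced by a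
  weighted mean \<open>C\<close>, at the price of the continuous coefficient
  \<open>q = n^2 P\<close>, whose sign later drives the rotation argument for large \<Lambda>. Since
  \<open>n\<close> vanishes at both ends, the form acquires no boundary term; the boundary space is
  only rescaled at 1 by \<open>exp (h 1)\<close>, and \<alpha> becomes
  \<open>\<beta> = \<alpha> exp (- h 1)\<close>, of the same sign. What remains is classical C1
  theory and linear algebra: the kernel of the operator minus \<mu> is the space of initial values
  \<open>(y 0, s 0)\<close> in \<open>C^2\<close> that satisfy two linear equations. The
  discriminant is never differentiated. The Lagrange identity for two parameters gives exact
  difference formulas whose coefficients are Gram entries, continuous in the second parameter and
  definite on the diagonal. Eigenvalues are not counted exactly; the gaps depend only on the parity
  of the number of simple ones.\<close>

text \<open>The function \<open>f\<close> is absolutely continuous on \<open>[0,1]\<close> with derivative \<open>g\<close>; its values outside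
  \<open>[0,1]\<close> are arbitrary.\<close>

definition prim :: "(real \<Rightarrow> 'a::euclidean_space) \<Rightarrow> (real \<Rightarrow> 'a) \<Rightarrow> bool" where
  "prim g f \<longleftrightarrow> g absolutely_integrable_on {0..1} \<and> (\<forall>x\<in>{0..1}. f x = f 0 + integral {0..x} g)"

lemma absolutely_integrable_sub01:
  fixes g :: "real \<Rightarrow> 'a::euclidean_space"
  assumes "g absolutely_integrable_on {0..1}" "0 \<le> a" "b \<le> 1"
  shows "g absolutely_integrable_on {a..b}" "g integrable_on {a..b}"
proof -
  show *: "g absolutely_integrable_on {a..b}"
    by (rule absolutely_integrable_on_subinterval[OF assms(1)]) (use assms in auto)
  show "g integrable_on {a..b}" using * set_lebesgue_integral_eq_integral(1) by blast
qed

lemma lebesgue_on_integral_eq: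
  fixes g :: "real \<Rightarrow> 'a::euclidean_space"
  assumes "g absolutely_integrable_on S" "S \<in> sets lebesgue"
  shows "integrable (lebesgue_on S) g" "integral\<^sup>L (lebesgue_on S) g = integral S g"
proof -
  show "integrable (lebesgue_on S) g" using absolutely_integrable_imp_integrable assms by blast
  show "integral\<^sup>L (lebesgue_on S) g = integral S g"
    using set_lebesgue_integral_eq_integral(2)[OF assms(1)] assms(2)
    by (simp add: integral_restrict_space set_lebesgue_integral_def)
qed

lemma product_primitive:
  fixes f g :: "real \<Rightarrow> 'a::{euclidean_space,real_normed_field}"
  assumes f: "f absolutely_integrable_on {0..1}" and g: "g absolutely_integrable_on {0..1}"
    and x: "x \<in> {0..1}"
  shows "integral {0..x} f * integral {0..x} g =
    integral {0..x} (\<lambda>t. f t * integral {0..t} g + integral {0..t} f * g t)"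
proof -
  define N where "N = lebesgue_on {0..x}"
  have fin: "finite_measure N" unfolding N_def by (rule finite_measure_lebesgue_on) auto
  interpret N: finite_measure N by fact
  interpret NN: pair_sigma_finite N N ..
  have fx: "f absolutely_integrable_on {0..x}" "g absolutely_integrable_on {0..x}"
    using absolutely_integrable_sub01 f g x by auto
  have fi[simp]: "integrable N f" "integrable N g"
    using lebesgue_on_integral_eq(1)[OF fx(1)] lebesgue_on_integral_eq(1)[OF fx(2)] unfolding N_def by auto
  have [measurable]: "f \<in> borel_measurable N" "g \<in> borel_measurable N"
    using borel_measurable_integrable fi by blast+
  have spN[simp]: "space N = {0..x}" by (simp add: N_def)
  have setN[simp]: "{0..s} \<in> sets N" if "s \<in> {0..x}" for s
    using that by (auto simp: N_def sets_restrict_space intro!: image_eqI[of _ _ "{0..s}"])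
  have idm[measurable]: "(\<lambda>t. t) \<in> borel_measurable N"
    using id_borel_measurable_lebesgue_on[of "{0..x}"] unfolding N_def id_def by simp
  have int1: "integral\<^sup>L N (\<lambda>t. indicator {0..s} t *\<^sub>R h t) = integral {0..s} h"
    if "h absolutely_integrable_on {0..1}" "s \<in> {0..x}" for h :: "real \<Rightarrow> 'a" and s
  proof -
    have "integral\<^sup>L N (\<lambda>t. indicator {0..s} t *\<^sub>R h t) = integral\<^sup>L lebesgue (\<lambda>t. indicator {0..x} t *\<^sub>R indicator {0..s} t *\<^sub>R h t)"
      unfolding N_def by (subst integral_restrict_space) auto
    also have "\<dots> = integral\<^sup>L lebesgue (\<lambda>t. indicator {0..s} t *\<^sub>R h t)"
      using that by (intro Bochner_Integration.integral_cong) (auto simp: indicator_def)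
    also have "\<dots> = integral {0..s} h"
      using set_lebesgue_integral_eq_integral(2)[OF absolutely_integrable_sub01(1)[OF that(1), of 0 s]] that x
      by (auto simp: set_lebesgue_integral_def)
    finally show ?thesis .
  qed
  define H where "H = (\<lambda>(s,t). indicator {p. fst p < snd p} (s,t) *\<^sub>R (f s * g t) :: 'a)"
  have Hm[measurable]: "H \<in> borel_measurable (N \<Otimes>\<^sub>M N)"
  proof -
    have "{p \<in> space (N \<Otimes>\<^sub>M N). fst p < snd p} \<in> sets (N \<Otimes>\<^sub>M N)" by measurable
    then have "(indicator {p. fst p < snd p} :: _ \<Rightarrow> real) \<in> borel_measurable (N \<Otimes>\<^sub>M N)"
      by (subst borel_measurable_indicator_iff) (simp add: Collect_conj_eq Int_commute inf_set_def)
    then show ?thesis unfolding H_def split_beta by measurable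
  qed
  have Hint: "integrable (N \<Otimes>\<^sub>M N) H"
  proof (rule NN.Fubini_integrable[OF Hm])
    have b: "norm (H (s,t)) \<le> norm (f s) * norm (g t)" for s t
      by (auto simp: H_def indicator_def norm_mult)
    have ig: "integrable N (\<lambda>t. H (s,t))" for s
    proof (rule Bochner_Integration.integrable_bound[of _ "\<lambda>t. f s * g t"])
      have "(\<lambda>t. H (s,t)) = (\<lambda>t. (if s < t then f s * g t else 0))" by (auto simp: H_def indicator_def)
      then show "(\<lambda>t. H (s,t)) \<in> borel_measurable N" by simp
    qed (auto simp: b norm_mult)
    show "AE s in N. integrable N (\<lambda>t. H (s,t))" using ig by auto
    show "integrable N (\<lambda>s. \<integral>t. norm (H (s,t)) \<partial>N)"
    proof (rule Bochner_Integration.integrable_bound[of _ "\<lambda>s. norm (f s) * (\<integral>t. norm (g t) \<partial>N)"])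
      show "integrable N (\<lambda>s. norm (f s) * (\<integral>t. norm (g t) \<partial>N))" by auto
      show "(\<lambda>s. \<integral>t. norm (H (s,t)) \<partial>N) \<in> borel_measurable N" by measurable
      have "norm (\<integral>t. norm (H (s,t)) \<partial>N) \<le> norm (norm (f s) * (\<integral>t. norm (g t) \<partial>N))" for s
      proof -
        have "(\<integral>t. norm (H (s,t)) \<partial>N) \<le> (\<integral>t. norm (f s) * norm (g t) \<partial>N)"
          using ig[of s] b by (intro integral_mono) auto
        then show ?thesis by (simp add: abs_of_nonneg)
      qed
      then show "AE s in N. norm (\<integral>t. norm (H (s,t)) \<partial>N) \<le> norm (norm (f s) * (\<integral>t. norm (g t) \<partial>N))" by auto
    qed
  qed
  have fub: "(\<integral>s. (\<integral>t. H (s,t) \<partial>N) \<partial>N) = (\<integral>t. (\<integral>s. H (s,t) \<partial>N) \<partial>N)"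
    using NN.Fubini_integral[of "\<lambda>s t. H (s,t)"] Hint by simp
  have inner1: "(\<integral>t. H (s,t) \<partial>N) = f s * (integral {0..x} g - integral {0..s} g)" if s: "s \<in> {0..x}" for s
  proof -
    have "(\<integral>t. H (s,t) \<partial>N) = (\<integral>t. f s * g t - f s * (indicator {0..s} t *\<^sub>R g t) \<partial>N)"
      by (intro Bochner_Integration.integral_cong) (auto simp: H_def indicator_def N_def)
    also have "\<dots> = f s * integral\<^sup>L N g - f s * (\<integral>t. indicator {0..s} t *\<^sub>R g t \<partial>N)"
      using s by (subst Bochner_Integration.integral_diff) (auto intro!: integrable_mult_indicator simp del: mult_scaleR_right)
    also have "\<dots> = f s * (integral {0..x} g - integral {0..s} g)"
      using int1[OF g s] lebesgue_on_integral_eq(2)[OF fx(2)] by (simp add: N_def algebra_simps)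
    finally show ?thesis .
  qed
  have inner2: "(\<integral>s. H (s,t) \<partial>N) = integral {0..t} f * g t" if t: "t \<in> {0..x}" for t
  proof -
    have "(\<integral>s. H (s,t) \<partial>N) = (\<integral>s. (indicator {0..t} s *\<^sub>R f s) * g t \<partial>N)"
    proof (rule integral_cong_AE)
      have "(\<lambda>s. H (s,t)) = (\<lambda>s. (if s < t then f s * g t else 0))" by (auto simp: H_def indicator_def)
      then show "(\<lambda>s. H (s,t)) \<in> borel_measurable N" by simp
      show "(\<lambda>s. (indicator {0..t} s *\<^sub>R f s) * g t) \<in> borel_measurable N"
        using t by (intro borel_measurable_times borel_measurable_scaleR borel_measurable_indicator) auto
      \<comment> \<open>The triangle is open while \<open>{0..t}\<close> contains its end point; the
        two integrands differ only at \<open>s = t\<close>.\<close>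
      have "AE s in lebesgue. s \<noteq> t"
        by (rule AE_completion[OF AE_lborel_singleton])
      then have "AE s in N. s \<noteq> t" unfolding N_def by (subst AE_restrict_space_iff) auto
      moreover have "AE s in N. s \<in> {0..x}" using AE_space[of N] by (simp add: N_def)
      ultimately show "AE s in N. H (s,t) = (indicator {0..t} s *\<^sub>R f s) * g t"
        by eventually_elim (auto simp: H_def indicator_def)
    qed
    also have "\<dots> = integral {0..t} f * g t"
      using t int1[OF f t] by (subst Bochner_Integration.integral_mult_left) (auto intro!: integrable_mult_indicator)
    finally show ?thesis .
  qed
  have cont: "continuous_on {0..x} (\<lambda>t. integral {0..t} h)" if "h absolutely_integrable_on {0..1}" for h :: "real \<Rightarrow> 'a"
    using indefinite_integral_continuous_1[of h 0 x] absolutely_integrable_sub01(2)[OF that, of 0 x] x by auto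
  have ai: "(\<lambda>t. h t * integral {0..t} k) absolutely_integrable_on {0..x}"
     if "h absolutely_integrable_on {0..1}" "k absolutely_integrable_on {0..1}" for h k :: "real \<Rightarrow> 'a"
  proof -
    have "(\<lambda>t. integral {0..t} k * h t) absolutely_integrable_on {0..x}"
      apply (rule absolutely_integrable_bounded_measurable_product[of "(*)"])
      using cont[OF that(2)] compact_continuous_image[OF cont[OF that(2)]] absolutely_integrable_sub01(1)[OF that(1), of 0 x] x
      by (auto intro!: compact_imp_bounded continuous_imp_measurable_on_sets_lebesgue bounded_bilinear_mult simp: bilinear_conv_bounded_bilinear)
    then show ?thesis by (simp add: mult.commute)
  qed
  have ai1: "(\<lambda>t. f t * integral {0..t} g) absolutely_integrable_on {0..x}" by (rule ai[OF f g])
  have ai2: "(\<lambda>t. integral {0..t} f * g t) absolutely_integrable_on {0..x}" using ai[OF g f] by (simp add: mult.commute)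
  have "(\<integral>s. (\<integral>t. H (s,t) \<partial>N) \<partial>N) = (\<integral>s. f s * integral {0..x} g - f s * integral {0..s} g \<partial>N)"
    by (intro Bochner_Integration.integral_cong) (auto simp: inner1 algebra_simps)
  also have "\<dots> = integral {0..x} f * integral {0..x} g - integral {0..x} (\<lambda>t. f t * integral {0..t} g)"
    using lebesgue_on_integral_eq[OF ai1] lebesgue_on_integral_eq(2)[OF fx(1)] fi
    by (subst Bochner_Integration.integral_diff) (auto simp: N_def)
  finally have L: "(\<integral>s. (\<integral>t. H (s,t) \<partial>N) \<partial>N) = integral {0..x} f * integral {0..x} g - integral {0..x} (\<lambda>t. f t * integral {0..t} g)" .
  have "(\<integral>t. (\<integral>s. H (s,t) \<partial>N) \<partial>N) = (\<integral>t. integral {0..t} f * g t \<partial>N)"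
    by (intro Bochner_Integration.integral_cong) (auto simp: inner2)
  also have "\<dots> = integral {0..x} (\<lambda>t. integral {0..t} f * g t)"
    using lebesgue_on_integral_eq[OF ai2] by (auto simp: N_def)
  finally have R: "(\<integral>t. (\<integral>s. H (s,t) \<partial>N) \<partial>N) = integral {0..x} (\<lambda>t. integral {0..t} f * g t)" .
  have "integral {0..x} (\<lambda>t. f t * integral {0..t} g + integral {0..t} f * g t) =
    integral {0..x} (\<lambda>t. f t * integral {0..t} g) + integral {0..x} (\<lambda>t. integral {0..t} f * g t)"
    using ai1 ai2 set_lebesgue_integral_eq_integral(1) by (intro Henstock_Kurzweil_Integration.integral_add) blast+
  then show ?thesis using L R fub by (simp add: algebra_simps)
qed

lemma prim_ai: "prim g f \<Longrightarrow> g absolutely_integrable_on {0..1}"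
  by (simp add: prim_def)

lemma prim_eval: "prim g f \<Longrightarrow> x \<in> {0..1} \<Longrightarrow> f x = f 0 + integral {0..x} g"
  unfolding prim_def by blast

lemma prim_eval1: "prim g f \<Longrightarrow> integral {0..1} g = f 1 - f 0"
  using prim_eval[of g f 1] by simp

lemma prim_continuous:
  fixes f :: "real \<Rightarrow> 'a::euclidean_space"
  assumes "prim g f" shows "continuous_on {0..1} f"
proof -
  have "continuous_on {0..1} (\<lambda>x. f 0 + integral {0..x} g)"
    by (intro continuous_on_add continuous_on_const indefinite_integral_continuous_1 set_lebesgue_integral_eq_integral(1)[OF prim_ai[OF assms]])
  then show ?thesis by (rule continuous_on_eq) (rule prim_eval[OF assms, symmetric])
qed

lemma ai_mult_continuous:
  fixes f g :: "real \<Rightarrow> 'a::{euclidean_space,real_normed_field}"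
  assumes "g absolutely_integrable_on {0..1}" "continuous_on {0..1} f"
  shows "(\<lambda>t. f t * g t) absolutely_integrable_on {0..1}" "(\<lambda>t. g t * f t) absolutely_integrable_on {0..1}"
proof -
  show "(\<lambda>t. f t * g t) absolutely_integrable_on {0..1}"
  proof (rule absolutely_integrable_bounded_measurable_product[of "(*)"])
    show "bilinear ((*) :: 'a \<Rightarrow> 'a \<Rightarrow> 'a)" by (simp add: bilinear_conv_bounded_bilinear bounded_bilinear_mult)
    show "f \<in> borel_measurable (lebesgue_on {0..1})"
      by (rule continuous_imp_measurable_on_sets_lebesgue[OF assms(2)]) auto
    show "bounded (f ` {0..1})" by (rule compact_imp_bounded[OF compact_continuous_image[OF assms(2)]]) simp
  qed (use assms in auto)
  then show "(\<lambda>t. g t * f t) absolutely_integrable_on {0..1}" by (simp add: mult.commute)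
qed

lemma ai_integrable:
  fixes f :: "real \<Rightarrow> 'a::euclidean_space"
  shows "f absolutely_integrable_on S \<Longrightarrow> f integrable_on S"
  by (rule set_lebesgue_integral_eq_integral(1))

lemma ai_add:
  fixes f g :: "real \<Rightarrow> 'a::euclidean_space"
  shows "f absolutely_integrable_on S \<Longrightarrow> g absolutely_integrable_on S \<Longrightarrow> (\<lambda>x. f x + g x) absolutely_integrable_on S"
  by (rule set_integral_add(1))

lemma ai_diff:
  fixes f g :: "real \<Rightarrow> 'a::euclidean_space"
  shows "f absolutely_integrable_on S \<Longrightarrow> g absolutely_integrable_on S \<Longrightarrow> (\<lambda>x. f x - g x) absolutely_integrable_on S"
  by (rule set_integral_diff(1))

lemma ai_cmult:
  fixes f :: "real \<Rightarrow> 'a::{euclidean_space,real_normed_field}"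
  shows "f absolutely_integrable_on S \<Longrightarrow> (\<lambda>x. c * f x) absolutely_integrable_on S"
  by (rule set_integrable_mult_right)

lemma prim_const: "prim (\<lambda>x. 0) (\<lambda>x. c)"
  by (simp add: prim_def)

lemma prim_add:
  fixes f1 f2 :: "real \<Rightarrow> 'a::euclidean_space"
  assumes "prim g1 f1" "prim g2 f2" shows "prim (\<lambda>x. g1 x + g2 x) (\<lambda>x. f1 x + f2 x)"
  unfolding prim_def
proof (intro conjI ballI)
  show "(\<lambda>x. g1 x + g2 x) absolutely_integrable_on {0..1}" by (intro ai_add prim_ai[OF assms(1)] prim_ai[OF assms(2)])
  fix x :: real assume x: "x \<in> {0..1}"
  have "g1 integrable_on {0..x}" "g2 integrable_on {0..x}"
    using absolutely_integrable_sub01(2)[OF prim_ai[OF assms(1)], of 0 x]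
      absolutely_integrable_sub01(2)[OF prim_ai[OF assms(2)], of 0 x] x by auto
  then show "f1 x + f2 x = f1 0 + f2 0 + integral {0..x} (\<lambda>x. g1 x + g2 x)"
    using prim_eval[OF assms(1) x] prim_eval[OF assms(2) x]
    by (simp add: Henstock_Kurzweil_Integration.integral_add)
qed

lemma prim_linear:
  fixes f :: "real \<Rightarrow> 'a::euclidean_space" and T :: "'a \<Rightarrow> 'b::euclidean_space"
  assumes "prim g f" "bounded_linear T" shows "prim (\<lambda>x. T (g x)) (\<lambda>x. T (f x))"
  unfolding prim_def
proof (intro conjI ballI)
  show "(\<lambda>x. T (g x)) absolutely_integrable_on {0..1}"
    using absolutely_integrable_linear[OF prim_ai[OF assms(1)] assms(2)] by (simp add: o_def)
  fix x :: real assume x: "x \<in> {0..1}"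
  have "g integrable_on {0..x}"
    using absolutely_integrable_sub01(2)[OF prim_ai[OF assms(1)], of 0 x] x by auto
  then show "T (f x) = T (f 0) + integral {0..x} (\<lambda>x. T (g x))"
    using integral_linear[OF _ assms(2), of g "{0..x}"] prim_eval[OF assms(1) x]
    by (simp add: o_def bounded_linear.linear[OF assms(2)] linear_add)
qed

lemma prim_cmult:
  fixes f :: "real \<Rightarrow> 'a::{euclidean_space,real_normed_field}"
  shows "prim g f \<Longrightarrow> prim (\<lambda>x. c * g x) (\<lambda>x. c * f x)"
  using prim_linear[OF _ bounded_linear_mult_right] by blast

text \<open>Each factor is its value at 0 plus its primitive. The product of the two primitives is
  \<open>product_primitive\<close>; the cross terms are multiples of a single primitive.\<close>

lemma prim_mult:
  fixes f1 f2 :: "real \<Rightarrow> 'a::{euclidean_space,real_normed_field}"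
  assumes "prim g1 f1" "prim g2 f2"
  shows "prim (\<lambda>t. g1 t * f2 t + f1 t * g2 t) (\<lambda>t. f1 t * f2 t)"
  unfolding prim_def
proof (intro conjI ballI)
  note ai = prim_ai[OF assms(1)] prim_ai[OF assms(2)]
  note ct = prim_continuous[OF assms(1)] prim_continuous[OF assms(2)]
  show "(\<lambda>t. g1 t * f2 t + f1 t * g2 t) absolutely_integrable_on {0..1}"
    by (intro ai_add ai_mult_continuous ai ct)
  fix x :: real assume x: "x \<in> {0..1}"
  note sub = absolutely_integrable_sub01(2)[of _ 0 x]
  have ci: "continuous_on {0..1} (\<lambda>t. integral {0..t} h)" if "h absolutely_integrable_on {0..1}" for h :: "real \<Rightarrow> 'a"
    by (intro indefinite_integral_continuous_1 set_lebesgue_integral_eq_integral(1) that)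
  have "integral {0..x} (\<lambda>t. g1 t * f2 t + f1 t * g2 t) =
    integral {0..x} (\<lambda>t. (g1 t * integral {0..t} g2 + integral {0..t} g1 * g2 t) + (f2 0 * g1 t + f1 0 * g2 t))"
  proof (rule integral_cong)
    fix t assume t: "t \<in> {0..x}"
    then have t1: "t \<in> {0..1}" using x by auto
    show "g1 t * f2 t + f1 t * g2 t = (g1 t * integral {0..t} g2 + integral {0..t} g1 * g2 t) + (f2 0 * g1 t + f1 0 * g2 t)"
      by (subst (1) prim_eval[OF assms(1) t1], subst (1) prim_eval[OF assms(2) t1]) (simp add: algebra_simps)
  qed
  also have "\<dots> = integral {0..x} (\<lambda>t. g1 t * integral {0..t} g2 + integral {0..t} g1 * g2 t) +
      (f2 0 * integral {0..x} g1 + f1 0 * integral {0..x} g2)"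
    using x ai by (subst Henstock_Kurzweil_Integration.integral_add,
       (intro sub ai_add ai_mult_continuous ai_cmult ci ai; simp),
       (intro sub ai_add ai_mult_continuous ai_cmult ci ai; simp))
      (subst Henstock_Kurzweil_Integration.integral_add, auto intro!: sub ai_cmult)
  also have "integral {0..x} (\<lambda>t. g1 t * integral {0..t} g2 + integral {0..t} g1 * g2 t)
     = integral {0..x} g1 * integral {0..x} g2"
    using product_primitive[OF ai x] by simp
  finally show "f1 x * f2 x = f1 0 * f2 0 + integral {0..x} (\<lambda>t. g1 t * f2 t + f1 t * g2 t)"
    using prim_eval[OF assms(1) x] prim_eval[OF assms(2) x] by (simp add: algebra_simps)
qed

lemma prim_parts:
  fixes f1 f2 :: "real \<Rightarrow> 'a::{euclidean_space,real_normed_field}"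
  assumes "prim g1 f1" "prim g2 f2"
  shows "integral {0..1} (\<lambda>t. f1 t * g2 t) = f1 1 * f2 1 - f1 0 * f2 0 - integral {0..1} (\<lambda>t. g1 t * f2 t)"
proof -
  note ai = prim_ai[OF assms(1)] prim_ai[OF assms(2)]
  note ct = prim_continuous[OF assms(1)] prim_continuous[OF assms(2)]
  have "integral {0..1} (\<lambda>t. g1 t * f2 t + f1 t * g2 t) = integral {0..1} (\<lambda>t. g1 t * f2 t) + integral {0..1} (\<lambda>t. f1 t * g2 t)"
    by (intro Henstock_Kurzweil_Integration.integral_add ai_integrable ai_mult_continuous ai ct)
  then show ?thesis using prim_eval1[OF prim_mult[OF assms]] by (simp add: algebra_simps)
qed

lemma prim_C1:
  fixes f :: "real \<Rightarrow> 'a::euclidean_space"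
  assumes "\<And>x. x \<in> {0..1} \<Longrightarrow> (f has_vector_derivative g x) (at x within {0..1})" "continuous_on {0..1} g"
  shows "prim g f"
  unfolding prim_def
proof (intro conjI ballI)
  show "g absolutely_integrable_on {0..1}" using absolutely_integrable_continuous_real[OF assms(2)] by simp
  fix x :: real assume x: "x \<in> {0..1}"
  have "(g has_integral (f x - f 0)) {0..x}"
    using x by (intro fundamental_theorem_of_calculus) (auto intro: has_vector_derivative_within_subset[OF assms(1)])
  then show "f x = f 0 + integral {0..x} g" by (simp add: integral_unique)
qed

text \<open>The passage from weak to classical solutions: once the weak derivative is continuous,
  the fundamental theorem of calculus makes it the pointwise derivative on
  \<open>[0,1]\<close>.\<close>

lemma prim_C1_derivative:
  fixes f :: "real \<Rightarrow> 'a::euclidean_space"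
  assumes "prim g f" "continuous_on {0..1} g" "x \<in> {0..1}"
  shows "(f has_vector_derivative g x) (at x within {0..1})"
proof -
  have "((\<lambda>u. f 0 + integral {0..u} g) has_vector_derivative g x) (at x within {0..1})"
    using integral_has_vector_derivative[OF assms(2,3)] has_vector_derivative_add[OF has_vector_derivative_const] by fastforce
  then show ?thesis
    by (rule has_vector_derivative_transform[OF assms(3), rotated]) (rule prim_eval[OF assms(1)])
qed

text \<open>Dominated convergence in the defining integral equation; the domination concerns the
  derivatives, while the functions only have to converge pointwise.\<close>

lemma prim_limit:
  fixes f :: "nat \<Rightarrow> real \<Rightarrow> 'a::euclidean_space"
  assumes p: "\<And>m. prim (g m) (f m)" and h: "h integrable_on {0..1}"
    and le: "\<And>m x. x \<in> {0..1} \<Longrightarrow> norm (g m x) \<le> h x"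
    and gl: "\<And>x. x \<in> {0..1} \<Longrightarrow> (\<lambda>m. g m x) \<longlonglongrightarrow> g' x"
    and fl: "\<And>x. x \<in> {0..1} \<Longrightarrow> (\<lambda>m. f m x) \<longlonglongrightarrow> f' x"
  shows "prim g' f'"
  unfolding prim_def
proof (intro conjI ballI)
  have n: "norm (g' x) \<le> h x" if "x \<in> {0..1}" for x
    using LIMSEQ_le_const2[OF tendsto_norm[OF gl[OF that]]] le[OF that] by blast
  show "g' absolutely_integrable_on {0..1}"
    by (rule dominated_convergence_absolutely_integrable[OF prim_ai[OF p] h n gl])
  fix x :: real assume x: "x \<in> {0..1}"
  have "(\<lambda>m. integral {0..x} (g m)) \<longlonglongrightarrow> integral {0..x} g'"
  proof (rule dominated_convergence(2))
    show "g k integrable_on {0..x}" for k using absolutely_integrable_sub01(2)[OF prim_ai[OF p]] x by simp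
    show "h integrable_on {0..x}" using integrable_subinterval_real[OF h] x by auto
  qed (use x le gl in auto)
  then have "(\<lambda>m. f m 0 + integral {0..x} (g m)) \<longlonglongrightarrow> f' 0 + integral {0..x} g'"
    by (intro tendsto_add fl) auto
  moreover have "(\<lambda>m. f m 0 + integral {0..x} (g m)) = (\<lambda>m. f m x)"
    using prim_eval[OF p x] by auto
  ultimately show "f' x = f' 0 + integral {0..x} g'" using fl[OF x] LIMSEQ_unique by metis
qed

text \<open>The product rule yields powers, hence the partial sums of the exponential series. Their
  derivatives are dominated by \<open>exp (norm W) * norm w\<close>, so the chain rule survives the
  limit although \<open>W\<close> is differentiable in the weak sense only.\<close>

lemma prim_exp:
  fixes W :: "real \<Rightarrow> 'a::{euclidean_space,real_normed_field}"
  assumes "prim w W" shows "prim (\<lambda>t. w t * exp (W t)) (\<lambda>t. exp (W t))"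
proof -
  have pw: "prim (\<lambda>t. w t * (W t ^ n /\<^sub>R fact n)) (\<lambda>t. W t ^ Suc n /\<^sub>R fact (Suc n))" for n
  proof (induction n)
    case 0 then show ?case using assms by simp
  next
    case (Suc n)
    have "prim (\<lambda>t. (1 / of_nat (Suc (Suc n))) * (w t * (W t ^ Suc n /\<^sub>R fact (Suc n)) + W t * (w t * (W t ^ n /\<^sub>R fact n))))
       (\<lambda>t. (1 / of_nat (Suc (Suc n))) * (W t * (W t ^ Suc n /\<^sub>R fact (Suc n))))"
      by (intro prim_cmult prim_mult assms Suc)
    moreover have "(1 / of_nat (Suc (Suc n))) * (W t * (W t ^ Suc n /\<^sub>R fact (Suc n))) = W t ^ Suc (Suc n) /\<^sub>R fact (Suc (Suc n))" for t
      by (simp add: scaleR_conv_of_real field_simps)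
    moreover have "(1 / of_nat (Suc (Suc n))) * (w t * (W t ^ Suc n /\<^sub>R fact (Suc n)) + W t * (w t * (W t ^ n /\<^sub>R fact n)))
       = w t * (W t ^ Suc n /\<^sub>R fact (Suc n))" for t
    proof -
      have "W t ^ n /\<^sub>R fact n = of_nat (Suc n) * (W t ^ n /\<^sub>R fact (Suc n))"
        by (simp add: scaleR_conv_of_real field_simps del: of_nat_Suc)
      then have "w t * (W t ^ Suc n /\<^sub>R fact (Suc n)) + W t * (w t * (W t ^ n /\<^sub>R fact n))
         = of_nat (Suc (Suc n)) * (w t * (W t ^ Suc n /\<^sub>R fact (Suc n)))"
        by (simp add: algebra_simps)
      then show ?thesis by (simp add: divide_simps del: of_nat_Suc)
    qed
    ultimately show ?case by simp
  qed
  define S where "S m t = (\<Sum>n<m. W t ^ n /\<^sub>R fact n)" for m t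
  have pS: "prim (\<lambda>t. w t * S m t) (\<lambda>t. S (Suc m) t)" for m
  proof (induction m)
    case 0 then show ?case using prim_const[of 1] by (simp add: S_def)
  next
    case (Suc m)
    show ?case using prim_add[OF Suc pw[of m]] by (simp add: S_def algebra_simps)
  qed
  have Slim: "(\<lambda>m. S m t) \<longlonglongrightarrow> exp (W t)" for t
    using summable_LIMSEQ[OF summable_exp_generic[of "W t"]] unfolding S_def exp_def by simp
  have Sb: "norm (S m t) \<le> exp (norm (W t))" for m t
  proof -
    have "norm (S m t) \<le> (\<Sum>n<m. norm (W t) ^ n /\<^sub>R fact n)"
      unfolding S_def by (rule sum_norm_le) (simp add: norm_power)
    also have "\<dots> \<le> exp (norm (W t))"
      unfolding exp_def by (rule sum_le_suminf[OF summable_exp_generic]) auto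
    finally show ?thesis .
  qed
  show ?thesis
  proof (rule prim_limit[OF pS, where h = "\<lambda>t. exp (norm (W t)) * norm (w t)"])
    show "(\<lambda>t. exp (norm (W t)) * norm (w t)) integrable_on {0..1}"
      using absolutely_integrable_norm[OF prim_ai[OF assms]]
      by (intro ai_integrable ai_mult_continuous continuous_intros prim_continuous[OF assms]) (simp add: o_def)
    show "norm (w x * S m x) \<le> exp (norm (W x)) * norm (w x)" for m x
      using mult_left_mono[OF Sb[of m x], of "norm (w x)"] by (simp add: norm_mult mult.commute)
    show "(\<lambda>m. w x * S m x) \<longlonglongrightarrow> w x * exp (W x)" for x by (intro tendsto_intros Slim)
    show "(\<lambda>m. S (Suc m) x) \<longlonglongrightarrow> exp (W x)" for x using Slim by (rule LIMSEQ_Suc)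
  qed
qed

text \<open>The integral vanishes over every half-line, and the sets over which it vanishes are
  closed under complements and countable disjoint unions. By Dynkin's argument it vanishes over all
  Borel sets, and a Lebesgue set differs from a Borel set by a null set.\<close>

lemma zero_integral_ae_zero:
  fixes g :: "real \<Rightarrow> 'a::euclidean_space"
  assumes g: "g absolutely_integrable_on {0..1}" and z: "\<And>x. x \<in> {0..1} \<Longrightarrow> integral {0..x} g = 0"
  shows "AE x in lebesgue. x \<in> {0..1} \<longrightarrow> g x = 0"
proof -
  let ?f = "\<lambda>x. indicator {0..1} x *\<^sub>R g x"
  have fi: "integrable lebesgue ?f" using g by (simp add: set_integrable_def)
  define P where "P A \<longleftrightarrow> (LINT x:A|lebesgue. ?f x) = 0" for A
  have sif: "set_integrable lebesgue A ?f" if "A \<in> sets lebesgue" for A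
    unfolding set_integrable_def by (intro integrable_mult_indicator that fi)
  have PI: "(LINT x:{..a}|lebesgue. ?f x) = 0" for a
  proof -
    have "(LINT x:{..a}|lebesgue. ?f x) = (LINT x:{0..min a 1}|lebesgue. g x)"
      unfolding set_lebesgue_integral_def by (intro Bochner_Integration.integral_cong) (auto simp: indicator_def)
    also have "\<dots> = integral {0..min a 1} g"
      by (rule set_lebesgue_integral_eq_integral(2)[OF absolutely_integrable_sub01(1)[OF g]]) auto
    also have "\<dots> = 0" using z[of "min a 1"] by (cases "a \<ge> 0") auto
    finally show ?thesis .
  qed
  have tot: "(LINT x:UNIV|lebesgue. ?f x) = 0"
  proof -
    have "(LINT x:UNIV|lebesgue. ?f x) = (LINT x:{..1}|lebesgue. ?f x)"
      unfolding set_lebesgue_integral_def by (intro Bochner_Integration.integral_cong) (auto simp: indicator_def)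
    then show ?thesis using PI by simp
  qed
  have Pb: "P A" if "A \<in> sets borel" for A
  proof -
    from that have A: "A \<in> sigma_sets UNIV (range (\<lambda>a. {..a::real}))"
      by (simp add: borel_eq_atMost)
    have st: "Int_stable (range (\<lambda>a. {..a::real}))" by (auto simp: Int_stable_def)
    have pw: "range (\<lambda>a. {..a::real}) \<subseteq> Pow UNIV" by simp
    from st pw A show ?thesis
    proof (induction rule: sigma_sets_induct_disjoint)
      case (basic A) then show ?case using PI by (auto simp: P_def)
    next case empty then show ?case by (simp add: P_def set_lebesgue_integral_def)
    next
      case (compl A)
      note 5 = compl
      have "A \<in> sets borel" using 5(1) by (simp add: borel_eq_atMost)
      then have Ab: "A \<in> sets lebesgue" by simp
      have "(LINT x:A \<union> (UNIV - A)|lebesgue. ?f x) = (LINT x:A|lebesgue. ?f x) + (LINT x:UNIV - A|lebesgue. ?f x)"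
        using Ab by (intro set_integral_Un sif) auto
      then show ?case using 5 tot by (simp add: P_def)
    next
      case (union A)
      note 6 = union
      have "A i \<in> sets borel" for i using 6(2) by (auto simp: borel_eq_atMost)
      then have Ab: "A i \<in> sets lebesgue" for i by simp
      have "(LINT x:(\<Union>i. A i)|lebesgue. ?f x) = (\<Sum>i. (LINT x:(A i)|lebesgue. ?f x))"
        using Ab 6(1) by (intro lebesgue_integral_countable_add sif) (auto simp: disjoint_family_on_def)
      then show ?case using 6(3) by (simp add: P_def)
    qed
  qed
  interpret N: finite_measure "lebesgue_on {0..1::real}" by (rule finite_measure_lebesgue_on) auto
  have "AE x in lebesgue_on {0..1}. g x = 0"
  proof (rule N.density_zero)
    show "integrable (lebesgue_on {0..1}) g" using lebesgue_on_integral_eq[OF g] by simp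
    fix A :: "real set" assume AN: "A \<in> sets (lebesgue_on {0..1})"
    then have A: "A \<in> sets lebesgue" by (auto simp: sets_restrict_space)
    then obtain S N N' where SN: "A = S \<union> N" "N \<subseteq> N'" "N' \<in> null_sets lborel" "S \<in> sets lborel"
      by (rule sets_completionE)
    have nl: "N \<in> null_sets lebesgue" using SN(2,3) null_sets_completion_subset[of N N' lborel] null_sets_completionI by blast
    have "(LINT x:A|lebesgue. ?f x) = (LINT x:S|lebesgue. ?f x)"
    proof (rule set_integral_null_delta[OF fi A])
      show "S \<in> sets lebesgue" using SN(4) by simp
      show "(A - S) \<union> (S - A) \<in> null_sets lebesgue"
        by (rule null_sets_completion_subset[OF _ nl]) (use SN in auto)
    qed
    then have "(LINT x:A|lebesgue. ?f x) = 0" using Pb SN(4) by (simp add: P_def)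
    moreover have "(LINT x:A|lebesgue_on {0..1}. g x) = (LINT x:A|lebesgue. ?f x)"
      unfolding set_lebesgue_integral_def by (subst integral_restrict_space) (auto simp: mult.commute)
    ultimately show "(LINT x:A|lebesgue_on {0..1}. g x) = 0" by simp
  qed
  then show ?thesis by (subst (asm) AE_restrict_space_iff) auto
qed

text \<open>This makes the choice operator in \<open>wderiv\<close> harmless: the chosen weak
  derivative agrees almost everywhere with any other.\<close>

lemma prim_unique:
  fixes f :: "real \<Rightarrow> 'a::euclidean_space"
  assumes "prim g f" "prim g' f"
  shows "AE x in lebesgue. x \<in> {0..1} \<longrightarrow> g x = g' x"
proof -
  have "AE x in lebesgue. x \<in> {0..1} \<longrightarrow> g x - g' x = 0"
  proof (rule zero_integral_ae_zero)
    show "(\<lambda>x. g x - g' x) absolutely_integrable_on {0..1}" by (intro ai_diff prim_ai[OF assms(1)] prim_ai[OF assms(2)])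
    fix x :: real assume x: "x \<in> {0..1}"
    have "integral {0..x} (\<lambda>x. g x - g' x) = integral {0..x} g - integral {0..x} g'"
      using absolutely_integrable_sub01(2)[OF prim_ai[OF assms(1)], of 0 x]
        absolutely_integrable_sub01(2)[OF prim_ai[OF assms(2)], of 0 x] x
      by (intro Henstock_Kurzweil_Integration.integral_diff) auto
    then show "integral {0..x} (\<lambda>x. g x - g' x) = 0"
      using prim_eval[OF assms(1) x] prim_eval[OF assms(2) x] by simp
  qed
  then show ?thesis by eventually_elim auto
qed

lemma ae01E:
  assumes "AE x in lebesgue. x \<in> {0..1} \<longrightarrow> P (x::real)"
  obtains N where "negligible N" "\<And>x. x \<in> {0..1} \<Longrightarrow> x \<notin> N \<Longrightarrow> P x"
proof -
  obtain N where N: "N \<in> null_sets lebesgue" "\<And>x. x \<in> space lebesgue - N \<Longrightarrow> x \<in> {0..1} \<longrightarrow> P x"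
    using AE_E3[OF assms] by blast
  show thesis
  proof (rule that[of N])
    show "negligible N" using N(1) by (simp add: negligible_iff_null_sets)
    show "P x" if "x \<in> {0..1}" "x \<notin> N" for x :: real using N(2)[of x] that by simp
  qed
qed

lemma integral_cong_ae01:
  fixes f g :: "real \<Rightarrow> 'a::euclidean_space"
  assumes "AE x in lebesgue. x \<in> {0..1} \<longrightarrow> f x = g x" "0 \<le> a" "b \<le> 1"
  shows "integral {a..b} f = integral {a..b} g"
proof -
  obtain N where N: "negligible N" "\<And>x. x \<in> {0..1} \<Longrightarrow> x \<notin> N \<Longrightarrow> g x = f x"
    using ae01E[OF assms(1)] by metis
  show ?thesis
  proof (rule integral_spike[of N])
    show "g x = f x" if "x \<in> {a..b} - N" for x using N(2)[of x] that assms(2,3) by simp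
    show "negligible N" by (rule N(1))
  qed
qed

lemma ai_cong_ae01:
  fixes f g :: "real \<Rightarrow> 'a::euclidean_space"
  assumes "AE x in lebesgue. x \<in> {0..1} \<longrightarrow> f x = g x" "f absolutely_integrable_on {0..1}"
  shows "g absolutely_integrable_on {0..1}"
proof -
  obtain N where N: "negligible N" "\<And>x. x \<in> {0..1} \<Longrightarrow> x \<notin> N \<Longrightarrow> g x = f x"
    using ae01E[OF assms(1)] by metis
  show ?thesis
  proof (rule absolutely_integrable_spike[OF assms(2), of N])
    show "g x = f x" if "x \<in> {0..1} - N" for x using N(2)[of x] that by simp
    show "negligible N" by (rule N(1))
  qed
qed

lemma prim_cong:
  fixes f f' :: "real \<Rightarrow> 'a::euclidean_space"
  assumes "prim g f" "AE x in lebesgue. x \<in> {0..1} \<longrightarrow> g x = g' x" "\<And>x. x \<in> {0..1} \<Longrightarrow> f x = f' x"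
  shows "prim g' f'"
  unfolding prim_def
proof (intro conjI ballI)
  show "g' absolutely_integrable_on {0..1}" by (rule ai_cong_ae01[OF assms(2) prim_ai[OF assms(1)]])
  fix x :: real assume x: "x \<in> {0..1}"
  have e: "f x = f' x" "f 0 = f' 0" using assms(3) x by auto
  have i: "integral {0..x} g = integral {0..x} g'" using integral_cong_ae01[OF assms(2), of 0 x] x by simp
  show "f' x = f' 0 + integral {0..x} g'"
    using prim_eval[OF assms(1) x] unfolding e i .
qed

lemma prim_integral:
  fixes g :: "real \<Rightarrow> 'a::euclidean_space"
  assumes "g absolutely_integrable_on {0..1}" shows "prim g (\<lambda>x. c + integral {0..x} g)"
  using assms by (simp add: prim_def)

subsection \<open>Square-integrable functions\<close>

text \<open>Polymorphic in the values because real functions carry the Riesz argument, whereas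
  complex ones are the elements of \<open>L2I\<close>.\<close>

definition sqint :: "(real \<Rightarrow> 'a::euclidean_space) \<Rightarrow> bool" where
  "sqint f \<longleftrightarrow> f \<in> borel_measurable (lebesgue_on {0..1}) \<and> integrable (lebesgue_on {0..1}) (\<lambda>x. (norm (f x))\<^sup>2)"

lemma L2I_iff: "L2I f \<longleftrightarrow> sqint f"
  unfolding L2I_def sqint_def set_borel_measurable_def set_integrable_def
  by (simp add: borel_measurable_restrict_space_iff integrable_restrict_space)

lemma integrable01_iff:
  fixes f :: "real \<Rightarrow> 'a::euclidean_space"
  shows "f absolutely_integrable_on {0..1} \<longleftrightarrow> integrable (lebesgue_on {0..1}) f"
  by (simp add: set_integrable_def integrable_restrict_space)

lemma sqint_ai_sq: "sqint f \<Longrightarrow> (\<lambda>x. (norm (f x))\<^sup>2) absolutely_integrable_on {0..1}"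
  by (simp add: sqint_def integrable01_iff)

lemma sqint_measurable: "sqint f \<Longrightarrow> f \<in> borel_measurable (lebesgue_on {0..1})"
  by (simp add: sqint_def)

lemma finite_lebesgue_on01: "finite_measure (lebesgue_on {0..1::real})"
  by (rule finite_measure_lebesgue_on) auto

lemma sqint_prod:
  fixes f g :: "real \<Rightarrow> 'a::{euclidean_space,real_normed_field}"
  assumes f: "sqint f" and g: "sqint g" shows "(\<lambda>x. f x * g x) absolutely_integrable_on {0..1}"
  unfolding integrable01_iff
proof (rule Bochner_Integration.integrable_bound[of _ "\<lambda>x. (norm (f x))\<^sup>2 + (norm (g x))\<^sup>2"])
  show "integrable (lebesgue_on {0..1}) (\<lambda>x. (norm (f x))\<^sup>2 + (norm (g x))\<^sup>2)"
    using f g by (simp add: sqint_def)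
  show "(\<lambda>x. f x * g x) \<in> borel_measurable (lebesgue_on {0..1})"
    using f g by (intro borel_measurable_times) (auto simp: sqint_def)
  have "norm (f x * g x) \<le> (norm (f x))\<^sup>2 + (norm (g x))\<^sup>2" for x
  proof -
    have "2 * (norm (f x) * norm (g x)) \<le> (norm (f x))\<^sup>2 + (norm (g x))\<^sup>2"
      using zero_le_power2[of "norm (f x) - norm (g x)"] by (simp add: power2_diff algebra_simps)
    moreover have "0 \<le> norm (f x) * norm (g x)" by simp
    ultimately show ?thesis unfolding norm_mult by linarith
  qed
  then show "AE x in lebesgue_on {0..1}. norm (f x * g x) \<le> norm ((norm (f x))\<^sup>2 + (norm (g x))\<^sup>2)"
    by (intro AE_I2) simp
qed

lemma sqint_bound:
  fixes f :: "real \<Rightarrow> 'a::euclidean_space" and g :: "real \<Rightarrow> 'b::euclidean_space"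
  assumes "sqint g" "f \<in> borel_measurable (lebesgue_on {0..1})" "\<And>x. x \<in> {0..1} \<Longrightarrow> norm (f x) \<le> K * norm (g x)"
  shows "sqint f"
  unfolding sqint_def
proof (intro conjI assms(2))
  show "integrable (lebesgue_on {0..1}) (\<lambda>x. (norm (f x))\<^sup>2)"
  proof (rule Bochner_Integration.integrable_bound[of _ "\<lambda>x. K\<^sup>2 * (norm (g x))\<^sup>2"])
    show "integrable (lebesgue_on {0..1}) (\<lambda>x. K\<^sup>2 * (norm (g x))\<^sup>2)" using assms(1) by (simp add: sqint_def)
    show "(\<lambda>x. (norm (f x))\<^sup>2) \<in> borel_measurable (lebesgue_on {0..1})" using assms(2) by measurable
    have "(norm (f x))\<^sup>2 \<le> K\<^sup>2 * (norm (g x))\<^sup>2" if "x \<in> {0..1}" for x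
      using power_mono[OF assms(3)[OF that], of 2] by (simp add: power_mult_distrib)
    then show "AE x in lebesgue_on {0..1}. norm ((norm (f x))\<^sup>2) \<le> norm (K\<^sup>2 * (norm (g x))\<^sup>2)"
      by (intro AE_I2) auto
  qed
qed

lemma sqint_continuous:
  fixes f :: "real \<Rightarrow> 'a::euclidean_space"
  assumes "continuous_on {0..1} f" shows "sqint f"
  unfolding sqint_def
proof
  show "f \<in> borel_measurable (lebesgue_on {0..1})"
    by (rule continuous_imp_measurable_on_sets_lebesgue[OF assms]) auto
  have "continuous_on {0..1} (\<lambda>x. (norm (f x))\<^sup>2)" by (intro continuous_intros assms)
  then show "integrable (lebesgue_on {0..1}) (\<lambda>x. (norm (f x))\<^sup>2)"
    using absolutely_integrable_continuous_real integrable01_iff by blast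
qed

lemma sqint_mult_continuous:
  fixes f g :: "real \<Rightarrow> 'a::{euclidean_space,real_normed_field}"
  assumes "sqint g" "continuous_on {0..1} f" shows "sqint (\<lambda>x. f x * g x)"
proof -
  have "bounded (f ` {0..1})" by (rule compact_imp_bounded[OF compact_continuous_image[OF assms(2)]]) simp
  then obtain K where K: "\<And>x. x \<in> {0..1} \<Longrightarrow> norm (f x) \<le> K" unfolding bounded_iff by blast
  show ?thesis
  proof (rule sqint_bound[OF assms(1), where K = K])
    show "(\<lambda>x. f x * g x) \<in> borel_measurable (lebesgue_on {0..1})"
      using sqint_measurable[OF assms(1)] sqint_measurable[OF sqint_continuous[OF assms(2)]] by measurable
    show "norm (f x * g x) \<le> K * norm (g x)" if "x \<in> {0..1}" for x
      using K[OF that] by (simp add: norm_mult mult_right_mono)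
  qed
qed

lemma sqint_cmult:
  fixes f :: "real \<Rightarrow> 'a::{euclidean_space,real_normed_field}"
  shows "sqint f \<Longrightarrow> sqint (\<lambda>x. c * f x)"
  by (rule sqint_mult_continuous) auto

lemma sqint_add:
  fixes f g :: "real \<Rightarrow> 'a::euclidean_space"
  assumes f: "sqint f" and g: "sqint g" shows "sqint (\<lambda>x. f x + g x)"
  unfolding sqint_def
proof
  show "(\<lambda>x. f x + g x) \<in> borel_measurable (lebesgue_on {0..1})"
    using f g by (intro borel_measurable_add) (auto simp: sqint_def)
  show "integrable (lebesgue_on {0..1}) (\<lambda>x. (norm (f x + g x))\<^sup>2)"
  proof (rule Bochner_Integration.integrable_bound[of _ "\<lambda>x. 2 * (norm (f x))\<^sup>2 + 2 * (norm (g x))\<^sup>2"])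
    show "integrable (lebesgue_on {0..1}) (\<lambda>x. 2 * (norm (f x))\<^sup>2 + 2 * (norm (g x))\<^sup>2)"
      using f g by (simp add: sqint_def)
    show "(\<lambda>x. (norm (f x + g x))\<^sup>2) \<in> borel_measurable (lebesgue_on {0..1})"
      using sqint_measurable[OF f] sqint_measurable[OF g] by measurable
    have "(norm (f x + g x))\<^sup>2 \<le> 2 * (norm (f x))\<^sup>2 + 2 * (norm (g x))\<^sup>2" for x
    proof -
      have "(norm (f x + g x))\<^sup>2 \<le> (norm (f x) + norm (g x))\<^sup>2" by (intro power_mono norm_triangle_ineq) simp
      moreover have "0 \<le> (norm (f x) - norm (g x))\<^sup>2" by simp
      ultimately show ?thesis by (simp add: power2_sum power2_diff)
    qed
    then show "AE x in lebesgue_on {0..1}. norm ((norm (f x + g x))\<^sup>2) \<le> norm (2 * (norm (f x))\<^sup>2 + 2 * (norm (g x))\<^sup>2)"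
      by (intro AE_I2) simp
  qed
qed

lemma sqint_diff:
  fixes f g :: "real \<Rightarrow> 'a::{euclidean_space,real_normed_field}"
  assumes f: "sqint f" and g: "sqint g" shows "sqint (\<lambda>x. f x - g x)"
  using sqint_add[OF f sqint_cmult[OF g, of "-1"]] by simp

lemma sqint_ai:
  fixes f :: "real \<Rightarrow> 'a::{euclidean_space,real_normed_field}"
  assumes "sqint f" shows "f absolutely_integrable_on {0..1}"
  using sqint_prod[OF assms sqint_continuous[OF continuous_on_const[of _ 1]]] by simp

lemma sqint_linear:
  fixes f :: "real \<Rightarrow> 'a::euclidean_space" and T :: "'a \<Rightarrow> 'b::euclidean_space"
  assumes "sqint f" "bounded_linear T" shows "sqint (\<lambda>x. T (f x))"
proof -
  obtain K where K: "\<And>x. norm (T x) \<le> norm x * K" using bounded_linear.bounded[OF assms(2)] by blast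
  show ?thesis
  proof (rule sqint_bound[OF assms(1), where K=K])
    show "(\<lambda>x. T (f x)) \<in> borel_measurable (lebesgue_on {0..1})"
      using measurable_compose[OF sqint_measurable[OF assms(1)] borel_measurable_continuous_onI[OF linear_continuous_on[OF assms(2)]]] .
    show "norm (T (f x)) \<le> K * norm (f x)" for x using K[of "f x"] by (simp add: mult.commute)
  qed
qed

section \<open>The real inner product, completeness and the Riesz representation\<close>

definition ip01 :: "(real \<Rightarrow> real) \<Rightarrow> (real \<Rightarrow> real) \<Rightarrow> real" where
  "ip01 f g = integral {0..1} (\<lambda>x. f x * g x)"

lemma ip01_sym: "ip01 f g = ip01 g f"
  by (simp add: ip01_def mult.commute)

lemma ip01_add: "sqint f \<Longrightarrow> sqint g \<Longrightarrow> sqint h \<Longrightarrow> ip01 (\<lambda>x. f x + g x) h = ip01 f h + ip01 g h"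
  unfolding ip01_def distrib_right
  by (intro Henstock_Kurzweil_Integration.integral_add ai_integrable sqint_prod)

lemma ip01_cmult: "ip01 (\<lambda>x. c * f x) h = c * ip01 f h"
  by (simp add: ip01_def mult.assoc)

lemma ip01_diff: "sqint f \<Longrightarrow> sqint g \<Longrightarrow> sqint h \<Longrightarrow> ip01 (\<lambda>x. f x - g x) h = ip01 f h - ip01 g h"
  unfolding ip01_def left_diff_distrib
  by (intro Henstock_Kurzweil_Integration.integral_diff ai_integrable sqint_prod)

lemma ip01_nonneg: "0 \<le> ip01 f f"
  unfolding ip01_def by (cases "(\<lambda>x. f x * f x) integrable_on {0..1}")
    (auto intro: Henstock_Kurzweil_Integration.integral_nonneg simp: not_integrable_integral)

lemma ip01_expand:
  assumes "sqint f" "sqint g"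
  shows "ip01 (\<lambda>x. f x + t * g x) (\<lambda>x. f x + t * g x) = ip01 f f + 2 * t * ip01 f g + t\<^sup>2 * ip01 g g"
proof -
  have s: "sqint (\<lambda>x. t * g x)" "sqint (\<lambda>x. f x + t * g x)" using assms by (auto intro: sqint_add sqint_cmult)
  have "ip01 (\<lambda>x. f x + t * g x) (\<lambda>x. f x + t * g x) = ip01 f (\<lambda>x. f x + t * g x) + t * ip01 g (\<lambda>x. f x + t * g x)"
    using ip01_add[OF assms(1) s] by (simp add: ip01_cmult)
  also have "\<dots> = ip01 (\<lambda>x. f x + t * g x) f + t * ip01 (\<lambda>x. f x + t * g x) g"
    by (simp add: ip01_sym)
  also have "ip01 (\<lambda>x. f x + t * g x) f = ip01 f f + t * ip01 g f"
    using ip01_add[OF assms(1) s(1) assms(1)] by (simp add: ip01_cmult)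
  also have "ip01 (\<lambda>x. f x + t * g x) g = ip01 f g + t * ip01 g g"
    using ip01_add[OF assms(1) s(1) assms(2)] by (simp add: ip01_cmult)
  finally show ?thesis using ip01_sym[of f g] by (simp add: algebra_simps power2_eq_square)
qed

lemma quadratic_nonneg_discriminant:
  fixes a b c :: real
  assumes "\<And>t. 0 \<le> a + 2 * t * b + t\<^sup>2 * c" "0 \<le> c"
  shows "b\<^sup>2 \<le> a * c"
proof (cases "c = 0")
  case True
  have "b = 0"
  proof (rule ccontr)
    assume "b \<noteq> 0"
    \<comment> \<open>For \<open>c = 0\<close> the expression is affine in \<open>t\<close>; this
      \<open>t\<close> gives it the value -1.\<close>
    then show False using assms(1)[of "- (a + 1) / (2 * b)"] True by (simp add: field_simps)
  qed
  then show ?thesis using True by simp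
next
  case False
  then have c: "c > 0" using assms(2) by simp
  have "0 \<le> a + 2 * (- b / c) * b + (- b / c)\<^sup>2 * c" by (rule assms(1))
  also have "\<dots> = a - b\<^sup>2 / c" using c by (simp add: power2_eq_square field_simps)
  finally show ?thesis using c by (simp add: field_simps)
qed

lemma ip01_cauchy_schwarz:
  assumes "sqint f" "sqint g"
  shows "(ip01 f g)\<^sup>2 \<le> ip01 f f * ip01 g g" "\<bar>ip01 f g\<bar> \<le> sqrt (ip01 f f) * sqrt (ip01 g g)"
proof -
  show 1: "(ip01 f g)\<^sup>2 \<le> ip01 f f * ip01 g g"
  proof (rule quadratic_nonneg_discriminant)
    show "0 \<le> ip01 f f + 2 * t * ip01 f g + t\<^sup>2 * ip01 g g" for t
      using ip01_nonneg[of "\<lambda>x. f x + t * g x"] unfolding ip01_expand[OF assms] .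
  qed (rule ip01_nonneg)
  show "\<bar>ip01 f g\<bar> \<le> sqrt (ip01 f f) * sqrt (ip01 g g)"
    using real_sqrt_le_mono[OF 1] by (simp add: real_sqrt_mult)
qed

lemma ip01_minkowski:
  assumes "sqint f" "sqint g"
  shows "sqrt (ip01 (\<lambda>x. f x + g x) (\<lambda>x. f x + g x)) \<le> sqrt (ip01 f f) + sqrt (ip01 g g)"
proof (rule real_le_lsqrt)
  show "0 \<le> sqrt (ip01 f f) + sqrt (ip01 g g)" using ip01_nonneg by simp
  have "ip01 (\<lambda>x. f x + g x) (\<lambda>x. f x + g x) = ip01 f f + 2 * ip01 f g + ip01 g g"
    using ip01_expand[OF assms, of 1] by simp
  also have "\<dots> \<le> ip01 f f + 2 * (sqrt (ip01 f f) * sqrt (ip01 g g)) + ip01 g g"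
    using ip01_cauchy_schwarz(2)[OF assms] by simp
  also have "\<dots> = (sqrt (ip01 f f) + sqrt (ip01 g g))\<^sup>2"
    using ip01_nonneg by (simp add: power2_sum)
  finally show "ip01 (\<lambda>x. f x + g x) (\<lambda>x. f x + g x) \<le> (sqrt (ip01 f f) + sqrt (ip01 g g))\<^sup>2" .
qed

lemma ip01_lebesgue:
  assumes "sqint f" "sqint g" shows "ip01 f g = integral\<^sup>L (lebesgue_on {0..1}) (\<lambda>x. f x * g x)"
  unfolding ip01_def using lebesgue_on_integral_eq(2)[OF sqint_prod[OF assms]] by simp

text \<open>Riesz-Fischer for rapidly convergent sequences. Increments of norm at most
  \<open>(1/2)^n\<close> have an absolutely convergent sum almost everywhere, and Fatou's lemma
  carries the norm estimates over to the pointwise limit.\<close>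

lemma L2_complete:
  assumes g: "\<And>n. sqint (g n)" and c: "\<And>n. ip01 (\<lambda>x. g (Suc n) x - g n x) (\<lambda>x. g (Suc n) x - g n x) \<le> (1/4)^n"
  obtains w :: "real \<Rightarrow> real" where "sqint w" "(\<lambda>n. ip01 (\<lambda>x. w x - g n x) (\<lambda>x. w x - g n x)) \<longlonglongrightarrow> 0"
proof -
  let ?M = "lebesgue_on {0..1::real}"
  interpret M: finite_measure ?M by (rule finite_lebesgue_on01)
  define u where "u n x = g (Suc n) x - g n x" for n x
  have u: "sqint (u n)" for n unfolding u_def by (intro sqint_diff g)
  have gm[measurable]: "g n \<in> borel_measurable ?M" for n using g sqint_measurable by blast
  have um[measurable]: "u n \<in> borel_measurable ?M" for n using u sqint_measurable by blast
  have uc: "ip01 (u n) (u n) \<le> (1/4)^n" for n using c[of n] unfolding u_def .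
  have sq4: "sqrt ((1/4)^n) = (1/2)^n" for n
    by (simp add: real_sqrt_power real_sqrt_divide)
  \<comment> \<open>On an interval of length 1, Cauchy-Schwarz against the constant 1 bounds the L1
    norm by the L2 norm.\<close>
  have u1: "integral\<^sup>L ?M (\<lambda>x. \<bar>u n x\<bar>) \<le> (1/2)^n" for n
  proof -
    have s1: "sqint (\<lambda>x::real. 1::real)" by (rule sqint_continuous) simp
    have sa: "sqint (\<lambda>x. \<bar>u n x\<bar>)"
      by (rule sqint_bound[OF u[of n], where K = 1]) auto
    have "integral\<^sup>L ?M (\<lambda>x. \<bar>u n x\<bar>) = ip01 (\<lambda>x. \<bar>u n x\<bar>) (\<lambda>x. 1)"
      using ip01_lebesgue[OF sa s1] by simp
    also have "\<dots> \<le> sqrt (ip01 (\<lambda>x. \<bar>u n x\<bar>) (\<lambda>x. \<bar>u n x\<bar>)) * sqrt (ip01 (\<lambda>x. 1) (\<lambda>x. 1))"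
      using ip01_cauchy_schwarz(2)[OF sa s1] by simp
    also have "\<dots> = sqrt (ip01 (u n) (u n))" by (simp add: ip01_def)
    also have "\<dots> \<le> (1/2)^n" using real_sqrt_le_mono[OF uc[of n]] sq4 by simp
    finally show ?thesis .
  qed
  have "(\<integral>\<^sup>+x. (\<Sum>n. ennreal \<bar>u n x\<bar>) \<partial>?M) = (\<Sum>n. \<integral>\<^sup>+x. ennreal \<bar>u n x\<bar> \<partial>?M)"
    by (rule nn_integral_suminf) measurable
  also have "\<dots> \<le> (\<Sum>n. ennreal ((1/2)^n))"
  proof (rule suminf_le)
    fix n
    have "(\<integral>\<^sup>+x. ennreal \<bar>u n x\<bar> \<partial>?M) = ennreal (integral\<^sup>L ?M (\<lambda>x. \<bar>u n x\<bar>))"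
      using sqint_ai[OF u[of n]] by (intro nn_integral_eq_integral) (auto simp: integrable01_iff)
    then show "(\<integral>\<^sup>+x. ennreal \<bar>u n x\<bar> \<partial>?M) \<le> ennreal ((1/2)^n)" using u1[of n] by (simp add: ennreal_leI)
  qed auto
  also have "\<dots> = ennreal (\<Sum>n. (1/2)^n)" by (rule suminf_ennreal_eq) (auto intro: summable_sums summable_geometric)
  also have "\<dots> < \<infinity>" by simp
  finally have fin: "(\<integral>\<^sup>+x. (\<Sum>n. ennreal \<bar>u n x\<bar>) \<partial>?M) < \<infinity>" .
  have "AE x in ?M. (\<Sum>n. ennreal \<bar>u n x\<bar>) \<noteq> \<infinity>"
    by (rule nn_integral_PInf_AE) (use fin in auto)
  then have conv: "AE x in ?M. convergent (\<lambda>n. g n x)"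
  proof eventually_elim
    fix x assume "(\<Sum>n. ennreal \<bar>u n x\<bar>) \<noteq> \<infinity>"
    then have "summable (\<lambda>n. \<bar>u n x\<bar>)" by (intro summable_suminf_not_top) auto
    then have "summable (\<lambda>n. u n x)" by (rule summable_rabs_cancel)
    then have "convergent (\<lambda>n. \<Sum>k<n. u k x)" by (simp add: summable_iff_convergent)
    moreover have "(\<lambda>n. \<Sum>k<n. u k x) = (\<lambda>n. g n x - g 0 x)"
      unfolding u_def by (rule ext) (rule sum_lessThan_telescope)
    ultimately show "convergent (\<lambda>n. g n x)" by (simp add: convergent_diff_const_right_iff)
  qed
  define w where "w x = lim (\<lambda>n. g n x)" for x
  have wm[measurable]: "w \<in> borel_measurable ?M" unfolding w_def by (rule borel_measurable_lim_metric) simp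
  \<comment> \<open>The bound is the sum of \<open>(1/2)^j\<close> over the \<open>k\<close> indices
    starting at \<open>n\<close>, in the closed form that telescopes in the induction.\<close>
  have dist: "sqrt (ip01 (\<lambda>x. g (n + k) x - g n x) (\<lambda>x. g (n + k) x - g n x)) \<le> 2 * (1/2)^n - 2 * (1/2)^(n+k)" for n k
  proof (induction k)
    case 0 then show ?case by (simp add: ip01_def)
  next
    case (Suc k)
    have "sqrt (ip01 (\<lambda>x. (g (n + k) x - g n x) + u (n+k) x) (\<lambda>x. (g (n + k) x - g n x) + u (n + k) x)) \<le>
       sqrt (ip01 (\<lambda>x. g (n + k) x - g n x) (\<lambda>x. g (n + k) x - g n x)) + sqrt (ip01 (u (n+k)) (u (n+k)))"
      by (rule ip01_minkowski) (intro sqint_diff g u)+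
    also have "\<dots> \<le> 2 * (1/2)^n - 2 * (1/2)^(n+k) + (1/2)^(n+k)"
      using Suc real_sqrt_le_mono[OF uc[of "n+k"]] sq4 by (intro add_mono) auto
    finally show ?case by (simp add: u_def)
  qed
  have est: "(\<integral>\<^sup>+x. ennreal ((w x - g n x)\<^sup>2) \<partial>?M) \<le> ennreal ((2 * (1/2)^n)\<^sup>2)" for n
  proof -
    have "(\<integral>\<^sup>+x. ennreal ((w x - g n x)\<^sup>2) \<partial>?M) = (\<integral>\<^sup>+x. liminf (\<lambda>k. ennreal ((g (n+k) x - g n x)\<^sup>2)) \<partial>?M)"
    proof (rule nn_integral_cong_AE, use conv in eventually_elim)
      fix x assume "convergent (\<lambda>n. g n x)"
      then have "(\<lambda>k. g k x) \<longlonglongrightarrow> w x" unfolding w_def by (simp add: convergent_LIMSEQ_iff)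
      then have "(\<lambda>k. g (n+k) x) \<longlonglongrightarrow> w x" using LIMSEQ_ignore_initial_segment[of _ _ n] by (simp add: add.commute)
      then have "(\<lambda>k. ennreal ((g (n+k) x - g n x)\<^sup>2)) \<longlonglongrightarrow> ennreal ((w x - g n x)\<^sup>2)"
        by (intro tendsto_ennrealI tendsto_intros)
      then show "ennreal ((w x - g n x)\<^sup>2) = liminf (\<lambda>k. ennreal ((g (n+k) x - g n x)\<^sup>2))"
        using lim_imp_Liminf[OF sequentially_bot] by metis
    qed
    also have "\<dots> \<le> liminf (\<lambda>k. \<integral>\<^sup>+x. ennreal ((g (n+k) x - g n x)\<^sup>2) \<partial>?M)"
      by (rule nn_integral_liminf) measurable
    also have "\<dots> \<le> liminf (\<lambda>k::nat. ennreal ((2 * (1/2)^n)\<^sup>2))"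
    proof (rule Liminf_mono, rule always_eventually, rule allI)
      fix k
      have s: "sqint (\<lambda>x. g (n+k) x - g n x)" by (intro sqint_diff g)
      have "(\<integral>\<^sup>+x. ennreal ((g (n+k) x - g n x)\<^sup>2) \<partial>?M) = ennreal (ip01 (\<lambda>x. g (n+k) x - g n x) (\<lambda>x. g (n+k) x - g n x))"
        using ip01_lebesgue[OF s s] sqint_ai_sq[OF s]
        by (subst nn_integral_eq_integral) (auto simp: integrable01_iff power2_eq_square)
      moreover have "ip01 (\<lambda>x. g (n+k) x - g n x) (\<lambda>x. g (n+k) x - g n x) \<le> (2 * (1/2)^n)\<^sup>2"
      proof (rule sqrt_le_D)
        show "sqrt (ip01 (\<lambda>x. g (n+k) x - g n x) (\<lambda>x. g (n+k) x - g n x)) \<le> 2 * (1/2)^n"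
          by (rule order_trans[OF dist[of n k]]) simp
      qed
      ultimately show "(\<integral>\<^sup>+x. ennreal ((g (n+k) x - g n x)\<^sup>2) \<partial>?M) \<le> ennreal ((2 * (1/2)^n)\<^sup>2)"
        by (simp add: ennreal_leI)
    qed
    also have "\<dots> = ennreal ((2 * (1/2)^n)\<^sup>2)" by (simp add: Liminf_const)
    finally show ?thesis .
  qed
  have wg: "sqint (\<lambda>x. w x - g n x)" for n
    unfolding sqint_def
  proof
    show "integrable ?M (\<lambda>x. (norm (w x - g n x))\<^sup>2)"
      using est[of n] by (intro integrableI_bounded) (auto simp: less_top[symmetric] top_unique)
  qed measurable
  have "sqint w" using sqint_add[OF wg[of 0] g[of 0]] by simp
  moreover have "(\<lambda>n. ip01 (\<lambda>x. w x - g n x) (\<lambda>x. w x - g n x)) \<longlonglongrightarrow> 0"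
  proof (rule tendsto_sandwich[of "\<lambda>_. 0" _ _ "\<lambda>n. (2 * (1/2)^n)\<^sup>2"])
    show "\<forall>\<^sub>F n in sequentially. 0 \<le> ip01 (\<lambda>x. w x - g n x) (\<lambda>x. w x - g n x)" by (simp add: ip01_nonneg)
    have "ip01 (\<lambda>x. w x - g n x) (\<lambda>x. w x - g n x) \<le> (2 * (1/2)^n)\<^sup>2" for n
    proof -
      have "ennreal (ip01 (\<lambda>x. w x - g n x) (\<lambda>x. w x - g n x)) = (\<integral>\<^sup>+x. ennreal ((w x - g n x)\<^sup>2) \<partial>?M)"
        using ip01_lebesgue[OF wg wg] sqint_ai_sq[OF wg]
        by (subst nn_integral_eq_integral) (auto simp: integrable01_iff power2_eq_square)
      then have "ennreal (ip01 (\<lambda>x. w x - g n x) (\<lambda>x. w x - g n x)) \<le> ennreal ((2 * (1/2)^n)\<^sup>2)" using est[of n] by metis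
      then show ?thesis by (subst (asm) ennreal_le_iff) auto
    qed
    then show "\<forall>\<^sub>F n in sequentially. ip01 (\<lambda>x. w x - g n x) (\<lambda>x. w x - g n x) \<le> (2 * (1/2)^n)\<^sup>2" by simp
    have "(\<lambda>n. (2 * (1/2::real)^n)\<^sup>2) \<longlonglongrightarrow> (2 * 0)\<^sup>2"
      by (intro tendsto_intros LIMSEQ_power_zero) simp
    then show "(\<lambda>n. (2 * (1/2::real)^n)\<^sup>2) \<longlonglongrightarrow> 0" by simp
  qed simp
  ultimately show ?thesis using that by blast
qed

text \<open>The representing function minimises \<open>J f = ip01 f f / 2 - T f\<close>. By strict
  convexity the midpoint of two near-minimisers would lie too low if they were far apart, so a
  minimising sequence is Cauchy; the Euler-Lagrange equation of \<open>J\<close> is the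
  claim.\<close>

lemma riesz_L2:
  fixes T :: "(real \<Rightarrow> real) \<Rightarrow> real"
  assumes add: "\<And>f g. sqint f \<Longrightarrow> sqint g \<Longrightarrow> T (\<lambda>x. f x + g x) = T f + T g"
    and scal: "\<And>f c. sqint f \<Longrightarrow> T (\<lambda>x. c * f x) = c * T f"
    and bd: "\<And>f. sqint f \<Longrightarrow> \<bar>T f\<bar> \<le> C * sqrt (ip01 f f)"
  obtains w where "sqint w" "\<And>g. sqint g \<Longrightarrow> T g = ip01 w g"
proof -
  define J where "J f = ip01 f f / 2 - T f" for f
  define m where "m = (INF f\<in>{f. sqint f}. J f)"
  have "sqint (\<lambda>_. 0::real)" by (rule sqint_continuous) simp
  then have ne: "{f :: real \<Rightarrow> real. sqint f} \<noteq> {}" by (metis mem_Collect_eq empty_iff)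
  have Jlow: "- C\<^sup>2 / 2 \<le> J f" if "sqint f" for f
  proof -
    have "T f \<le> C * sqrt (ip01 f f)" using bd[OF that] by simp
    moreover have "0 \<le> (C - sqrt (ip01 f f))\<^sup>2" by simp
    ultimately show ?thesis using ip01_nonneg[of f] by (simp add: J_def power2_diff)
  qed
  have bb: "bdd_below (J ` {f. sqint f})" by (rule bdd_belowI2[where m = "- C\<^sup>2 / 2"]) (use Jlow in auto)
  have mJ: "m \<le> J f" if "sqint f" for f unfolding m_def by (rule cINF_lower[OF bb]) (use that in auto)
  \<comment> \<open>Tuned to the rate that \<open>L2_complete\<close> asks for: the midpoint
    estimate bounds the squared distance of successive terms by \<open>8 * e n\<close>.\<close>
  define e :: "nat \<Rightarrow> real" where "e n = (1/4)^n / 8" for n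
  have e0: "e n > 0" for n by (simp add: e_def)
  have "\<exists>f. sqint f \<and> J f < m + e n" for n
  proof -
    have "\<exists>f\<in>{f. sqint f}. J f < m + e n"
      using cINF_less_iff[OF ne bb, of "m + e n"] e0[of n] unfolding m_def by simp
    then show ?thesis by blast
  qed
  then obtain g where g: "\<And>n. sqint (g n)" "\<And>n. J (g n) < m + e n" by metis
  have Jexp: "J (\<lambda>x. f x + t * h x) = J f + t * (ip01 f h - T h) + t\<^sup>2 / 2 * ip01 h h" if "sqint f" "sqint h" for f h t
    unfolding J_def ip01_expand[OF that] using add[OF that(1) sqint_cmult[OF that(2), of t]] scal[OF that(2), of t]
    by (simp add: algebra_simps add_divide_distrib)
  obtain w where w: "sqint w" "(\<lambda>n. ip01 (\<lambda>x. w x - g n x) (\<lambda>x. w x - g n x)) \<longlonglongrightarrow> 0"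
  proof (rule L2_complete[OF g(1)])
    fix n
    let ?h = "\<lambda>x. g (Suc n) x - g n x"
    have h: "sqint ?h" by (intro sqint_diff g)
    have "J (g (Suc n)) = J (\<lambda>x. g n x + 1 * ?h x)" by simp
    also have "\<dots> = J (g n) + (ip01 (g n) ?h - T ?h) + 1 / 2 * ip01 ?h ?h"
      using Jexp[OF g(1)[of n] h, of 1] by simp
    finally have 1: "J (g (Suc n)) = J (g n) + (ip01 (g n) ?h - T ?h) + 1 / 2 * ip01 ?h ?h" .
    have 2: "m \<le> J (g n) + 1 / 2 * (ip01 (g n) ?h - T ?h) + 1 / 8 * ip01 ?h ?h"
      using mJ[OF sqint_add[OF g(1)[of n] sqint_cmult[OF h, of "1/2"]]] Jexp[OF g(1)[of n] h, of "1/2"]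
      by (simp add: power2_eq_square)
    have "e (Suc n) = e n / 4" by (simp add: e_def)
    have alg: "i \<le> 8 * a" if "j' = j + l + 1/2 * i" "m \<le> j + 1/2 * l + 1/8 * i" "j < m + a" "j' < m + a/4" "0 < a" for j j' l i a :: real
      using that by linarith
    have "ip01 ?h ?h \<le> 8 * e n"
      by (rule alg[OF 1 2 g(2)[of n] _ e0[of n]]) (use g(2)[of "Suc n"] \<open>e (Suc n) = e n / 4\<close> in metis)
    then show "ip01 ?h ?h \<le> (1/4)^n" by (simp add: e_def)
  qed
  have "T f = ip01 w f" if f: "sqint f" for f
  proof -
    have lim: "(\<lambda>n. ip01 (g n) f) \<longlonglongrightarrow> ip01 w f"
    proof -
      have "(\<lambda>n. sqrt (ip01 (\<lambda>x. w x - g n x) (\<lambda>x. w x - g n x)) * sqrt (ip01 f f)) \<longlonglongrightarrow> sqrt 0 * sqrt (ip01 f f)"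
        by (intro tendsto_intros w(2))
      then have l0: "(\<lambda>n. sqrt (ip01 (\<lambda>x. w x - g n x) (\<lambda>x. w x - g n x)) * sqrt (ip01 f f)) \<longlonglongrightarrow> 0" by simp
      have "norm (ip01 w f - ip01 (g n) f) \<le> sqrt (ip01 (\<lambda>x. w x - g n x) (\<lambda>x. w x - g n x)) * sqrt (ip01 f f)" for n
        using ip01_cauchy_schwarz(2)[OF sqint_diff[OF w(1) g(1)[of n]] f]
        unfolding ip01_diff[OF w(1) g(1)[of n] f] real_norm_def .
      then have "(\<lambda>n. ip01 w f - ip01 (g n) f) \<longlonglongrightarrow> 0"
        by (intro Lim_null_comparison[OF _ l0] always_eventually allI)
      then have "(\<lambda>n. ip01 w f - (ip01 w f - ip01 (g n) f)) \<longlonglongrightarrow> ip01 w f - 0" by (intro tendsto_intros)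
      then show ?thesis by simp
    qed
    have elim: "e \<longlonglongrightarrow> 0" unfolding e_def
      using tendsto_divide[OF LIMSEQ_power_zero[of "1/4::real"] tendsto_const[of "8::real"]] by simp
    \<comment> \<open>Minimality is tested at \<open>g n + t f\<close> along the sequence and passed
      to the limit. The resulting quadratic in \<open>t\<close> is nonnegative and has no constant
      term, so its linear coefficient vanishes.\<close>
    have "0 \<le> 0 + 2 * t * ((ip01 w f - T f) / 2) + t\<^sup>2 * (ip01 f f / 2)" for t
    proof -
      have "0 \<le> e n + t * (ip01 (g n) f - T f) + t\<^sup>2 / 2 * ip01 f f" for n
        using mJ[OF sqint_add[OF g(1)[of n] sqint_cmult[OF f, of t]]] Jexp[OF g(1)[of n] f, of t] g(2)[of n] by simp
      moreover have "(\<lambda>n. e n + t * (ip01 (g n) f - T f) + t\<^sup>2 / 2 * ip01 f f) \<longlonglongrightarrow> 0 + t * (ip01 w f - T f) + t\<^sup>2 / 2 * ip01 f f"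
        by (intro tendsto_intros lim elim)
      ultimately have "0 \<le> 0 + t * (ip01 w f - T f) + t\<^sup>2 / 2 * ip01 f f"
        using LIMSEQ_le_const by blast
      then show ?thesis by simp
    qed
    then have "((ip01 w f - T f) / 2)\<^sup>2 \<le> 0 * (ip01 f f / 2)"
      by (rule quadratic_nonneg_discriminant) (simp add: ip01_nonneg)
    then show ?thesis by simp
  qed
  then show ?thesis using that w(1) by blast
qed

subsection \<open>The form domain and the potential\<close>

lemma is_wderiv_iff: "is_wderiv g \<psi> \<longleftrightarrow> sqint g \<and> prim g \<psi>"
proof (cases "sqint g")
  case True
  have "(LINT t:{0..x}|lebesgue. g t) = integral {0..x} g" if "x \<in> {0..1}" for x
    using that by (intro set_lebesgue_integral_eq_integral(2) absolutely_integrable_sub01(1)[OF sqint_ai[OF True]]) auto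
  then show ?thesis using True sqint_ai[OF True] unfolding is_wderiv_def prim_def L2I_iff by (metis (no_types, lifting))
next
  case False then show ?thesis by (simp add: is_wderiv_def L2I_iff)
qed

lemma H1I: "sqint g \<Longrightarrow> prim g \<psi> \<Longrightarrow> \<psi> \<in> H1"
  unfolding H1_def using is_wderiv_iff by blast

lemma wderiv:
  assumes "\<psi> \<in> H1" shows "sqint (wderiv \<psi>)" "prim (wderiv \<psi>) \<psi>"
proof -
  obtain g where "is_wderiv g \<psi>" using assms unfolding H1_def by blast
  then have "is_wderiv (wderiv \<psi>) \<psi>" unfolding wderiv_def by (rule someI[of "\<lambda>g. is_wderiv g \<psi>"])
  then show "sqint (wderiv \<psi>)" "prim (wderiv \<psi>) \<psi>" by (auto simp: is_wderiv_iff)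
qed

lemma wderiv_ae:
  assumes "sqint g" "prim g \<psi>" shows "AE x in lebesgue. x \<in> {0..1} \<longrightarrow> wderiv \<psi> x = g x"
  using prim_unique[OF wderiv(2)[OF H1I[OF assms]] assms(2)] .

lemma H1_const: "(\<lambda>x. c) \<in> H1"
  by (rule H1I[OF sqint_continuous prim_const]) simp

lemma H1_add: "\<psi> \<in> H1 \<Longrightarrow> \<phi> \<in> H1 \<Longrightarrow> (\<lambda>x. \<psi> x + \<phi> x) \<in> H1"
  by (rule H1I[OF sqint_add prim_add]) (rule wderiv; assumption)+

lemma H1_cmult: "\<psi> \<in> H1 \<Longrightarrow> (\<lambda>x. c * \<psi> x) \<in> H1"
  by (rule H1I[OF sqint_cmult prim_cmult]) (rule wderiv; assumption)+

lemma prim_cnj: "prim g \<psi> \<Longrightarrow> prim (\<lambda>x. cnj (g x)) (\<lambda>x. cnj (\<psi> x))"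
  by (erule prim_linear) (rule bounded_linear_cnj)

lemma sqint_cnj: "sqint g \<Longrightarrow> sqint (\<lambda>x. cnj (g x))"
  by (erule sqint_linear) (rule bounded_linear_cnj)

lemma sqint_mult_deriv:
  fixes f1 f2 :: "real \<Rightarrow> 'a::{euclidean_space,real_normed_field}"
  assumes "sqint g1" "prim g1 f1" "sqint g2" "prim g2 f2"
  shows "sqint (\<lambda>t. g1 t * f2 t + f1 t * g2 t)"
proof (rule sqint_add)
  show "sqint (\<lambda>t. g1 t * f2 t)"
    using sqint_mult_continuous[OF assms(1) prim_continuous[OF assms(4)]] by (simp add: mult.commute)
  show "sqint (\<lambda>t. f1 t * g2 t)"
    using sqint_mult_continuous[OF assms(3) prim_continuous[OF assms(2)]] .
qed

lemma H1_continuous: "\<psi> \<in> H1 \<Longrightarrow> continuous_on {0..1} \<psi>"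
  using prim_continuous wderiv(2) by blast

lemma H1_cong:
  assumes "\<psi> \<in> H1" "\<And>x. x \<in> {0..1} \<Longrightarrow> \<psi> x = \<phi> x" shows "\<phi> \<in> H1"
  by (rule H1I[OF wderiv(1)[OF assms(1)] prim_cong[OF wderiv(2)[OF assms(1)]]]) (use assms in auto)

lemma set_integral01_eq:
  fixes f :: "real \<Rightarrow> 'a::euclidean_space"
  shows "f absolutely_integrable_on {0..1} \<Longrightarrow> (LINT x:{0..1}|lebesgue. f x) = integral {0..1} f"
  by (rule set_lebesgue_integral_eq_integral(2))

lemma H1_norm_eq:
  assumes "sqint g" "prim g \<psi>"
  shows "H1_norm \<psi> = sqrt (integral {0..1} (\<lambda>x. (cmod (\<psi> x))\<^sup>2) + integral {0..1} (\<lambda>x. (cmod (g x))\<^sup>2))"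
proof -
  have "\<psi> \<in> H1" using H1I assms .
  have a: "AE x in lebesgue. x \<in> {0..1} \<longrightarrow> (cmod (wderiv \<psi> x))\<^sup>2 = (cmod (g x))\<^sup>2"
    using wderiv_ae[OF assms] by eventually_elim auto
  show ?thesis
    unfolding H1_norm_def
    using set_integral01_eq[OF sqint_ai_sq[OF wderiv(1)[OF \<open>\<psi> \<in> H1\<close>]]]
     set_integral01_eq[OF sqint_ai_sq[OF sqint_continuous[OF prim_continuous[OF assms(2)]]]]
     integral_cong_ae01[OF a, of 0 1] by simp
qed

lemma sqint_of_real: "sqint g \<Longrightarrow> sqint (\<lambda>x. complex_of_real (g x))"
  by (erule sqint_linear) (rule bounded_linear_of_real)

lemma prim_of_real: "prim g f \<Longrightarrow> prim (\<lambda>x. complex_of_real (g x)) (\<lambda>x. complex_of_real (f x))"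
  by (erule prim_linear) (rule bounded_linear_of_real)

section \<open>Representation of the potential by a square-integrable function\<close>

context
  fixes v assumes v: "v \<in> Vpot"
begin

lemma v_add: "\<psi> \<in> H1 \<Longrightarrow> \<phi> \<in> H1 \<Longrightarrow> v (\<lambda>x. \<psi> x + \<phi> x) = v \<psi> + v \<phi>"
  and v_cmult: "\<psi> \<in> H1 \<Longrightarrow> v (\<lambda>x. c * \<psi> x) = c * v \<psi>"
  and v_bounded: "\<exists>C. \<forall>\<psi>\<in>H1. cmod (v \<psi>) \<le> C * H1_norm \<psi>"
  and v_real: "\<psi> \<in> H1 \<Longrightarrow> (\<And>x. x \<in> {0..1} \<Longrightarrow> \<psi> x \<in> \<real>) \<Longrightarrow> v \<psi> \<in> \<real>"
  using v unfolding Vpot_def Hminus1_def by auto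

text \<open>Functions are total on the real line, while only their values on \<open>[0,1]\<close>
  are meant. Boundedness makes \<open>v\<close> blind to the rest, because the difference has H1
  norm 0.\<close>

lemma v_cong:
  assumes "\<psi> \<in> H1" "\<And>x. x \<in> {0..1} \<Longrightarrow> \<psi> x = \<phi> x" shows "v \<psi> = v \<phi>"
proof -
  have \<phi>: "\<phi> \<in> H1" using H1_cong assms by blast
  let ?d = "\<lambda>x. \<psi> x + (-1) * \<phi> x"
  have d: "prim (\<lambda>x. 0) ?d" by (rule prim_cong[OF prim_const[of 0]]) (use assms in auto)
  have s: "sqint (\<lambda>x::real. 0::complex)" by (rule sqint_continuous) simp
  have "integral {0..1} (\<lambda>x. (cmod (?d x))\<^sup>2) = integral {0..1} (\<lambda>x::real. 0::real)"
    by (rule Henstock_Kurzweil_Integration.integral_cong) (use assms in auto)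
  then have "H1_norm ?d = 0" using H1_norm_eq[OF s d] by simp
  moreover obtain C where "\<forall>\<psi>\<in>H1. cmod (v \<psi>) \<le> C * H1_norm \<psi>" using v_bounded by blast
  ultimately have "v ?d = 0" using H1I[OF s d] by force
  moreover have "v ?d = v \<psi> + v (\<lambda>x. (-1) * \<phi> x)" by (rule v_add[OF assms(1) H1_cmult[OF \<phi>]])
  moreover have "v (\<lambda>x. (-1) * \<phi> x) = (-1) * v \<phi>" by (rule v_cmult[OF \<phi>])
  ultimately show ?thesis by simp
qed

text \<open>The Riesz representation is applied to the functional that sends a real \<open>g\<close>
  to \<open>v\<close> of its primitive. The constant function accounts for the value at 0, and a
  complex derivative is split into its real and imaginary parts.\<close>

lemma potential_representation0:
  obtains w0 :: "real \<Rightarrow> real" and c :: real where "sqint w0"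
    "\<And>(\<psi>::real\<Rightarrow>complex) g. sqint g \<Longrightarrow> prim g \<psi> \<Longrightarrow> v \<psi> = complex_of_real c * \<psi> 0 + integral {0..1} (\<lambda>x. complex_of_real (w0 x) * g x)"
proof -
  let ?G = "\<lambda>g x. complex_of_real (integral {0..x} g)"
  have pG: "prim (\<lambda>x. complex_of_real (g x)) (?G g)" if "sqint g" for g
    using prim_of_real[OF prim_integral[OF sqint_ai[OF that], of 0]] by simp
  have HG: "?G g \<in> H1" if "sqint g" for g by (rule H1I[OF sqint_of_real pG]) (rule that)+
  define T where "T g = Re (v (?G g))" for g
  have vT: "v (?G g) = complex_of_real (T g)" if "sqint g" for g
    using v_real[OF HG[OF that]] by (simp add: T_def)
  obtain C where C: "\<And>\<psi>. \<psi> \<in> H1 \<Longrightarrow> cmod (v \<psi>) \<le> C * H1_norm \<psi>" using v_bounded by blast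
  obtain w0 :: "real \<Rightarrow> real" where w0: "sqint w0" "\<And>g. sqint g \<Longrightarrow> T g = ip01 w0 g"
  proof (rule riesz_L2[of T "2 * \<bar>C\<bar>"])
    fix f g :: "real \<Rightarrow> real" assume f: "sqint f" and g: "sqint g"
    have "v (?G (\<lambda>x. f x + g x)) = v (\<lambda>x. ?G f x + ?G g x)"
    proof (rule v_cong[OF HG[OF sqint_add[OF f g]]])
      fix x :: real assume x: "x \<in> {0..1}"
      have "f integrable_on {0..x}" "g integrable_on {0..x}"
        using absolutely_integrable_sub01(2)[OF sqint_ai[OF f], of 0 x] absolutely_integrable_sub01(2)[OF sqint_ai[OF g], of 0 x] x by auto
      then show "?G (\<lambda>x. f x + g x) x = ?G f x + ?G g x" by (simp add: Henstock_Kurzweil_Integration.integral_add)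
    qed
    also have "\<dots> = v (?G f) + v (?G g)" by (rule v_add[OF HG[OF f] HG[OF g]])
    finally show "T (\<lambda>x. f x + g x) = T f + T g" by (simp add: T_def)
  next
    fix f :: "real \<Rightarrow> real" and c :: real assume f: "sqint f"
    have "v (?G (\<lambda>x. c * f x)) = v (\<lambda>x. complex_of_real c * ?G f x)"
      by (rule v_cong[OF HG[OF sqint_cmult[OF f]]]) simp
    also have "\<dots> = c * v (?G f)" by (rule v_cmult[OF HG[OF f]])
    finally show "T (\<lambda>x. c * f x) = c * T f" by (simp add: T_def)
  next
    fix f :: "real \<Rightarrow> real" assume f: "sqint f"
    \<comment> \<open>A primitive is bounded in the supremum norm by the L2 norm of its derivative,
      hence so is its H1 norm.\<close>
    have fb: "\<bar>integral {0..x} f\<bar> \<le> sqrt (ip01 f f)" if x: "x \<in> {0..1}" for x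
    proof -
      have sa: "sqint (\<lambda>x. \<bar>f x\<bar>)"
      proof (rule sqint_bound[OF f, where K = 1])
        show "(\<lambda>x. \<bar>f x\<bar>) \<in> borel_measurable (lebesgue_on {0..1})" using sqint_measurable[OF f] by measurable
      qed auto
      have s1: "sqint (\<lambda>x::real. 1::real)" by (rule sqint_continuous) simp
      have ai: "(\<lambda>x. \<bar>f x\<bar>) absolutely_integrable_on {0..1}" by (rule sqint_ai[OF sa])
      have "\<bar>integral {0..x} f\<bar> \<le> integral {0..x} (\<lambda>x. \<bar>f x\<bar>)"
        using integral_norm_bound_integral[of f "{0..x}" "\<lambda>x. \<bar>f x\<bar>"] absolutely_integrable_sub01(2)[OF sqint_ai[OF f], of 0 x]
          absolutely_integrable_sub01(2)[OF ai, of 0 x] x by auto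
      also have "\<dots> \<le> integral {0..1} (\<lambda>x. \<bar>f x\<bar>)"
        using absolutely_integrable_sub01(2)[OF ai, of 0 x] absolutely_integrable_sub01(2)[OF ai, of 0 1] x
        by (intro integral_subset_le) auto
      also have "\<dots> = ip01 (\<lambda>x. \<bar>f x\<bar>) (\<lambda>x. 1)" by (simp add: ip01_def)
      also have "\<dots> \<le> sqrt (ip01 (\<lambda>x. \<bar>f x\<bar>) (\<lambda>x. \<bar>f x\<bar>)) * sqrt (ip01 (\<lambda>x. 1) (\<lambda>x. 1))"
        using ip01_cauchy_schwarz(2)[OF sa s1] by linarith
      also have "\<dots> = sqrt (ip01 f f)" by (simp add: ip01_def)
      finally show ?thesis .
    qed
    have c1: "continuous_on {0..1} (?G f)" by (rule prim_continuous[OF pG[OF f]])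
    have c2: "continuous_on {0..1} (\<lambda>x. integral {0..x} f)"
      by (rule indefinite_integral_continuous_1[OF ai_integrable[OF sqint_ai[OF f]]])
    have i1: "integral {0..1} (\<lambda>x. (cmod (?G f x))\<^sup>2) \<le> integral {0..1} (\<lambda>x::real. ip01 f f)"
    proof (rule integral_le)
      show "(\<lambda>x. (cmod (?G f x))\<^sup>2) integrable_on {0..1}" by (intro integrable_continuous_real continuous_intros c1)
      show "(cmod (?G f x))\<^sup>2 \<le> ip01 f f" if "x \<in> {0..1}" for x
        using power_mono[OF fb[OF that], of 2] ip01_nonneg[of f] by simp
    qed auto
    have i2: "integral {0..1} (\<lambda>x. (cmod (complex_of_real (f x)))\<^sup>2) = ip01 f f"
      by (simp add: ip01_def power2_eq_square)
    \<comment> \<open>Two summands, each at most \<open>ip01 f f\<close>, would give the factor 2;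
      it is enlarged to 4, whose root is rational.\<close>
    have "H1_norm (?G f) \<le> sqrt (4 * ip01 f f)"
      unfolding H1_norm_eq[OF sqint_of_real[OF f] pG[OF f]] i2
      by (rule real_sqrt_le_mono) (use i1 ip01_nonneg[of f] in simp)
    then have H: "H1_norm (?G f) \<le> 2 * sqrt (ip01 f f)" by (simp add: real_sqrt_mult)
    have "\<bar>T f\<bar> \<le> cmod (v (?G f))" unfolding T_def by (rule abs_Re_le_cmod)
    also have "\<dots> \<le> C * H1_norm (?G f)" by (rule C[OF HG[OF f]])
    also have "\<dots> \<le> \<bar>C\<bar> * H1_norm (?G f)"
    proof (rule mult_right_mono)
      have "0 \<le> integral {0..1} (\<lambda>x. (cmod (?G f x))\<^sup>2)"
        by (rule Henstock_Kurzweil_Integration.integral_nonneg) (auto intro!: integrable_continuous_real continuous_intros c2)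
      then show "0 \<le> H1_norm (?G f)"
        unfolding H1_norm_eq[OF sqint_of_real[OF f] pG[OF f]] i2 using ip01_nonneg[of f] by simp
    qed simp
    also have "\<dots> \<le> \<bar>C\<bar> * (2 * sqrt (ip01 f f))" by (rule mult_left_mono[OF H]) simp
    finally show "\<bar>T f\<bar> \<le> 2 * \<bar>C\<bar> * sqrt (ip01 f f)" by simp
  next
    fix w assume "sqint w" "\<And>g. sqint g \<Longrightarrow> T g = ip01 w g"
    then show thesis by (rule that)
  qed
  have vw: "v (?G g) = integral {0..1} (\<lambda>x. complex_of_real (w0 x) * complex_of_real (g x))" if "sqint g" for g
  proof -
    have "v (?G g) = complex_of_real (integral {0..1} (\<lambda>x. w0 x * g x))" using vT[OF that] w0(2)[OF that] by (simp add: ip01_def)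
    also have "\<dots> = integral {0..1} (\<lambda>x. complex_of_real (w0 x * g x))"
      using integral_linear[OF ai_integrable[OF sqint_prod[OF w0(1) that]] bounded_linear_of_real[where 'a=complex]] by (simp add: o_def)
    finally show ?thesis by simp
  qed
  have "v (\<lambda>x. 1) \<in> \<real>" by (rule v_real[OF H1_const]) simp
  then obtain c where c: "v (\<lambda>x. 1) = complex_of_real c" by (auto elim: Reals_cases)
  show ?thesis
  proof (rule that[OF w0(1), of c])
    fix \<psi> g :: "real \<Rightarrow> complex" assume g: "sqint g" and p: "prim g \<psi>"
    have sr: "sqint (\<lambda>x. Re (g x))" "sqint (\<lambda>x. Im (g x))"
      using sqint_linear[OF g bounded_linear_Re] sqint_linear[OF g bounded_linear_Im] .
    let ?R = "?G (\<lambda>x. Re (g x))" and ?I = "?G (\<lambda>x. Im (g x))"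
    have "v \<psi> = v (\<lambda>x. \<psi> 0 * 1 + (?R x + \<i> * ?I x))"
    proof (rule v_cong[OF H1I[OF g p]])
      fix x :: real assume x: "x \<in> {0..1}"
      have gi: "g integrable_on {0..x}" using absolutely_integrable_sub01(2)[OF sqint_ai[OF g], of 0 x] x by auto
      have "integral {0..x} (\<lambda>x. Re (g x)) = Re (integral {0..x} g)" "integral {0..x} (\<lambda>x. Im (g x)) = Im (integral {0..x} g)"
        using integral_linear[OF gi bounded_linear_Re] integral_linear[OF gi bounded_linear_Im] by (auto simp: o_def)
      then show "\<psi> x = \<psi> 0 * 1 + (?R x + \<i> * ?I x)" using prim_eval[OF p x] complex_eq[of "integral {0..x} g"] by simp
    qed
    also have "\<dots> = v (\<lambda>x. \<psi> 0 * 1) + v (\<lambda>x. ?R x + \<i> * ?I x)"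
      by (rule v_add) (intro H1_cmult H1_const H1_add HG sr)+
    also have "v (\<lambda>x. ?R x + \<i> * ?I x) = v ?R + v (\<lambda>x. \<i> * ?I x)"
      by (rule v_add) (intro H1_cmult HG sr)+
    also have "v (\<lambda>x. \<i> * ?I x) = \<i> * v ?I" by (rule v_cmult[OF HG[OF sr(2)]])
    also have "v (\<lambda>x. \<psi> 0 * 1) = \<psi> 0 * c" using v_cmult[OF H1_const[of 1], of "\<psi> 0"] c by simp
    also have "v ?R + \<i> * v ?I = integral {0..1} (\<lambda>x. complex_of_real (w0 x) * complex_of_real (Re (g x))) + integral {0..1} (\<lambda>x. \<i> * (complex_of_real (w0 x) * complex_of_real (Im (g x))))"
      using vw[OF sr(1)] vw[OF sr(2)] by simp
    also have "\<dots> = integral {0..1} (\<lambda>x. complex_of_real (w0 x) * complex_of_real (Re (g x)) + \<i> * (complex_of_real (w0 x) * complex_of_real (Im (g x))))"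
      by (rule Henstock_Kurzweil_Integration.integral_add[symmetric])
        (intro ai_integrable ai_cmult sqint_prod sqint_of_real w0(1) sr)+
    also have "(\<lambda>x. complex_of_real (w0 x) * complex_of_real (Re (g x)) + \<i> * (complex_of_real (w0 x) * complex_of_real (Im (g x)))) = (\<lambda>x. complex_of_real (w0 x) * g x)"
    proof
      fix x show "complex_of_real (w0 x) * complex_of_real (Re (g x)) + \<i> * (complex_of_real (w0 x) * complex_of_real (Im (g x))) = complex_of_real (w0 x) * g x"
        by (subst (3) complex_eq) (simp add: algebra_simps)
    qed
    finally show "v \<psi> = complex_of_real c * \<psi> 0 + integral {0..1} (\<lambda>x. complex_of_real (w0 x) * g x)" by simp
  qed
qed

text \<open>Integration by parts against \<open>1 - x\<close> trades the point evaluation at 0 for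
  an integral of \<open>\<psi>\<close>. The potential then contributes no boundary term, and
  \<open>c\<close> amounts to a shift of the spectral parameter.\<close>

lemma potential_representation:
  obtains w :: "real \<Rightarrow> real" and c :: real where "sqint w"
    "\<And>(\<psi>::real\<Rightarrow>complex) g. sqint g \<Longrightarrow> prim g \<psi> \<Longrightarrow> v \<psi> = complex_of_real c * integral {0..1} \<psi> + integral {0..1} (\<lambda>x. complex_of_real (w x) * g x)"
proof -
  obtain w0 :: "real \<Rightarrow> real" and c :: real where w0: "sqint w0"
    "\<And>(\<psi>::real\<Rightarrow>complex) g. sqint g \<Longrightarrow> prim g \<psi> \<Longrightarrow> v \<psi> = complex_of_real c * \<psi> 0 + integral {0..1} (\<lambda>x. complex_of_real (w0 x) * g x)"
  proof (rule potential_representation0)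
    fix w0 :: "real \<Rightarrow> real" and c :: real
    assume "sqint w0" "\<And>(\<psi>::real\<Rightarrow>complex) g. sqint g \<Longrightarrow> prim g \<psi> \<Longrightarrow> v \<psi> = complex_of_real c * \<psi> 0 + integral {0..1} (\<lambda>x. complex_of_real (w0 x) * g x)"
    then show thesis by (rule that)
  qed
  define w where "w x = w0 x - c * (1 - x)" for x
  have sl: "sqint (\<lambda>x::real. c * (1 - x))" by (intro sqint_continuous continuous_intros)
  have w: "sqint w" unfolding w_def by (intro sqint_diff w0 sl)
  show ?thesis
  proof (rule that[OF w, of c])
    fix \<psi> g :: "real \<Rightarrow> complex" assume g: "sqint g" and p: "prim g \<psi>"
    have "prim (\<lambda>x. -1) (\<lambda>x. complex_of_real (1 - x))"
      by (rule prim_C1) (auto intro!: derivative_eq_intros simp: has_vector_derivative_def scaleR_conv_of_real)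
    from prim_parts[OF this p]
    have parts: "integral {0..1} (\<lambda>x. complex_of_real (1 - x) * g x) = integral {0..1} \<psi> - \<psi> 0" by simp
    have "integral {0..1} (\<lambda>x. complex_of_real (w x) * g x) = integral {0..1} (\<lambda>x. complex_of_real (w0 x) * g x - complex_of_real c * (complex_of_real (1 - x) * g x))"
      by (rule Henstock_Kurzweil_Integration.integral_cong) (simp add: w_def algebra_simps)
    also have "\<dots> = integral {0..1} (\<lambda>x. complex_of_real (w0 x) * g x) - integral {0..1} (\<lambda>x. complex_of_real c * (complex_of_real (1 - x) * g x))"
      by (intro Henstock_Kurzweil_Integration.integral_diff ai_integrable ai_cmult sqint_prod sqint_of_real w0 g sqint_continuous continuous_intros)
    also have "\<dots> = integral {0..1} (\<lambda>x. complex_of_real (w0 x) * g x) - complex_of_real c * (integral {0..1} \<psi> - \<psi> 0)"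
      using parts by simp
    finally show "v \<psi> = complex_of_real c * integral {0..1} \<psi> + integral {0..1} (\<lambda>x. complex_of_real (w x) * g x)"
      using w0(2)[OF g p] by (simp add: algebra_simps)
  qed
qed

end

section \<open>Removal of the singular part of the form\<close>

lemma prim_real_exp:
  assumes "prim w (W :: real \<Rightarrow> real)" shows "prim (\<lambda>x. c * w x * exp (c * W x)) (\<lambda>x. exp (c * W x))"
  using prim_exp[OF prim_cmult[OF assms, of c]] .

text \<open>The Liouville-type substitution \<open>\<psi> = exp (- h) y\<close> with \<open>h' = w + n\<close>: the function \<open>n\<close> is
  chosen so that \<open>(P n)' = P (w\<^sup>2 - C) - 2 n\<^sup>2 P\<close> and \<open>P n\<close> vanishes at both end points, which cancels
  the terms with the merely integrable coefficient \<open>w\<^sup>2\<close>.\<close>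

lemma liouville_function:
  fixes w :: "real \<Rightarrow> real"
  assumes w: "sqint w"
  obtains h n :: "real \<Rightarrow> real" and C :: real where
    "h 0 = 0" "prim (\<lambda>x. w x + n x) h" "continuous_on {0..1} n"
    "n 0 = 0" "n 1 = 0"
    "prim (\<lambda>x. exp (-2 * h x) * ((w x)\<^sup>2 - C) - 2 * (n x)\<^sup>2 * exp (-2 * h x)) (\<lambda>x. exp (-2 * h x) * n x)"
proof -
  define W where "W x = 0 + integral {0..x} w" for x
  have pW: "prim w W" unfolding W_def by (rule prim_integral[OF sqint_ai[OF w]])
  define Q where "Q x = exp (-2 * W x)" for x
  have cW: "continuous_on {0..1} W" by (rule prim_continuous[OF pW])
  have cQ: "continuous_on {0..1} Q" unfolding Q_def by (intro continuous_intros cW)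
  have Q0: "Q x > 0" for x by (simp add: Q_def)
  have aw: "(\<lambda>x. (w x)\<^sup>2) absolutely_integrable_on {0..1}" using sqint_ai_sq[OF w] by simp
  have aQw: "(\<lambda>x. Q x * (w x)\<^sup>2) absolutely_integrable_on {0..1}" by (rule ai_mult_continuous(1)[OF aw cQ])
  have aQ: "Q absolutely_integrable_on {0..1}" using absolutely_integrable_continuous_real[OF cQ] by simp
  have IQ: "integral {0..1} Q > 0"
  proof -
    have "integral {0..1} Q \<noteq> 0"
    proof
      assume "integral {0..1} Q = 0"
      then have "Q 0 = 0" using integral_eq_0_iff[OF cQ, of] Q0 by (simp add: less_imp_le)
      then show False using Q0[of 0] by simp
    qed
    moreover have "integral {0..1} Q \<ge> 0"
      by (rule Henstock_Kurzweil_Integration.integral_nonneg[OF ai_integrable[OF aQ]]) (simp add: Q0 less_imp_le)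
    ultimately show ?thesis by simp
  qed
  \<comment> \<open>The mean of \<open>w^2\<close> with weight \<open>Q\<close>, which is exactly
    what makes \<open>N\<close> vanish at 1.\<close>
  define C where "C = integral {0..1} (\<lambda>x. Q x * (w x)\<^sup>2) / integral {0..1} Q"
  have aN: "(\<lambda>x. Q x * ((w x)\<^sup>2 - C)) absolutely_integrable_on {0..1}"
    unfolding right_diff_distrib by (intro ai_diff aQw) (use ai_cmult[OF aQ, of C] in \<open>simp add: mult.commute\<close>)
  define N where "N x = 0 + integral {0..x} (\<lambda>x. Q x * ((w x)\<^sup>2 - C))" for x
  have pN: "prim (\<lambda>x. Q x * ((w x)\<^sup>2 - C)) N" unfolding N_def by (rule prim_integral[OF aN])
  have N0: "N 0 = 0" by (simp add: N_def)
  have N1: "N 1 = 0"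
  proof -
    have "N 1 = integral {0..1} (\<lambda>x. Q x * (w x)\<^sup>2 - C * Q x)" unfolding N_def by (simp add: algebra_simps)
    also have "\<dots> = integral {0..1} (\<lambda>x. Q x * (w x)\<^sup>2) - integral {0..1} (\<lambda>x. C * Q x)"
      by (intro Henstock_Kurzweil_Integration.integral_diff ai_integrable ai_cmult aQ aQw)
    also have "\<dots> = 0" using IQ by (simp add: C_def)
    finally show ?thesis .
  qed
  have cN: "continuous_on {0..1} N" by (rule prim_continuous[OF pN])
  \<comment> \<open>The equation for \<open>P n\<close> is nonlinear but has an explicit solution:
    \<open>N\<close> does not involve \<open>n\<close>, and \<open>P n = N exp (-2 V)\<close> with
    \<open>V' = n\<close>, so that differentiating the exponential produces the quadratic
    term.\<close>
  define n where "n x = N x / Q x" for x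
  have cn: "continuous_on {0..1} n" unfolding n_def using Q0 by (intro continuous_intros cN cQ) (metis less_irrefl)
  define V where "V x = 0 + integral {0..x} n" for x
  have pV: "prim n V" unfolding V_def
    by (rule prim_integral) (use absolutely_integrable_continuous_real[OF cn] in simp)
  define h where "h x = W x + V x" for x
  have ph: "prim (\<lambda>x. w x + n x) h" unfolding h_def by (rule prim_add[OF pW pV])
  have Ph: "exp (-2 * h x) = Q x * exp (-2 * V x)" for x by (simp add: h_def Q_def exp_add[symmetric] algebra_simps)
  have "prim (\<lambda>x. exp (-2 * h x) * ((w x)\<^sup>2 - C) - 2 * (n x)\<^sup>2 * exp (-2 * h x)) (\<lambda>x. exp (-2 * h x) * n x)"
  proof -
    have "prim (\<lambda>x. Q x * ((w x)\<^sup>2 - C) * exp (-2 * V x) + N x * (-2 * n x * exp (-2 * V x))) (\<lambda>x. N x * exp (-2 * V x))"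
      by (rule prim_mult[OF pN prim_real_exp[OF pV]])
    moreover have Nn: "N x = n x * Q x" for x using Q0[of x] by (simp add: n_def)
    have "Q x * ((w x)\<^sup>2 - C) * exp (-2 * V x) + N x * (-2 * n x * exp (-2 * V x)) =
      exp (-2 * h x) * ((w x)\<^sup>2 - C) - 2 * (n x)\<^sup>2 * exp (-2 * h x)" for x
      unfolding Ph Nn power2_eq_square by (simp add: algebra_simps)
    moreover have "N x * exp (-2 * V x) = exp (-2 * h x) * n x" for x
      unfolding Ph Nn by (simp add: algebra_simps)
    ultimately show ?thesis by simp
  qed
  then show ?thesis using that[of h n C] ph cn N0 N1 by (simp add: h_def W_def V_def n_def)
qed

text \<open>Multiplication by a positive factor with square-integrable derivative preserves H1. The
  exponents \<open>c = -1\<close> and \<open>c = 1\<close> give the substitution and its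
  inverse.\<close>

lemma exp_transform:
  fixes h :: "real \<Rightarrow> real" and y :: "real \<Rightarrow> complex"
  assumes ph: "prim h' h" and sh: "sqint h'" and y: "sqint g" "prim g y"
  shows "sqint (\<lambda>x. complex_of_real (exp (c * h x)) * (g x + complex_of_real c * complex_of_real (h' x) * y x))"
    "prim (\<lambda>x. complex_of_real (exp (c * h x)) * (g x + complex_of_real c * complex_of_real (h' x) * y x)) (\<lambda>x. complex_of_real (exp (c * h x)) * y x)"
proof -
  have pe: "prim (\<lambda>x. complex_of_real (c * h' x * exp (c * h x))) (\<lambda>x. complex_of_real (exp (c * h x)))"
    by (rule prim_linear[OF prim_real_exp[OF ph] bounded_linear_of_real])
  have ch: "continuous_on {0..1} h" by (rule prim_continuous[OF ph])
  have se: "sqint (\<lambda>x. complex_of_real (c * h' x * exp (c * h x)))"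
  proof (rule sqint_linear[OF _ bounded_linear_of_real])
    have "sqint (\<lambda>x. (c * exp (c * h x)) * h' x)"
      by (rule sqint_mult_continuous[OF sh]) (intro continuous_intros ch)
    then show "sqint (\<lambda>x. c * h' x * exp (c * h x))" by (simp add: algebra_simps)
  qed
  show "sqint (\<lambda>x. complex_of_real (exp (c * h x)) * (g x + complex_of_real c * complex_of_real (h' x) * y x))"
    using sqint_mult_deriv[OF se pe y] by (simp add: algebra_simps)
  show "prim (\<lambda>x. complex_of_real (exp (c * h x)) * (g x + complex_of_real c * complex_of_real (h' x) * y x)) (\<lambda>x. complex_of_real (exp (c * h x)) * y x)"
    using prim_mult[OF pe y(2)] by (simp add: algebra_simps)
qed

lemma form_a_eq:
  assumes "sqint g" "prim g \<psi>" "sqint k" "prim k \<phi>"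
  shows "form_a v \<psi> \<phi> = integral {0..1} (\<lambda>x. g x * cnj (k x)) + v (\<lambda>x. \<psi> x * cnj (\<phi> x))"
proof -
  have H: "\<psi> \<in> H1" "\<phi> \<in> H1" using H1I assms by auto
  have "AE x in lebesgue. x \<in> {0..1} \<longrightarrow> wderiv \<psi> x * cnj (wderiv \<phi> x) = g x * cnj (k x)"
    using wderiv_ae[OF assms(1,2)] wderiv_ae[OF assms(3,4)] by eventually_elim auto
  from integral_cong_ae01[OF this, of 0 1]
  show ?thesis unfolding form_a_def
    using set_integral01_eq[OF sqint_prod[OF wderiv(1)[OF H(1)] sqint_cnj[OF wderiv(1)[OF H(2)]]]] by simp
qed

lemma l2inner_eq:
  assumes "sqint f" "sqint g" shows "l2inner f g = integral {0..1} (\<lambda>x. f x * cnj (g x))"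
  unfolding l2inner_def by (rule set_integral01_eq[OF sqint_prod[OF assms(1) sqint_cnj[OF assms(2)]]])

text \<open>With \<open>\<psi>' = exp (- h) (y' - (w + n) y)\<close> the form has the coefficient
  \<open>P (c + n^2 - w^2)\<close> at \<open>y cnj \<eta>\<close> and \<open>- P n\<close> at the
  derivative of \<open>y cnj \<eta>\<close>. Adding the derivative of
  \<open>P n y cnj \<eta>\<close>, whose integral is 0 because \<open>n\<close> vanishes at the
  ends, removes the latter and replaces the former by \<open>(c - C) P - n^2 P\<close>. This gives
  \<open>\<gamma> = c - C\<close> and \<open>q = n^2 P\<close>.\<close>

lemma form_reduction:
  assumes v: "v \<in> Vpot"
  obtains h q :: "real \<Rightarrow> real" and \<gamma> :: real where
    "h 0 = 0" "continuous_on {0..1} h" "continuous_on {0..1} q" "\<And>x. q x \<ge> 0"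
    "\<And>c y. y \<in> H1 \<Longrightarrow> (\<lambda>x. complex_of_real (exp (c * h x)) * y x) \<in> H1"
    "\<And>g y k \<eta>. sqint g \<Longrightarrow> prim g y \<Longrightarrow> sqint k \<Longrightarrow> prim k \<eta> \<Longrightarrow>
       form_a v (\<lambda>x. complex_of_real (exp (- 1 * h x)) * y x) (\<lambda>x. complex_of_real (exp (- 1 * h x)) * \<eta> x) =
       integral {0..1} (\<lambda>x. exp (-2 * h x) * (g x * cnj (k x)) + (\<gamma> * exp (-2 * h x) - q x) * (y x * cnj (\<eta> x)))"
proof -
  obtain w :: "real \<Rightarrow> real" and c :: real where w: "sqint w"
    and vr: "\<And>(\<psi>::real\<Rightarrow>complex) g. sqint g \<Longrightarrow> prim g \<psi> \<Longrightarrow> v \<psi> = complex_of_real c * integral {0..1} \<psi> + integral {0..1} (\<lambda>x. complex_of_real (w x) * g x)"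
  proof (rule potential_representation[OF v])
    fix w :: "real \<Rightarrow> real" and c :: real
    assume "sqint w" "\<And>(\<psi>::real\<Rightarrow>complex) g. sqint g \<Longrightarrow> prim g \<psi> \<Longrightarrow> v \<psi> = complex_of_real c * integral {0..1} \<psi> + integral {0..1} (\<lambda>x. complex_of_real (w x) * g x)"
    then show thesis by (rule that)
  qed
  obtain h n :: "real \<Rightarrow> real" and C :: real where
    h0: "h 0 = 0" and ph: "prim (\<lambda>x. w x + n x) h" and cn: "continuous_on {0..1} n" and n01: "n 0 = 0" "n 1 = 0" and
    pm: "prim (\<lambda>x. exp (-2 * h x) * ((w x)\<^sup>2 - C) - 2 * (n x)\<^sup>2 * exp (-2 * h x)) (\<lambda>x. exp (-2 * h x) * n x)"
    by (rule liouville_function[OF w])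
  have sh: "sqint (\<lambda>x. w x + n x)" by (rule sqint_add[OF w sqint_continuous[OF cn]])
  have ch: "continuous_on {0..1} h" by (rule prim_continuous[OF ph])
  show ?thesis
  proof (rule that[of h "\<lambda>x. (n x)\<^sup>2 * exp (-2 * h x)" "c - C"])
    show "h 0 = 0" by fact
    show "continuous_on {0..1} h" by fact
    show "continuous_on {0..1} (\<lambda>x. (n x)\<^sup>2 * exp (-2 * h x))" by (intro continuous_intros cn ch)
    show "0 \<le> (n x)\<^sup>2 * exp (-2 * h x)" for x by simp
    show "(\<lambda>x. complex_of_real (exp (c * h x)) * y x) \<in> H1" if "y \<in> H1" for c y
      by (rule H1I[OF exp_transform[OF ph sh wderiv[OF that]]])
    fix g y k \<eta> :: "real \<Rightarrow> complex" assume y: "sqint g" "prim g y" and \<eta>: "sqint k" "prim k \<eta>"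
    define E where "E x = complex_of_real (exp (- 1 * h x))" for x
    define P where "P x = complex_of_real (exp (-2 * h x))" for x
    define g' where "g' x = E x * (g x + complex_of_real (-1) * complex_of_real (w x + n x) * y x)" for x
    define k' where "k' x = E x * (k x + complex_of_real (-1) * complex_of_real (w x + n x) * \<eta> x)" for x
    define \<psi> where "\<psi> x = E x * y x" for x
    define \<phi> where "\<phi> x = E x * \<eta> x" for x
    have EE: "E x * E x = P x" for x by (simp add: E_def P_def exp_add[symmetric] flip: of_real_mult)
    have cE: "cnj (E x) = E x" for x by (simp add: E_def)
    have \<psi>: "sqint g'" "prim g' \<psi>" using exp_transform[OF ph sh y, of "-1"] unfolding g'_def[abs_def] \<psi>_def[abs_def] E_def by blast+
    have \<phi>: "sqint k'" "prim k' \<phi>" using exp_transform[OF ph sh \<eta>, of "-1"] unfolding k'_def[abs_def] \<phi>_def[abs_def] E_def by blast+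
    note ck = sqint_cnj[OF \<phi>(1)] prim_cnj[OF \<phi>(2)]
    have pp: "prim (\<lambda>x. g' x * cnj (\<phi> x) + \<psi> x * cnj (k' x)) (\<lambda>x. \<psi> x * cnj (\<phi> x))"
      by (rule prim_mult[OF \<psi>(2) ck(2)])
    have sp: "sqint (\<lambda>x. g' x * cnj (\<phi> x) + \<psi> x * cnj (k' x))" by (rule sqint_mult_deriv[OF \<psi> ck])
    define A where "A x = g' x * cnj (k' x) + (c * (\<psi> x * cnj (\<phi> x)) + w x * (g' x * cnj (\<phi> x) + \<psi> x * cnj (k' x)))" for x
    have "form_a v \<psi> \<phi> = integral {0..1} (\<lambda>x. g' x * cnj (k' x)) +
       (c * integral {0..1} (\<lambda>x. \<psi> x * cnj (\<phi> x)) + integral {0..1} (\<lambda>x. w x * (g' x * cnj (\<phi> x) + \<psi> x * cnj (k' x))))"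
      unfolding form_a_eq[OF \<psi> \<phi>] vr[OF sp pp] ..
    also have "\<dots> = integral {0..1} A"
    proof -
      have a1: "(\<lambda>x. g' x * cnj (k' x)) absolutely_integrable_on {0..1}" by (rule sqint_prod[OF \<psi>(1) ck(1)])
      have a2: "(\<lambda>x. c * (\<psi> x * cnj (\<phi> x))) absolutely_integrable_on {0..1}"
        by (intro ai_cmult sqint_prod sqint_continuous prim_continuous[OF \<psi>(2)] prim_continuous[OF ck(2)])
      have a3: "(\<lambda>x. w x * (g' x * cnj (\<phi> x) + \<psi> x * cnj (k' x))) absolutely_integrable_on {0..1}"
        by (rule sqint_prod[OF sqint_of_real[OF w] sp])
      show ?thesis unfolding A_def
        by (subst Henstock_Kurzweil_Integration.integral_add[OF ai_integrable[OF a1] ai_integrable[OF ai_add[OF a2 a3]]],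
          subst Henstock_Kurzweil_Integration.integral_add[OF ai_integrable[OF a2] ai_integrable[OF a3]]) simp
    qed
    finally have F: "form_a v \<psi> \<phi> = integral {0..1} A" .
    define B where "B x = P x * (g x * cnj (k x)) + ((c - C) * P x - (n x)\<^sup>2 * P x) * (y x * cnj (\<eta> x))" for x
    define D where "D x = complex_of_real (exp (-2 * h x) * ((w x)\<^sup>2 - C) - 2 * (n x)\<^sup>2 * exp (-2 * h x)) * (y x * cnj (\<eta> x)) +
      complex_of_real (exp (-2 * h x) * n x) * (g x * cnj (\<eta> x) + y x * cnj (k x))" for x
    note c\<eta> = sqint_cnj[OF \<eta>(1)] prim_cnj[OF \<eta>(2)]
    have pD: "prim D (\<lambda>x. complex_of_real (exp (-2 * h x) * n x) * (y x * cnj (\<eta> x)))"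
      unfolding D_def by (rule prim_mult[OF prim_of_real[OF pm] prim_mult[OF y(2) c\<eta>(2)]])
    have iD: "integral {0..1} D = 0" using prim_eval1[OF pD] n01 by simp
    have aB: "B absolutely_integrable_on {0..1}"
      unfolding B_def P_def
      by (intro ai_add ai_mult_continuous(1) sqint_prod y(1) c\<eta>(1) sqint_continuous continuous_intros ch cn prim_continuous[OF y(2)] prim_continuous[OF c\<eta>(2)])
    \<comment> \<open>All terms with \<open>w\<close> cancel in \<open>A + D\<close>, and they do so
      at every point.\<close>
    have AB: "A x = B x - D x" for x
    proof -
      have "A x = P x * ((g x - (w x + n x) * y x) * cnj (k x - (w x + n x) * \<eta> x)) + c * P x * (y x * cnj (\<eta> x)) +
         w x * P x * ((g x - (w x + n x) * y x) * cnj (\<eta> x) + y x * cnj (k x - (w x + n x) * \<eta> x))"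
        unfolding A_def g'_def k'_def \<psi>_def \<phi>_def EE[symmetric] by (simp add: cE algebra_simps)
      also have "\<dots> = B x - D x" unfolding B_def D_def P_def
        by (simp add: algebra_simps power2_eq_square)
      finally show ?thesis .
    qed
    have "integral {0..1} A = integral {0..1} B - integral {0..1} D"
      unfolding AB[abs_def] using aB prim_ai[OF pD] by (intro Henstock_Kurzweil_Integration.integral_diff ai_integrable)
    then show "form_a v (\<lambda>x. complex_of_real (exp (- 1 * h x)) * y x) (\<lambda>x. complex_of_real (exp (- 1 * h x)) * \<eta> x) =
       integral {0..1} (\<lambda>x. exp (-2 * h x) * (g x * cnj (k x)) + ((c - C) * exp (-2 * h x) - (n x)\<^sup>2 * exp (-2 * h x)) * (y x * cnj (\<eta> x)))"
      using F iD by (simp add: \<psi>_def[abs_def] \<phi>_def[abs_def] E_def B_def[abs_def] P_def)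
  qed
qed

subsection \<open>Regular Sturm--Liouville systems\<close>

text \<open>In the supremum norm with weight \<open>exp (- 2 K x)\<close> the Picard operator contracts by the factor 1/2.\<close>

lemma ode_exists:
  fixes f :: "real \<Rightarrow> 'b::banach \<Rightarrow> 'b"
  assumes cont: "\<And>y. continuous_on {0..1} y \<Longrightarrow> continuous_on {0..1} (\<lambda>x. f x (y x))"
    and lip: "\<And>x a b. x \<in> {0..1} \<Longrightarrow> norm (f x a - f x b) \<le> K * norm (a - b)" and K: "K > 0"
  obtains y where "y 0 = y0" "\<And>x. x \<in> {0..1} \<Longrightarrow> (y has_vector_derivative f x (y x)) (at x within {0..1})"
proof -
  define k where "k = 2 * K"
  define G where "G \<eta> x = exp (- k * x) *\<^sub>R (y0 + integral {0..x} (\<lambda>t. f t (exp (k * t) *\<^sub>R \<eta> t)))" for \<eta> :: "real \<Rightarrow> 'b" and x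
  have cf: "continuous_on {0..1} (\<lambda>t. f t (exp (k * t) *\<^sub>R \<eta> t))" if "continuous_on {0..1} \<eta>" for \<eta> :: "real \<Rightarrow> 'b"
    by (intro cont continuous_intros that)
  have cG: "continuous_on {0..1} (G \<eta>)" if "continuous_on {0..1} \<eta>" for \<eta>
    unfolding G_def by (intro continuous_intros indefinite_integral_continuous_1 integrable_continuous_real cf that)
  \<comment> \<open>Clamping to \<open>[0,1]\<close> turns a continuous function on the interval
    into a bounded continuous one on the line, so that the fixed point theorem applies in the
    complete space of such functions.\<close>
  have "\<exists>g :: real \<Rightarrow>\<^sub>C 'b. \<forall>x. g x = G \<eta> (clamp 0 1 x)" for \<eta> :: "real \<Rightarrow>\<^sub>C 'b"
  proof -
    have "continuous_on (cbox 0 1) (G \<eta>)" using cG[of \<eta>] by simp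
    then show ?thesis by (rule continuous_on_cbox_bcontfunE) blast
  qed
  then obtain T :: "(real \<Rightarrow>\<^sub>C 'b) \<Rightarrow> (real \<Rightarrow>\<^sub>C 'b)" where T: "\<And>\<eta> x. T \<eta> x = G \<eta> (clamp 0 1 x)" by metis
  have cl: "clamp 0 1 x \<in> {0..1}" for x :: real using clamp_in_interval[of 0 1 x] by simp
  have contr: "dist (T \<eta>) (T \<theta>) \<le> (1/2) * dist \<eta> \<theta>" for \<eta> \<theta>
  proof (rule dist_bound)
    fix z :: real
    define x where "x = clamp 0 1 z"
    have x: "x \<in> {0..1}" using cl by (simp add: x_def)
    have i: "(\<lambda>t. f t (exp (k * t) *\<^sub>R apply_bcontfun \<xi> t)) integrable_on {0..x}" for \<xi>
      by (rule integrable_continuous_real[OF continuous_on_subset[OF cf]]) (use x in auto)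
    have hi: "((\<lambda>t. K * (exp (k * t) * dist \<eta> \<theta>)) has_integral (exp (k * x) / 2 * dist \<eta> \<theta> - exp (k * 0) / 2 * dist \<eta> \<theta>)) {0..x}"
      using x K by (intro fundamental_theorem_of_calculus)
        (auto simp: k_def has_real_derivative_iff_has_vector_derivative[symmetric] intro!: derivative_eq_intros)
    have "dist (T \<eta> z) (T \<theta> z) = norm (G \<eta> x - G \<theta> x)" by (simp add: T x_def dist_norm)
    also have "G \<eta> x - G \<theta> x = exp (- k * x) *\<^sub>R (integral {0..x} (\<lambda>t. f t (exp (k * t) *\<^sub>R \<eta> t)) - integral {0..x} (\<lambda>t. f t (exp (k * t) *\<^sub>R \<theta> t)))"
      by (simp add: G_def algebra_simps)
    also have "integral {0..x} (\<lambda>t. f t (exp (k * t) *\<^sub>R \<eta> t)) - integral {0..x} (\<lambda>t. f t (exp (k * t) *\<^sub>R \<theta> t))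
       = integral {0..x} (\<lambda>t. f t (exp (k * t) *\<^sub>R \<eta> t) - f t (exp (k * t) *\<^sub>R \<theta> t))"
      by (rule Henstock_Kurzweil_Integration.integral_diff[symmetric, OF i i])
    also have "norm (exp (- k * x) *\<^sub>R integral {0..x} (\<lambda>t. f t (exp (k * t) *\<^sub>R \<eta> t) - f t (exp (k * t) *\<^sub>R \<theta> t)))
       \<le> exp (- k * x) * integral {0..x} (\<lambda>t. K * (exp (k * t) * dist \<eta> \<theta>))"
    proof -
      have "norm (integral {0..x} (\<lambda>t. f t (exp (k * t) *\<^sub>R \<eta> t) - f t (exp (k * t) *\<^sub>R \<theta> t))) \<le> integral {0..x} (\<lambda>t. K * (exp (k * t) * dist \<eta> \<theta>))"
      proof (rule integral_norm_bound_integral)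
        show "(\<lambda>t. f t (exp (k * t) *\<^sub>R \<eta> t) - f t (exp (k * t) *\<^sub>R \<theta> t)) integrable_on {0..x}"
          by (rule integrable_diff[OF i i])
        show "(\<lambda>t. K * (exp (k * t) * dist \<eta> \<theta>)) integrable_on {0..x}" using hi by blast
        fix t assume "t \<in> {0..x}"
        then have "norm (f t (exp (k * t) *\<^sub>R \<eta> t) - f t (exp (k * t) *\<^sub>R \<theta> t)) \<le> K * norm (exp (k * t) *\<^sub>R \<eta> t - exp (k * t) *\<^sub>R \<theta> t)"
          using x by (intro lip) auto
        also have "\<dots> = K * (exp (k * t) * dist (\<eta> t) (\<theta> t))"
          by (simp add: dist_norm flip: scaleR_diff_right)
        also have "\<dots> \<le> K * (exp (k * t) * dist \<eta> \<theta>)"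
          using K by (intro mult_left_mono dist_bounded) auto
        finally show "norm (f t (exp (k * t) *\<^sub>R \<eta> t) - f t (exp (k * t) *\<^sub>R \<theta> t)) \<le> K * (exp (k * t) * dist \<eta> \<theta>)" .
      qed
      then show ?thesis by simp
    qed
    also have "\<dots> = exp (- k * x) * (exp (k * x) / 2 * dist \<eta> \<theta> - dist \<eta> \<theta> / 2)"
      using integral_unique[OF hi] by simp
    also have "\<dots> = (1/2) * dist \<eta> \<theta> - exp (- k * x) * (dist \<eta> \<theta> / 2)"
      by (simp add: right_diff_distrib exp_minus field_simps)
    also have "\<dots> \<le> (1/2) * dist \<eta> \<theta>" by simp
    finally show "dist (T \<eta> z) (T \<theta> z) \<le> (1/2) * dist \<eta> \<theta>" .
  qed
  have "\<exists>!\<eta>. T \<eta> = \<eta>" by (rule banach_fix_type[of "1/2"]) (use contr in auto)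
  then obtain \<eta> where \<eta>: "T \<eta> = \<eta>" by blast
  define y where "y x = exp (k * x) *\<^sub>R \<eta> x" for x
  have cy: "continuous_on {0..1} (\<lambda>x. f x (y x))" using cf[of \<eta>] by (simp add: y_def)
  have yx: "y x = y0 + integral {0..x} (\<lambda>t. f t (y t))" if "x \<in> {0..1}" for x
  proof -
    have "\<eta> x = G \<eta> x" using T[of \<eta> x] \<eta> that clamp_cancel_cbox[of x 0 1] by simp
    then show ?thesis by (simp add: y_def G_def exp_minus)
  qed
  show ?thesis
  proof (rule that)
    show "y 0 = y0" using yx[of 0] by simp
    fix x :: real assume x: "x \<in> {0..1}"
    have "((\<lambda>u. y0 + integral {0..u} (\<lambda>t. f t (y t))) has_vector_derivative f x (y x)) (at x within {0..1})"
      using has_vector_derivative_add[OF has_vector_derivative_const integral_has_vector_derivative[OF cy x]] by simp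
    then show "(y has_vector_derivative f x (y x)) (at x within {0..1})"
      by (rule has_vector_derivative_transform[OF x, rotated]) (rule yx)
  qed
qed

lemma nonincreasing01:
  fixes F :: "real \<Rightarrow> real"
  assumes "\<And>x. x \<in> {0..1} \<Longrightarrow> (F has_vector_derivative F' x) (at x within {0..1})"
    and "\<And>x. x \<in> {0..1} \<Longrightarrow> F' x \<le> 0" and "0 \<le> a" "a \<le> b" "b \<le> 1"
  shows "F b \<le> F a"
proof -
  have "(F' has_integral (F b - F a)) {a..b}"
    using assms(3-5) by (intro fundamental_theorem_of_calculus) (auto intro: has_vector_derivative_within_subset[OF assms(1)])
  then have "((\<lambda>x. - F' x) has_integral - (F b - F a)) {a..b}" by (rule has_integral_neg)
  then have "0 \<le> - (F b - F a)"
    by (rule has_integral_nonneg) (use assms in auto)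
  then show ?thesis by simp
qed

lemma constant01:
  fixes F :: "real \<Rightarrow> 'a::euclidean_space"
  assumes "\<And>x. x \<in> {0..1} \<Longrightarrow> (F has_vector_derivative 0) (at x within {0..1})" "x \<in> {0..1}"
  shows "F x = F 0"
proof -
  have "((\<lambda>_. 0) has_integral (F x - F 0)) {0..x}"
    using assms(2) by (intro fundamental_theorem_of_calculus) (auto intro: has_vector_derivative_within_subset[OF assms(1)])
  then show ?thesis using has_integral_0 has_integral_unique by (metis eq_iff_diff_eq_0)
qed

text \<open>The squared norm of the pair obeys a differential inequality with an inhomogeneous term.
  Adding \<open>e^2\<close> to the energy makes the inequality homogeneous, and
  \<open>2 a b \<le> a^2 + b^2\<close>, applied to the cross terms, produces the rate
  \<open>2 * K + 1\<close>.\<close>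

lemma gronwall_pair:
  fixes y s :: "real \<Rightarrow> complex"
  assumes y: "\<And>x. x \<in> {0..1} \<Longrightarrow> (y has_vector_derivative A x) (at x within {0..1})"
    and s: "\<And>x. x \<in> {0..1} \<Longrightarrow> (s has_vector_derivative B x) (at x within {0..1})"
    and A: "\<And>x. x \<in> {0..1} \<Longrightarrow> cmod (A x) \<le> K * cmod (s x)"
    and B: "\<And>x. x \<in> {0..1} \<Longrightarrow> cmod (B x) \<le> K * cmod (y x) + e"
    and K: "K \<ge> 0" and e: "e \<ge> 0" and x: "x \<in> {0..1}"
  shows "(cmod (y x))\<^sup>2 + (cmod (s x))\<^sup>2 \<le> exp (2 * K + 1) * ((cmod (y 0))\<^sup>2 + (cmod (s 0))\<^sup>2 + e\<^sup>2)"
proof -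
  define E where "E x = y x \<bullet> y x + s x \<bullet> s x + e\<^sup>2" for x
  define c where "c = 2 * K + 1"
  define E' where "E' x = 2 * (y x \<bullet> A x) + 2 * (s x \<bullet> B x)" for x
  have dE: "(E has_vector_derivative E' x) (at x within {0..1})" if "x \<in> {0..1}" for x
    using y[OF that] s[OF that] unfolding E_def E'_def has_vector_derivative_def
    by (auto intro!: derivative_eq_intros simp: inner_commute algebra_simps)
  define F where "F x = exp (- c * x) * E x" for x
  have dF: "(F has_vector_derivative (exp (- c * x) * E' x + (- c * exp (- c * x)) * E x)) (at x within {0..1})" if "x \<in> {0..1}" for x
  proof -
    have d1: "((\<lambda>x. exp (- c * x)) has_real_derivative (- c * exp (- c * x))) (at x within {0..1})"
      by (auto intro!: derivative_eq_intros)
    show ?thesis unfolding F_def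
      using DERIV_mult[OF d1 dE[OF that, folded has_real_derivative_iff_has_vector_derivative]]
      by (simp add: has_real_derivative_iff_has_vector_derivative[symmetric] add.commute mult.commute)
  qed
  have E'b: "E' x \<le> c * E x" if "x \<in> {0..1}" for x
  proof -
    have 1: "y x \<bullet> A x \<le> cmod (y x) * (K * cmod (s x))"
      by (rule order_trans[OF norm_cauchy_schwarz mult_left_mono[OF A[OF that]]]) simp
    have 2: "s x \<bullet> B x \<le> cmod (s x) * (K * cmod (y x) + e)"
      by (rule order_trans[OF norm_cauchy_schwarz mult_left_mono[OF B[OF that]]]) simp
    have 3: "2 * (cmod (y x) * cmod (s x)) \<le> (cmod (y x))\<^sup>2 + (cmod (s x))\<^sup>2"
      using sum_squares_bound[of "cmod (y x)" "cmod (s x)"] by simp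
    have 4: "2 * (cmod (s x) * e) \<le> (cmod (s x))\<^sup>2 + e\<^sup>2"
      using sum_squares_bound[of "cmod (s x)" e] by simp
    have "E' x \<le> 2 * K * (2 * (cmod (y x) * cmod (s x))) + 2 * (cmod (s x) * e)"
      using 1 2 unfolding E'_def by (simp add: algebra_simps)
    also have "\<dots> \<le> 2 * K * ((cmod (y x))\<^sup>2 + (cmod (s x))\<^sup>2) + ((cmod (s x))\<^sup>2 + e\<^sup>2)"
      using 3 4 K by (intro add_mono mult_left_mono) auto
    also have "\<dots> \<le> c * E x"
    proof -
      have "0 \<le> K * e\<^sup>2" "0 \<le> (cmod (y x))\<^sup>2" using K by auto
      then show ?thesis unfolding c_def E_def dot_square_norm by (simp add: algebra_simps)
    qed
    finally show ?thesis .
  qed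
  have "F x \<le> F 0"
  proof (rule nonincreasing01[OF dF])
    fix x :: real assume "x \<in> {0..1}"
    then show "exp (- c * x) * E' x + - c * exp (- c * x) * E x \<le> 0"
      using mult_left_mono[OF E'b[of x], of "exp (- c * x)"] by (simp add: algebra_simps)
  qed (use x in auto)
  then have "E x \<le> exp (c * x) * E 0" by (simp add: F_def exp_minus field_simps)
  also have "\<dots> \<le> exp c * E 0"
  proof (rule mult_right_mono)
    have "c * x \<le> c * 1" using x K by (intro mult_left_mono) (auto simp: c_def)
    then show "exp (c * x) \<le> exp c" by simp
  qed (auto simp: E_def)
  finally have "E x \<le> exp c * E 0" .
  moreover have "(cmod (y x))\<^sup>2 + (cmod (s x))\<^sup>2 \<le> E x" by (simp add: E_def dot_square_norm)
  ultimately show ?thesis unfolding E_def dot_square_norm c_def by linarith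
qed

text \<open>Continuity in \<open>x\<close> for each parameter is combined with a Lipschitz bound in
  the parameter that is uniform in \<open>x\<close>; this is the form in which the Gronwall estimate
  delivers parameter dependence.\<close>

lemma continuous_on_jointly:
  fixes f :: "'a::metric_space \<Rightarrow> 'c::metric_space \<Rightarrow> 'b::metric_space"
  assumes c: "\<And>a. continuous_on S (f a)"
    and l: "\<And>a0. \<exists>r>0. \<exists>C\<ge>0. \<forall>a. dist a a0 < r \<longrightarrow> (\<forall>x\<in>S. dist (f a x) (f a0 x) \<le> C * dist a a0)"
  shows "continuous_on (UNIV \<times> S) (\<lambda>p. f (fst p) (snd p))"
  unfolding continuous_on_iff
proof (intro ballI allI impI)
  fix p :: "'a \<times> 'c" and e :: real assume p: "p \<in> UNIV \<times> S" and e: "0 < e"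
  obtain a0 x0 where px: "p = (a0, x0)" by (cases p)
  then have x0: "x0 \<in> S" using p by simp
  obtain r C where r: "r > 0" "C \<ge> 0" "\<And>a x. dist a a0 < r \<Longrightarrow> x \<in> S \<Longrightarrow> dist (f a x) (f a0 x) \<le> C * dist a a0"
    using l[of a0] by blast
  obtain d where d: "d > 0" "\<And>x. x \<in> S \<Longrightarrow> dist x x0 < d \<Longrightarrow> dist (f a0 x) (f a0 x0) < e / 2"
    using c[of a0] x0 e unfolding continuous_on_iff by (metis half_gt_zero)
  define \<delta> where "\<delta> = min (min r d) (e / (2 * (C + 1)))"
  have "\<delta> > 0" using r d e by (simp add: \<delta>_def)
  moreover have "dist (f (fst p') (snd p')) (f (fst p) (snd p)) < e" if p': "p' \<in> UNIV \<times> S" and dd: "dist p' p < \<delta>" for p'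
  proof -
    have d1: "dist (fst p') a0 < \<delta>" and d2: "dist (snd p') x0 < \<delta>"
      using dist_fst_le[of p' p] dist_snd_le[of p' p] dd px by auto
    have xS: "snd p' \<in> S" using p' by (auto simp: mem_Times_iff)
    have "dist (f (fst p') (snd p')) (f a0 (snd p')) \<le> C * dist (fst p') a0"
      using r(3)[of "fst p'" "snd p'"] d1 xS by (simp add: \<delta>_def)
    also have "\<dots> \<le> C * (e / (2 * (C + 1)))" using d1 r(2) by (intro mult_left_mono) (auto simp: \<delta>_def)
    also have "\<dots> \<le> e / 2" using r(2) e by (simp add: field_simps)
    finally have "dist (f (fst p') (snd p')) (f a0 (snd p')) \<le> e / 2" .
    moreover have "dist (f a0 (snd p')) (f a0 x0) < e / 2" using d(2)[OF xS] d2 by (simp add: \<delta>_def)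
    ultimately show ?thesis using dist_triangle[of "f (fst p') (snd p')" "f a0 x0" "f a0 (snd p')"] px by simp
  qed
  ultimately show "\<exists>d>0. \<forall>p'\<in>UNIV \<times> S. dist p' p < d \<longrightarrow> dist (f (fst p') (snd p')) (f (fst p) (snd p)) < e" by blast
qed

section \<open>Fundamental systems and their dependence on the spectral parameter\<close>

locale sturm_liouville =
  fixes P q :: "real \<Rightarrow> real"
  assumes P_cont: "continuous_on {0..1} P" and P_pos: "\<And>x. P x > 0"
    and q_cont: "continuous_on {0..1} q" and q_nonneg: "\<And>x. q x \<ge> 0"
begin

text \<open>A right-hand side \<open>f\<close> of the resolvent equation is only square integrable.
  It enters through its primitive \<open>F\<close>, which is added to the quasi-derivative
  \<open>P y'\<close> to give \<open>s\<close>; in this form the system has a continuous right-hand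
  side and classical solutions.\<close>

definition sol :: "complex \<Rightarrow> (real \<Rightarrow> complex) \<Rightarrow> (real \<Rightarrow> complex) \<Rightarrow> (real \<Rightarrow> complex) \<Rightarrow> bool" where
  "sol \<Lambda> F y s \<longleftrightarrow> (\<forall>x\<in>{0..1}. (y has_vector_derivative ((s x - F x) / complex_of_real (P x))) (at x within {0..1}) \<and>
     (s has_vector_derivative (- (complex_of_real (q x) + \<Lambda> * complex_of_real (P x)) * y x)) (at x within {0..1}))"

lemma sol_continuous:
  assumes "sol \<Lambda> F y s" shows "continuous_on {0..1} y" "continuous_on {0..1} s"
  using assms unfolding sol_def continuous_on_eq_continuous_within
  by (auto intro: has_vector_derivative_continuous)

lemma P_nz: "complex_of_real (P x) \<noteq> 0" "P x \<noteq> 0"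
  using P_pos[of x] by auto

lemma coefficient_bound:
  obtains K where "K > 0" "\<And>x (\<Lambda>::complex). x \<in> {0..1} \<Longrightarrow> cmod \<Lambda> \<le> R \<Longrightarrow> cmod (complex_of_real (q x) + \<Lambda> * complex_of_real (P x)) \<le> K"
    "\<And>x. x \<in> {0..1} \<Longrightarrow> 1 / P x \<le> K" "\<And>x. x \<in> {0..1} \<Longrightarrow> P x \<le> K"
proof -
  have b: "\<exists>B>0. \<forall>x\<in>{0..1}. \<bar>g x\<bar> \<le> B" if "continuous_on {0..1} g" for g :: "real \<Rightarrow> real"
    using compact_imp_bounded[OF compact_continuous_image[OF that compact_Icc]]
    unfolding bounded_pos by auto
  have "continuous_on {0..1} (\<lambda>x. 1 / P x)" using P_nz by (intro continuous_intros P_cont) auto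
  then obtain B1 where B1: "B1 > 0" "\<And>x. x \<in> {0..1} \<Longrightarrow> \<bar>1 / P x\<bar> \<le> B1" using b by metis
  obtain B2 where B2: "B2 > 0" "\<And>x. x \<in> {0..1} \<Longrightarrow> \<bar>P x\<bar> \<le> B2" using b[OF P_cont] by metis
  obtain B3 where B3: "B3 > 0" "\<And>x. x \<in> {0..1} \<Longrightarrow> \<bar>q x\<bar> \<le> B3" using b[OF q_cont] by metis
  show ?thesis
  proof (rule that[of "B1 + B2 + (B3 + \<bar>R\<bar> * B2)"])
    show "B1 + B2 + (B3 + \<bar>R\<bar> * B2) > 0" using B1 B2 B3 by (simp add: add_pos_nonneg)
    have n: "0 \<le> \<bar>R\<bar> * B2" using B2 by simp
    fix x :: real and \<Lambda> :: complex assume x: "x \<in> {0..1}"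
    show "1 / P x \<le> B1 + B2 + (B3 + \<bar>R\<bar> * B2)" "P x \<le> B1 + B2 + (B3 + \<bar>R\<bar> * B2)"
      using B1(2)[OF x] B2(2)[OF x] B1(1) B2(1) B3(1) n by linarith+
    assume "cmod \<Lambda> \<le> R"
    then have "cmod \<Lambda> * \<bar>P x\<bar> \<le> \<bar>R\<bar> * B2" using B2(2)[OF x] by (intro mult_mono) auto
    then have "cmod (complex_of_real (q x) + \<Lambda> * complex_of_real (P x)) \<le> B3 + \<bar>R\<bar> * B2"
      using norm_triangle_ineq[of "complex_of_real (q x)" "\<Lambda> * P x"] B3(2)[OF x] by (simp add: norm_mult)
    then show "cmod (complex_of_real (q x) + \<Lambda> * complex_of_real (P x)) \<le> B1 + B2 + (B3 + \<bar>R\<bar> * B2)" using B1 B2 by simp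
  qed
qed

lemma sol_exists:
  assumes "continuous_on {0..1} F" shows "\<exists>y s. sol \<Lambda> F y s \<and> y 0 = a \<and> s 0 = b"
proof -
  obtain K where K: "K > 0" "\<And>x. x \<in> {0..1} \<Longrightarrow> cmod (complex_of_real (q x) + \<Lambda> * complex_of_real (P x)) \<le> K" "\<And>x. x \<in> {0..1} \<Longrightarrow> 1 / P x \<le> K"
    by (rule coefficient_bound[of "cmod \<Lambda>"]) blast
  define f where "f x p = ((snd p - F x) / complex_of_real (P x), - (complex_of_real (q x) + \<Lambda> * complex_of_real (P x)) * fst p)" for x and p :: "complex \<times> complex"
  obtain z where z: "z 0 = (a, b)" "\<And>x. x \<in> {0..1} \<Longrightarrow> (z has_vector_derivative f x (z x)) (at x within {0..1})"
  proof (rule ode_exists[of f "2 * K" "(a,b)"])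
    show "continuous_on {0..1} (\<lambda>x. f x (y x))" if "continuous_on {0..1} y" for y
      unfolding f_def using P_nz by (intro continuous_intros that assms P_cont q_cont) auto
    show "norm (f x p - f x p') \<le> 2 * K * norm (p - p')" if x: "x \<in> {0..1}" for x p p'
    proof -
      have "f x p - f x p' = (complex_of_real (1 / P x) * (snd p - snd p'), - (complex_of_real (q x) + \<Lambda> * complex_of_real (P x)) * (fst p - fst p'))"
        by (simp add: f_def algebra_simps diff_divide_distrib)
      then have "norm (f x p - f x p') \<le> cmod (complex_of_real (1 / P x) * (snd p - snd p')) + cmod (- (complex_of_real (q x) + \<Lambda> * complex_of_real (P x)) * (fst p - fst p'))"
        by (simp add: norm_Pair_le)
      also have "\<dots> = \<bar>1 / P x\<bar> * cmod (snd (p - p')) + cmod (complex_of_real (q x) + \<Lambda> * complex_of_real (P x)) * cmod (fst (p - p'))"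
        unfolding norm_mult norm_of_real by (simp only: norm_minus_cancel fst_diff snd_diff)
      also have "\<dots> \<le> K * norm (p - p') + K * norm (p - p')"
        using K(2)[OF x] K(3)[OF x] K(1) P_pos[of x]
          norm_fst_le[of "fst (p - p')" "snd (p - p')", unfolded prod.collapse] norm_snd_le[of "snd (p - p')" "fst (p - p')", unfolded prod.collapse]
        by (intro add_mono mult_mono) (auto simp: abs_of_pos simp del: fst_diff snd_diff)
      finally show ?thesis by simp
    qed
    show "2 * K > 0" using K by simp
  next
    fix y assume "y 0 = (a, b)" "\<And>x. x \<in> {0..1} \<Longrightarrow> (y has_vector_derivative f x (y x)) (at x within {0..1})"
    then show thesis by (rule that)
  qed
  have "sol \<Lambda> F (\<lambda>x. fst (z x)) (\<lambda>x. snd (z x))"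
    unfolding sol_def
  proof (intro ballI conjI)
    fix x :: real assume x: "x \<in> {0..1}"
    show "((\<lambda>x. fst (z x)) has_vector_derivative (snd (z x) - F x) / complex_of_real (P x)) (at x within {0..1})"
      using bounded_linear.has_vector_derivative[OF bounded_linear_fst z(2)[OF x]] by (simp add: f_def)
    show "((\<lambda>x. snd (z x)) has_vector_derivative - (complex_of_real (q x) + \<Lambda> * complex_of_real (P x)) * fst (z x)) (at x within {0..1})"
      using bounded_linear.has_vector_derivative[OF bounded_linear_snd z(2)[OF x]] by (simp add: f_def)
  qed
  then show ?thesis using z(1) by (intro exI[of _ "\<lambda>x. fst (z x)"] exI[of _ "\<lambda>x. snd (z x)"]) simp
qed

abbreviation "sol0 \<Lambda> \<equiv> sol \<Lambda> (\<lambda>_. 0)"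

lemma sol_lincomb:
  assumes "sol \<Lambda> F y s" "sol \<Lambda> G z t"
  shows "sol \<Lambda> (\<lambda>x. a * F x + b * G x) (\<lambda>x. a * y x + b * z x) (\<lambda>x. a * s x + b * t x)"
  unfolding sol_def
proof (intro ballI conjI)
  fix x :: real assume x: "x \<in> {0..1}"
  note d = assms[unfolded sol_def, rule_format, OF x]
  have "((\<lambda>x. a * y x + b * z x) has_vector_derivative a * ((s x - F x) / complex_of_real (P x)) + b * ((t x - G x) / complex_of_real (P x))) (at x within {0..1})"
    using d by (intro has_vector_derivative_add has_vector_derivative_mult_right) auto
  then show "((\<lambda>x. a * y x + b * z x) has_vector_derivative (a * s x + b * t x - (a * F x + b * G x)) / complex_of_real (P x)) (at x within {0..1})"
    by (rule has_vector_derivative_eq_rhs) (simp add: algebra_simps add_divide_distrib diff_divide_distrib)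
  have "((\<lambda>x. a * s x + b * t x) has_vector_derivative a * (- (complex_of_real (q x) + \<Lambda> * complex_of_real (P x)) * y x) + b * (- (complex_of_real (q x) + \<Lambda> * complex_of_real (P x)) * z x)) (at x within {0..1})"
    using d by (intro has_vector_derivative_add has_vector_derivative_mult_right) auto
  then show "((\<lambda>x. a * s x + b * t x) has_vector_derivative - (complex_of_real (q x) + \<Lambda> * complex_of_real (P x)) * (a * y x + b * z x)) (at x within {0..1})"
    by (rule has_vector_derivative_eq_rhs) (simp add: algebra_simps)
qed

text \<open>One constant serves all parameters in a disc, as the comparison of neighbouring
  parameters requires.\<close>

lemma sol0_bound:
  obtains M where "M > 0" "\<And>\<Lambda> y s x. cmod \<Lambda> \<le> R \<Longrightarrow> sol0 \<Lambda> y s \<Longrightarrow> x \<in> {0..1} \<Longrightarrow>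
     (cmod (y x))\<^sup>2 + (cmod (s x))\<^sup>2 \<le> M * ((cmod (y 0))\<^sup>2 + (cmod (s 0))\<^sup>2)"
proof -
  obtain K where K: "K > 0" "\<And>x (\<Lambda>::complex). x \<in> {0..1} \<Longrightarrow> cmod \<Lambda> \<le> R \<Longrightarrow> cmod (complex_of_real (q x) + \<Lambda> * complex_of_real (P x)) \<le> K" "\<And>x. x \<in> {0..1} \<Longrightarrow> 1 / P x \<le> K"
    by (rule coefficient_bound[of R]) blast
  show ?thesis
  proof (rule that[of "exp (2 * K + 1)"])
    fix \<Lambda> y s and x :: real assume \<Lambda>: "cmod \<Lambda> \<le> R" and s: "sol0 \<Lambda> y s" and x: "x \<in> {0..1}"
    have "(cmod (y x))\<^sup>2 + (cmod (s x))\<^sup>2 \<le> exp (2 * K + 1) * ((cmod (y 0))\<^sup>2 + (cmod (s 0))\<^sup>2 + 0\<^sup>2)"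
    proof (rule gronwall_pair[where A = "\<lambda>x. (s x - 0) / complex_of_real (P x)" and B = "\<lambda>x. - (complex_of_real (q x) + \<Lambda> * complex_of_real (P x)) * y x" and K = K])
      fix x :: real assume x: "x \<in> {0..1}"
      show "(y has_vector_derivative (s x - 0) / complex_of_real (P x)) (at x within {0..1})"
        "(s has_vector_derivative - (complex_of_real (q x) + \<Lambda> * complex_of_real (P x)) * y x) (at x within {0..1})"
        using s x unfolding sol_def by auto
      show "cmod ((s x - 0) / complex_of_real (P x)) \<le> K * cmod (s x)"
        using mult_right_mono[OF K(3)[OF x], of "cmod (s x)"] P_pos[of x] by (simp add: norm_divide)
      show "cmod (- (complex_of_real (q x) + \<Lambda> * complex_of_real (P x)) * y x) \<le> K * cmod (y x) + 0"
        using mult_right_mono[OF K(2)[OF x \<Lambda>], of "cmod (y x)"] unfolding norm_mult norm_minus_cancel by simp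
    qed (use K x in auto)
    then show "(cmod (y x))\<^sup>2 + (cmod (s x))\<^sup>2 \<le> exp (2 * K + 1) * ((cmod (y 0))\<^sup>2 + (cmod (s 0))\<^sup>2)" by simp
  qed simp
qed

lemma sol_unique:
  assumes "sol \<Lambda> F y s" "sol \<Lambda> F z t" "y 0 = z 0" "s 0 = t 0" and x: "x \<in> {0..1}"
  shows "y x = z x" "s x = t x"
proof -
  have "sol \<Lambda> (\<lambda>x. 1 * F x + (-1) * F x) (\<lambda>x. 1 * y x + (-1) * z x) (\<lambda>x. 1 * s x + (-1) * t x)"
    by (rule sol_lincomb[OF assms(1,2)])
  then have s0: "sol0 \<Lambda> (\<lambda>x. y x - z x) (\<lambda>x. s x - t x)" by simp
  obtain M where M: "\<And>\<Lambda>' y s x. cmod \<Lambda>' \<le> cmod \<Lambda> \<Longrightarrow> sol0 \<Lambda>' y s \<Longrightarrow> x \<in> {0..1} \<Longrightarrow>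
     (cmod (y x))\<^sup>2 + (cmod (s x))\<^sup>2 \<le> M * ((cmod (y 0))\<^sup>2 + (cmod (s 0))\<^sup>2)" by (rule sol0_bound[of "cmod \<Lambda>"]) blast
  have "(cmod (y x - z x))\<^sup>2 + (cmod (s x - t x))\<^sup>2 \<le> M * ((cmod (y 0 - z 0))\<^sup>2 + (cmod (s 0 - t 0))\<^sup>2)"
    by (rule M[OF order_refl s0 x])
  then have "(cmod (y x - z x))\<^sup>2 + (cmod (s x - t x))\<^sup>2 \<le> 0" using assms by simp
  moreover have "0 \<le> (cmod (y x - z x))\<^sup>2" "0 \<le> (cmod (s x - t x))\<^sup>2" by auto
  ultimately have "(cmod (y x - z x))\<^sup>2 = 0" "(cmod (s x - t x))\<^sup>2 = 0" by linarith+
  then show "y x = z x" "s x = t x" by auto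
qed

definition fund :: "complex \<Rightarrow> complex \<Rightarrow> complex \<Rightarrow> (real \<Rightarrow> complex) \<times> (real \<Rightarrow> complex)" where
  "fund \<Lambda> a b = (SOME p. sol0 \<Lambda> (fst p) (snd p) \<and> fst p 0 = a \<and> snd p 0 = b)"

definition "Y1 \<Lambda> = fst (fund \<Lambda> 1 0)"
definition "S1 \<Lambda> = snd (fund \<Lambda> 1 0)"
definition "Y2 \<Lambda> = fst (fund \<Lambda> 0 1)"
definition "S2 \<Lambda> = snd (fund \<Lambda> 0 1)"

lemma fund: "sol0 \<Lambda> (fst (fund \<Lambda> a b)) (snd (fund \<Lambda> a b))" "fst (fund \<Lambda> a b) 0 = a" "snd (fund \<Lambda> a b) 0 = b"
proof -
  obtain y s where "sol0 \<Lambda> y s \<and> y 0 = a \<and> s 0 = b" using sol_exists[OF continuous_on_const, of \<Lambda> 0 a b] by blast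
  then have "\<exists>p. sol0 \<Lambda> (fst p) (snd p) \<and> fst p 0 = a \<and> snd p 0 = b" by (intro exI[of _ "(y, s)"]) simp
  then have "sol0 \<Lambda> (fst (fund \<Lambda> a b)) (snd (fund \<Lambda> a b)) \<and> fst (fund \<Lambda> a b) 0 = a \<and> snd (fund \<Lambda> a b) 0 = b"
    unfolding fund_def by (rule someI_ex)
  then show "sol0 \<Lambda> (fst (fund \<Lambda> a b)) (snd (fund \<Lambda> a b))" "fst (fund \<Lambda> a b) 0 = a" "snd (fund \<Lambda> a b) 0 = b" by auto
qed

lemma Y1: "sol0 \<Lambda> (Y1 \<Lambda>) (S1 \<Lambda>)" "Y1 \<Lambda> 0 = 1" "S1 \<Lambda> 0 = 0"
  unfolding Y1_def S1_def by (rule fund)+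

lemma Y2: "sol0 \<Lambda> (Y2 \<Lambda>) (S2 \<Lambda>)" "Y2 \<Lambda> 0 = 0" "S2 \<Lambda> 0 = 1"
  unfolding Y2_def S2_def by (rule fund)+

lemma sol0_fund: "sol0 \<Lambda> (\<lambda>x. a * Y1 \<Lambda> x + b * Y2 \<Lambda> x) (\<lambda>x. a * S1 \<Lambda> x + b * S2 \<Lambda> x)"
  using sol_lincomb[OF Y1(1) Y2(1)] by simp

lemma sol0_repr:
  assumes "sol0 \<Lambda> y s" "x \<in> {0..1}"
  shows "y x = y 0 * Y1 \<Lambda> x + s 0 * Y2 \<Lambda> x" "s x = y 0 * S1 \<Lambda> x + s 0 * S2 \<Lambda> x"
proof -
  have "y 0 = y 0 * Y1 \<Lambda> 0 + s 0 * Y2 \<Lambda> 0" "s 0 = y 0 * S1 \<Lambda> 0 + s 0 * S2 \<Lambda> 0" by (simp_all add: Y1 Y2)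
  from sol_unique[OF assms(1) sol0_fund this assms(2)]
  show "y x = y 0 * Y1 \<Lambda> x + s 0 * Y2 \<Lambda> x" "s x = y 0 * S1 \<Lambda> x + s 0 * S2 \<Lambda> x" by blast+
qed

lemma wronskian:
  assumes "sol0 \<Lambda> y s" "sol0 \<Lambda> z t" "x \<in> {0..1}"
  shows "y x * t x - z x * s x = y 0 * t 0 - z 0 * s 0"
proof (rule constant01[OF _ assms(3)])
  fix x :: real assume x: "x \<in> {0..1}"
  note d1 = assms(1)[unfolded sol_def, rule_format, OF x, THEN conjunct1] assms(1)[unfolded sol_def, rule_format, OF x, THEN conjunct2]
  note d2 = assms(2)[unfolded sol_def, rule_format, OF x, THEN conjunct1] assms(2)[unfolded sol_def, rule_format, OF x, THEN conjunct2]
  show "((\<lambda>x. y x * t x - z x * s x) has_vector_derivative 0) (at x within {0..1})"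
    by (rule has_vector_derivative_eq_rhs[OF has_vector_derivative_diff[OF has_vector_derivative_mult[OF d1(1) d2(2)] has_vector_derivative_mult[OF d2(1) d1(2)]]])
      (simp add: algebra_simps)
qed

lemma fund_det: "x \<in> {0..1} \<Longrightarrow> Y1 \<Lambda> x * S2 \<Lambda> x - Y2 \<Lambda> x * S1 \<Lambda> x = 1"
  using wronskian[OF Y1(1) Y2(1), of x \<Lambda>] by (simp add: Y1 Y2)

text \<open>The difference of two solutions with equal initial values starts at 0 and solves the
  system at \<Lambda> with the source \<open>(\<Lambda> - \<Lambda>0) P y0\<close>, where
  \<open>y0\<close> is the reference solution. Gronwall with \<open>e\<close> proportional to the
  distance of the parameters gives the bound; staying within distance 1 fixes the disc in which the
  constants are taken.\<close>

lemma fund_lipschitz: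
  "\<exists>C\<ge>0. \<forall>\<Lambda>. dist \<Lambda> \<Lambda>0 < 1 \<longrightarrow> (\<forall>x\<in>{0..1}. dist (fst (fund \<Lambda> a b) x) (fst (fund \<Lambda>0 a b) x) \<le> C * dist \<Lambda> \<Lambda>0 \<and>
      dist (snd (fund \<Lambda> a b) x) (snd (fund \<Lambda>0 a b) x) \<le> C * dist \<Lambda> \<Lambda>0)"
proof -
  define R where "R = cmod \<Lambda>0 + 1"
  obtain K where K: "K > 0" "\<And>x (\<Lambda>::complex). x \<in> {0..1} \<Longrightarrow> cmod \<Lambda> \<le> R \<Longrightarrow> cmod (complex_of_real (q x) + \<Lambda> * complex_of_real (P x)) \<le> K" "\<And>x. x \<in> {0..1} \<Longrightarrow> 1 / P x \<le> K" "\<And>x. x \<in> {0..1} \<Longrightarrow> P x \<le> K"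
    by (rule coefficient_bound[of R]) blast
  obtain M where M: "M > 0" "\<And>\<Lambda> y s x. cmod \<Lambda> \<le> R \<Longrightarrow> sol0 \<Lambda> y s \<Longrightarrow> x \<in> {0..1} \<Longrightarrow>
     (cmod (y x))\<^sup>2 + (cmod (s x))\<^sup>2 \<le> M * ((cmod (y 0))\<^sup>2 + (cmod (s 0))\<^sup>2)" by (rule sol0_bound[of R]) blast
  define m where "m = sqrt (M * ((cmod a)\<^sup>2 + (cmod b)\<^sup>2))"
  define C where "C = sqrt (exp (2 * K + 1)) * (K * m)"
  have m0: "m \<ge> 0" using M by (simp add: m_def)
  have C0: "C \<ge> 0" using K m0 by (simp add: C_def)
  have "dist (fst (fund \<Lambda> a b) x) (fst (fund \<Lambda>0 a b) x) \<le> C * dist \<Lambda> \<Lambda>0 \<and>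
      dist (snd (fund \<Lambda> a b) x) (snd (fund \<Lambda>0 a b) x) \<le> C * dist \<Lambda> \<Lambda>0" if d: "dist \<Lambda> \<Lambda>0 < 1" and x: "x \<in> {0..1}" for \<Lambda> x
  proof -
    define y where "y x = fst (fund \<Lambda> a b) x - fst (fund \<Lambda>0 a b) x" for x
    define s where "s x = snd (fund \<Lambda> a b) x - snd (fund \<Lambda>0 a b) x" for x
    have \<Lambda>R: "cmod \<Lambda> \<le> R" using norm_triangle_sub[of \<Lambda> \<Lambda>0] d by (simp add: R_def dist_norm)
    have \<Lambda>0R: "cmod \<Lambda>0 \<le> R" by (simp add: R_def)
    have mb: "cmod (fst (fund \<Lambda>0 a b) x) \<le> m" if "x \<in> {0..1}" for x
    proof -
      have "(cmod (fst (fund \<Lambda>0 a b) x))\<^sup>2 + (cmod (snd (fund \<Lambda>0 a b) x))\<^sup>2 \<le> M * ((cmod a)\<^sup>2 + (cmod b)\<^sup>2)"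
        using M(2)[OF \<Lambda>0R fund(1) that, of a b] by (simp add: fund)
      moreover have "0 \<le> (cmod (snd (fund \<Lambda>0 a b) x))\<^sup>2" by simp
      ultimately have "(cmod (fst (fund \<Lambda>0 a b) x))\<^sup>2 \<le> M * ((cmod a)\<^sup>2 + (cmod b)\<^sup>2)" by linarith
      then show ?thesis unfolding m_def by (rule real_le_rsqrt)
    qed
    let ?e = "dist \<Lambda> \<Lambda>0 * (K * m)"
    have "(cmod (y x))\<^sup>2 + (cmod (s x))\<^sup>2 \<le> exp (2 * K + 1) * ((cmod (y 0))\<^sup>2 + (cmod (s 0))\<^sup>2 + ?e\<^sup>2)"
    proof (rule gronwall_pair[where A = "\<lambda>x. s x / complex_of_real (P x)" and K = K
          and B = "\<lambda>x. - (complex_of_real (q x) + \<Lambda> * complex_of_real (P x)) * y x - (\<Lambda> - \<Lambda>0) * complex_of_real (P x) * fst (fund \<Lambda>0 a b) x"])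
      fix x :: real assume x: "x \<in> {0..1}"
      note d1 = fund(1)[of \<Lambda> a b, unfolded sol_def, rule_format, OF x]
      note d2 = fund(1)[of \<Lambda>0 a b, unfolded sol_def, rule_format, OF x]
      show "(y has_vector_derivative s x / complex_of_real (P x)) (at x within {0..1})"
        unfolding y_def s_def
        by (rule has_vector_derivative_eq_rhs[OF has_vector_derivative_diff[OF d1[THEN conjunct1] d2[THEN conjunct1]]]) (simp add: diff_divide_distrib)
      show "(s has_vector_derivative - (complex_of_real (q x) + \<Lambda> * complex_of_real (P x)) * y x - (\<Lambda> - \<Lambda>0) * complex_of_real (P x) * fst (fund \<Lambda>0 a b) x) (at x within {0..1})"
        unfolding y_def s_def
        by (rule has_vector_derivative_eq_rhs[OF has_vector_derivative_diff[OF d1[THEN conjunct2] d2[THEN conjunct2]]]) (simp add: algebra_simps)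
      show "cmod (s x / complex_of_real (P x)) \<le> K * cmod (s x)"
        using mult_right_mono[OF K(3)[OF x], of "cmod (s x)"] P_pos[of x] by (simp add: norm_divide)
      have "cmod (- (complex_of_real (q x) + \<Lambda> * complex_of_real (P x)) * y x) \<le> K * cmod (y x)"
        using mult_right_mono[OF K(2)[OF x \<Lambda>R], of "cmod (y x)"] unfolding norm_mult norm_minus_cancel by simp
      moreover have "cmod ((\<Lambda> - \<Lambda>0) * complex_of_real (P x) * fst (fund \<Lambda>0 a b) x) \<le> ?e"
        unfolding norm_mult dist_norm using K(4)[OF x] P_pos[of x] mb[OF x] K(1)
        by (simp only: mult.assoc) (intro mult_left_mono mult_mono, auto)
      ultimately show "cmod (- (complex_of_real (q x) + \<Lambda> * complex_of_real (P x)) * y x - (\<Lambda> - \<Lambda>0) * complex_of_real (P x) * fst (fund \<Lambda>0 a b) x) \<le> K * cmod (y x) + ?e"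
        using norm_triangle_ineq4[of "- (complex_of_real (q x) + \<Lambda> * complex_of_real (P x)) * y x" "(\<Lambda> - \<Lambda>0) * complex_of_real (P x) * fst (fund \<Lambda>0 a b) x"] by linarith
    qed (use K x m0 in auto)
    then have "(cmod (y x))\<^sup>2 + (cmod (s x))\<^sup>2 \<le> exp (2 * K + 1) * ?e\<^sup>2" by (simp add: y_def s_def fund)
    also have "\<dots> = (C * dist \<Lambda> \<Lambda>0)\<^sup>2" by (simp add: C_def power_mult_distrib)
    finally have *: "(cmod (y x))\<^sup>2 + (cmod (s x))\<^sup>2 \<le> (C * dist \<Lambda> \<Lambda>0)\<^sup>2" .
    have n: "0 \<le> (cmod (y x))\<^sup>2" "0 \<le> (cmod (s x))\<^sup>2" by auto
    have "(cmod (y x))\<^sup>2 \<le> (C * dist \<Lambda> \<Lambda>0)\<^sup>2" "(cmod (s x))\<^sup>2 \<le> (C * dist \<Lambda> \<Lambda>0)\<^sup>2" using * n by linarith+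
    then have "cmod (y x) \<le> C * dist \<Lambda> \<Lambda>0" "cmod (s x) \<le> C * dist \<Lambda> \<Lambda>0"
      using C0 by (auto intro: power2_le_imp_le)
    then show ?thesis by (simp add: y_def s_def dist_norm)
  qed
  then show ?thesis using C0 by blast
qed

lemma fund_continuous:
  "continuous_on (UNIV \<times> {0..1}) (\<lambda>p. fst (fund (fst p) a b) (snd p))"
  "continuous_on (UNIV \<times> {0..1}) (\<lambda>p. snd (fund (fst p) a b) (snd p))"
proof -
  show "continuous_on (UNIV \<times> {0..1}) (\<lambda>p. fst (fund (fst p) a b) (snd p))"
  proof (rule continuous_on_jointly)
    show "continuous_on {0..1} (fst (fund \<Lambda> a b))" for \<Lambda> by (rule sol_continuous[OF fund(1)])
    show "\<exists>r>0. \<exists>C\<ge>0. \<forall>\<Lambda>. dist \<Lambda> \<Lambda>0 < r \<longrightarrow> (\<forall>x\<in>{0..1}. dist (fst (fund \<Lambda> a b) x) (fst (fund \<Lambda>0 a b) x) \<le> C * dist \<Lambda> \<Lambda>0)" for \<Lambda>0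
      by (rule exI[of _ 1]) (use fund_lipschitz[of \<Lambda>0 a b] in auto)
  qed
  show "continuous_on (UNIV \<times> {0..1}) (\<lambda>p. snd (fund (fst p) a b) (snd p))"
  proof (rule continuous_on_jointly)
    show "continuous_on {0..1} (snd (fund \<Lambda> a b))" for \<Lambda> by (rule sol_continuous[OF fund(1)])
    show "\<exists>r>0. \<exists>C\<ge>0. \<forall>\<Lambda>. dist \<Lambda> \<Lambda>0 < r \<longrightarrow> (\<forall>x\<in>{0..1}. dist (snd (fund \<Lambda> a b) x) (snd (fund \<Lambda>0 a b) x) \<le> C * dist \<Lambda> \<Lambda>0)" for \<Lambda>0
      by (rule exI[of _ 1]) (use fund_lipschitz[of \<Lambda>0 a b] in auto)
  qed
qed

lemma fund_joint [continuous_intros]: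
  fixes f :: "'t::topological_space \<Rightarrow> complex" and g :: "'t \<Rightarrow> real"
  assumes "continuous_on T f" "continuous_on T g" "\<And>t. t \<in> T \<Longrightarrow> g t \<in> {0..1}"
  shows "continuous_on T (\<lambda>t. Y1 (f t) (g t))" "continuous_on T (\<lambda>t. Y2 (f t) (g t))"
    "continuous_on T (\<lambda>t. S1 (f t) (g t))" "continuous_on T (\<lambda>t. S2 (f t) (g t))"
proof -
  have c: "continuous_on T (\<lambda>t. (f t, g t))" by (intro continuous_intros assms)
  have i: "(\<lambda>t. (f t, g t)) ` T \<subseteq> UNIV \<times> {0..1}" using assms(3) by auto
  show "continuous_on T (\<lambda>t. Y1 (f t) (g t))" "continuous_on T (\<lambda>t. Y2 (f t) (g t))"
    "continuous_on T (\<lambda>t. S1 (f t) (g t))" "continuous_on T (\<lambda>t. S2 (f t) (g t))"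
    unfolding Y1_def Y2_def S1_def S2_def
    using continuous_on_compose2[OF fund_continuous(1) c i] continuous_on_compose2[OF fund_continuous(2) c i] by auto
qed

lemma sol0_cnj:
  assumes "sol0 \<Lambda> y s" shows "sol0 (cnj \<Lambda>) (\<lambda>x. cnj (y x)) (\<lambda>x. cnj (s x))"
  unfolding sol_def
proof (intro ballI conjI)
  fix x :: real assume x: "x \<in> {0..1}"
  note d = assms[unfolded sol_def, rule_format, OF x]
  show "((\<lambda>x. cnj (y x)) has_vector_derivative (cnj (s x) - 0) / complex_of_real (P x)) (at x within {0..1})"
    using bounded_linear.has_vector_derivative[OF bounded_linear_cnj d[THEN conjunct1]] by simp
  show "((\<lambda>x. cnj (s x)) has_vector_derivative - (complex_of_real (q x) + cnj \<Lambda> * complex_of_real (P x)) * cnj (y x)) (at x within {0..1})"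
    using bounded_linear.has_vector_derivative[OF bounded_linear_cnj d[THEN conjunct2]] by simp
qed

lemma fund_real:
  assumes "x \<in> {0..1}"
  shows "Y1 (of_real l) x \<in> \<real>" "S1 (of_real l) x \<in> \<real>" "Y2 (of_real l) x \<in> \<real>" "S2 (of_real l) x \<in> \<real>"
proof -
  have s1: "sol0 (of_real l) (\<lambda>x. cnj (Y1 (of_real l) x)) (\<lambda>x. cnj (S1 (of_real l) x))"
    using sol0_cnj[OF Y1(1)[of "of_real l"]] by simp
  have s2: "sol0 (of_real l) (\<lambda>x. cnj (Y2 (of_real l) x)) (\<lambda>x. cnj (S2 (of_real l) x))"
    using sol0_cnj[OF Y2(1)[of "of_real l"]] by simp
  show "Y1 (of_real l) x \<in> \<real>" "S1 (of_real l) x \<in> \<real>"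
    unfolding Reals_cnj_iff using sol_unique[OF s1 Y1(1) _ _ assms] by (simp_all add: Y1)
  show "Y2 (of_real l) x \<in> \<real>" "S2 (of_real l) x \<in> \<real>"
    unfolding Reals_cnj_iff using sol_unique[OF s2 Y2(1) _ _ assms] by (simp_all add: Y2)
qed

end

subsection \<open>Weak solutions and boundary conditions\<close>

lemma sq_integral_zero_ae:
  fixes f :: "real \<Rightarrow> complex"
  assumes f: "sqint f" and z: "integral {0..1} (\<lambda>x. f x * cnj (f x)) = 0"
  shows "AE x in lebesgue. x \<in> {0..1} \<longrightarrow> f x = 0"
proof -
  have "integral {0..1} (\<lambda>x. f x * cnj (f x)) = integral {0..1} (\<lambda>x. complex_of_real ((cmod (f x))\<^sup>2))"
    by (simp only: complex_norm_square)
  also have "\<dots> = complex_of_real (integral {0..1} (\<lambda>x. (cmod (f x))\<^sup>2))"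
    using integral_linear[OF ai_integrable[OF sqint_ai_sq[OF f]] bounded_linear_of_real[where 'a=complex]] by (simp add: o_def)
  finally have "integral {0..1} (\<lambda>x. (cmod (f x))\<^sup>2) = 0" using z by simp
  then have "integral\<^sup>L (lebesgue_on {0..1}) (\<lambda>x. (cmod (f x))\<^sup>2) = 0"
    using lebesgue_on_integral_eq(2)[OF sqint_ai_sq[OF f]] by simp
  then have "AE x in lebesgue_on {0..1}. (cmod (f x))\<^sup>2 = 0"
    using integral_nonneg_eq_0_iff_AE[of "lebesgue_on {0..1}" "\<lambda>x. (cmod (f x))\<^sup>2"] f by (simp add: sqint_def)
  then have "AE x in lebesgue. x \<in> {0..1} \<longrightarrow> (cmod (f x))\<^sup>2 = 0"
    by (subst (asm) AE_restrict_space_iff) auto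
  then show ?thesis by eventually_elim auto
qed

lemma continuous_ae_zero:
  fixes f :: "real \<Rightarrow> complex"
  assumes c: "continuous_on {0..1} f" and z: "ae_zero_I f" and x: "x \<in> {0..1}"
  shows "f x = 0"
proof -
  have "f t = 0" if t: "t \<in> {0<..<1}" for t
  proof (rule ccontr)
    assume ft: "f t \<noteq> 0"
    have c': "continuous_on {0<..<1} f" by (rule continuous_on_subset[OF c]) auto
    have op: "open ({0<..<1} \<inter> f -` (- {0}))" by (rule continuous_open_preimage[OF c']) auto
    have ne: "{0<..<1} \<inter> f -` (- {0}) \<noteq> {}" using t ft by blast
    have "AE x in lebesgue. x \<notin> {0<..<1} \<inter> f -` (- {0})"
      using z unfolding ae_zero_I_def by eventually_elim auto
    then have "{0<..<1} \<inter> f -` (- {0}) \<in> null_sets lebesgue"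
      using op by (subst (asm) AE_iff_null_sets[symmetric]) auto
    then show False using open_not_negligible[OF op ne] by (simp add: negligible_iff_null_sets)
  qed
  then have "\<And>t. t \<in> {0<..<1} \<Longrightarrow> f t = 0" .
  moreover have "closure {0<..<1::real} = {0..1}" by simp
  ultimately show ?thesis using continuous_constant_on_closure[of "{0<..<1}" f 0 x] c x by metis
qed

lemma ae_zero_I_iff:
  assumes "continuous_on {0..1} f" shows "ae_zero_I f \<longleftrightarrow> (\<forall>x\<in>{0..1}. f x = 0)"
proof
  assume "ae_zero_I f" then show "\<forall>x\<in>{0..1}. f x = 0" using continuous_ae_zero[OF assms] by blast
qed (simp add: ae_zero_I_def)

context sturm_liouville
begin

text \<open>For the direct implication the test function is the primitive of \<open>G\<close> minus its mean, where \<open>G\<close> is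
  \<open>P y'\<close> plus a primitive of \<open>K\<close> (du Bois-Reymond).\<close>

lemma weak_iff:
  fixes y K :: "real \<Rightarrow> complex"
  assumes K: "sqint K" and y: "y \<in> H1" and L: "(0,0) \<in> L"
  shows "(\<forall>\<eta>\<in>H1. (\<eta> 0, \<eta> 1) \<in> L \<longrightarrow>
      integral {0..1} (\<lambda>x. P x * (wderiv y x * cnj (wderiv \<eta> x))) = integral {0..1} (\<lambda>x. K x * cnj (\<eta> x))) \<longleftrightarrow>
    (\<exists>s::real \<Rightarrow> complex. prim (\<lambda>x. - K x) s \<and> prim (\<lambda>x. s x / complex_of_real (P x)) y \<and> (\<forall>e\<in>L. s 1 * cnj (snd e) = s 0 * cnj (fst e)))"
    (is "?weak \<longleftrightarrow> ?ode")
proof -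
  have green: "integral {0..1} (\<lambda>x. P x * (wderiv y x * cnj (wderiv \<eta> x))) =
      s 1 * cnj (\<eta> 1) - s 0 * cnj (\<eta> 0) + integral {0..1} (\<lambda>x. K x * cnj (\<eta> x))"
    if s: "prim (\<lambda>x. - K x) s" "prim (\<lambda>x. s x / complex_of_real (P x)) y" and \<eta>: "\<eta> \<in> H1" for s \<eta> :: "real \<Rightarrow> complex"
  proof -
    have "AE x in lebesgue. x \<in> {0..1} \<longrightarrow> P x * (wderiv y x * cnj (wderiv \<eta> x)) = s x * cnj (wderiv \<eta> x)"
      using prim_unique[OF wderiv(2)[OF y] s(2)] by eventually_elim (use P_nz in auto)
    then have "integral {0..1} (\<lambda>x. P x * (wderiv y x * cnj (wderiv \<eta> x))) = integral {0..1} (\<lambda>x. s x * cnj (wderiv \<eta> x))"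
      by (rule integral_cong_ae01) auto
    also have "\<dots> = s 1 * cnj (\<eta> 1) - s 0 * cnj (\<eta> 0) - integral {0..1} (\<lambda>x. - K x * cnj (\<eta> x))"
      by (rule prim_parts[OF s(1) prim_cnj[OF wderiv(2)[OF \<eta>]]])
    finally show ?thesis by simp
  qed
  show ?thesis
  proof
    assume ?ode
    then obtain s where s: "prim (\<lambda>x. - K x) s" "prim (\<lambda>x. s x / complex_of_real (P x)) y" "\<forall>e\<in>L. s 1 * cnj (snd e) = s 0 * cnj (fst e)" by blast
    show ?weak
    proof (intro ballI impI)
      fix \<eta> assume \<eta>: "\<eta> \<in> H1" "(\<eta> 0, \<eta> 1) \<in> L"
      have "s 1 * cnj (\<eta> 1) = s 0 * cnj (\<eta> 0)" using bspec[OF s(3) \<eta>(2)] by simp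
      then show "integral {0..1} (\<lambda>x. P x * (wderiv y x * cnj (wderiv \<eta> x))) = integral {0..1} (\<lambda>x. K x * cnj (\<eta> x))"
        using green[OF s(1,2) \<eta>(1)] by simp
    qed
  next
    assume weak: ?weak
    define k where "k x = 0 + integral {0..x} K" for x
    have pk: "prim K k" unfolding k_def by (rule prim_integral[OF sqint_ai[OF K]])
    define G where "G x = P x * wderiv y x + k x" for x
    have sG: "sqint G" unfolding G_def
      by (intro sqint_add sqint_mult_continuous wderiv(1)[OF y] sqint_continuous prim_continuous[OF pk] continuous_intros P_cont)
    define c where "c = integral {0..1} G"
    define g where "g x = G x - c" for x
    have sg: "sqint g" unfolding g_def by (intro sqint_diff sG sqint_continuous continuous_intros)
    have Ig: "integral {0..1} g = 0"
      unfolding g_def using Henstock_Kurzweil_Integration.integral_diff[OF ai_integrable[OF sqint_ai[OF sG]], of "\<lambda>_. c"] by (simp add: c_def integrable_const_ivl)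
    define \<eta> where "\<eta> x = 0 + integral {0..x} g" for x
    have p\<eta>: "prim g \<eta>" unfolding \<eta>_def by (rule prim_integral[OF sqint_ai[OF sg]])
    have \<eta>01: "\<eta> 0 = 0" "\<eta> 1 = 0" using Ig by (auto simp: \<eta>_def)
    have \<eta>H: "\<eta> \<in> H1" by (rule H1I[OF sg p\<eta>])
    \<comment> \<open>With \<open>g = P y' + k - c\<close> in the first factor, the weak equation
      for \<eta> cancels against the integration by parts of \<open>k\<close> with
      \<open>\<eta>' = g\<close>, and the constant drops out since \<open>g\<close> has mean
      0.\<close>
    have "integral {0..1} (\<lambda>x. g x * cnj (g x)) = 0"
    proof -
      have i1: "(\<lambda>x. P x * (wderiv y x * cnj (g x))) absolutely_integrable_on {0..1}"
        by (intro ai_mult_continuous(1) sqint_prod wderiv(1)[OF y] sqint_cnj sg continuous_intros P_cont)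
      have i2: "(\<lambda>x. k x * cnj (g x)) absolutely_integrable_on {0..1}"
        by (intro sqint_prod sqint_cnj sg sqint_continuous prim_continuous[OF pk])
      have i3: "(\<lambda>x. c * cnj (g x)) absolutely_integrable_on {0..1}" by (intro ai_cmult sqint_ai sqint_cnj sg)
      have "AE x in lebesgue. x \<in> {0..1} \<longrightarrow> P x * (wderiv y x * cnj (wderiv \<eta> x)) = P x * (wderiv y x * cnj (g x))"
        using wderiv_ae[OF sg p\<eta>] by eventually_elim auto
      then have e1: "integral {0..1} (\<lambda>x. P x * (wderiv y x * cnj (g x))) = integral {0..1} (\<lambda>x. P x * (wderiv y x * cnj (wderiv \<eta> x)))"
        by (intro integral_cong_ae01[symmetric]) auto
      have e2: "\<dots> = integral {0..1} (\<lambda>x. K x * cnj (\<eta> x))" using weak \<eta>H \<eta>01 L by simp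
      have e3: "integral {0..1} (\<lambda>x. k x * cnj (g x)) = - integral {0..1} (\<lambda>x. K x * cnj (\<eta> x))"
        using prim_parts[OF pk prim_cnj[OF p\<eta>]] \<eta>01 by simp
      have e4: "integral {0..1} (\<lambda>x. c * cnj (g x)) = 0"
        using prim_eval1[OF prim_cnj[OF p\<eta>]] \<eta>01 by simp
      have "(\<lambda>x. g x * cnj (g x)) = (\<lambda>x. P x * (wderiv y x * cnj (g x)) + (k x * cnj (g x) - c * cnj (g x)))"
        by (rule ext) (simp add: g_def G_def algebra_simps)
      then have "integral {0..1} (\<lambda>x. g x * cnj (g x)) = integral {0..1} (\<lambda>x. P x * (wderiv y x * cnj (g x))) +
          (integral {0..1} (\<lambda>x. k x * cnj (g x)) - integral {0..1} (\<lambda>x. c * cnj (g x)))"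
        using Henstock_Kurzweil_Integration.integral_add[OF ai_integrable[OF i1] ai_integrable[OF ai_diff[OF i2 i3]]]
          Henstock_Kurzweil_Integration.integral_diff[OF ai_integrable[OF i2] ai_integrable[OF i3]] by simp
      then show ?thesis using e1 e2 e3 e4 by simp
    qed
    then have g0: "AE x in lebesgue. x \<in> {0..1} \<longrightarrow> g x = 0" by (rule sq_integral_zero_ae[OF sg])
    define s where "s x = c - k x" for x
    have s1: "prim (\<lambda>x. - K x) s"
      using prim_add[OF prim_const[of c] prim_cmult[OF pk, of "-1"]] by (simp add: s_def[abs_def])
    have s2: "prim (\<lambda>x. s x / complex_of_real (P x)) y"
    proof (rule prim_cong[OF wderiv(2)[OF y]])
      show "AE x in lebesgue. x \<in> {0..1} \<longrightarrow> wderiv y x = s x / complex_of_real (P x)"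
        using g0 by eventually_elim (use P_nz in \<open>auto simp: g_def G_def s_def field_simps\<close>)
    qed simp
    have s3: "s 1 * cnj (snd e) = s 0 * cnj (fst e)" if e: "e \<in> L" for e
    proof -
      \<comment> \<open>An affine test function attains any prescribed pair of boundary values;
        Green's formula then isolates the boundary terms.\<close>
      let ?\<eta> = "\<lambda>x. fst e + (snd e - fst e) * complex_of_real x"
      have "((\<lambda>x. fst e + (snd e - fst e) * complex_of_real x) has_vector_derivative 0 + (snd e - fst e) * 1) (at x within {0..1})" for x
        by (intro has_vector_derivative_add has_vector_derivative_mult_right has_vector_derivative_const has_vector_derivative_of_real has_vector_derivative_id[unfolded has_vector_derivative_def])
          (auto simp: has_vector_derivative_def scaleR_conv_of_real intro!: derivative_eq_intros)
      then have p: "prim (\<lambda>x. snd e - fst e) ?\<eta>" by (intro prim_C1) auto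
      have H: "?\<eta> \<in> H1" by (rule H1I[OF _ p]) (intro sqint_continuous continuous_intros)
      have "integral {0..1} (\<lambda>x. P x * (wderiv y x * cnj (wderiv ?\<eta> x))) = integral {0..1} (\<lambda>x. K x * cnj (?\<eta> x))"
        using weak H e by simp
      then show ?thesis using green[OF s1 s2 H] by simp
    qed
    show ?ode using s1 s2 s3 by blast
  qed
qed

text \<open>Regularity: the quasi-derivative \<open>s\<close> has only an integrable derivative, but
  \<open>y\<close> and \<open>s + F\<close> have continuous ones, because the irregular parts cancel
  in the sum.\<close>

lemma sol_iff_prim:
  fixes y s f :: "real \<Rightarrow> complex"
  assumes F: "prim f F"
  shows "prim (\<lambda>x. - (f x + (complex_of_real (q x) + \<Lambda> * complex_of_real (P x)) * y x)) s \<and> prim (\<lambda>x. s x / complex_of_real (P x)) y \<longleftrightarrow>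
     sol \<Lambda> F y (\<lambda>x. s x + F x)" (is "?p \<longleftrightarrow> ?s")
proof
  assume p: ?p
  have cy: "continuous_on {0..1} y" and cs: "continuous_on {0..1} s" using p prim_continuous by auto
  have "prim (\<lambda>x. - ((complex_of_real (q x) + \<Lambda> * complex_of_real (P x)) * y x)) (\<lambda>x. s x + F x)"
    using prim_add[OF conjunct1[OF p] F] by simp
  moreover have "continuous_on {0..1} (\<lambda>x. - ((complex_of_real (q x) + \<Lambda> * complex_of_real (P x)) * y x))"
    by (intro continuous_intros cy P_cont q_cont)
  ultimately have "((\<lambda>x. s x + F x) has_vector_derivative - ((complex_of_real (q x) + \<Lambda> * complex_of_real (P x)) * y x)) (at x within {0..1})" if "x \<in> {0..1}" for x
    using that by (rule prim_C1_derivative)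
  moreover have "(y has_vector_derivative s x / complex_of_real (P x)) (at x within {0..1})" if "x \<in> {0..1}" for x
    using conjunct2[OF p] _ that by (rule prim_C1_derivative) (use P_nz in \<open>auto intro!: continuous_intros cs P_cont\<close>)
  ultimately show ?s unfolding sol_def minus_mult_left[symmetric] by simp
next
  assume s: ?s
  have cy: "continuous_on {0..1} y" and csF: "continuous_on {0..1} (\<lambda>x. s x + F x)" using sol_continuous[OF s] by auto
  have cs: "continuous_on {0..1} s" using continuous_on_diff[OF csF prim_continuous[OF F]] by simp
  have "prim (\<lambda>x. - (complex_of_real (q x) + \<Lambda> * complex_of_real (P x)) * y x) (\<lambda>x. s x + F x)"
    by (rule prim_C1) (use s in \<open>auto simp: sol_def intro!: continuous_intros cy P_cont q_cont\<close>)
  from prim_add[OF this prim_cmult[OF F, of "-1"]]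
  have "prim (\<lambda>x. - (f x + (complex_of_real (q x) + \<Lambda> * complex_of_real (P x)) * y x)) s" by (simp add: algebra_simps)
  moreover have "prim (\<lambda>x. s x / complex_of_real (P x)) y"
    by (rule prim_C1) (use s P_nz in \<open>auto simp: sol_def intro!: continuous_intros cs P_cont\<close>)
  ultimately show ?p by blast
qed

section \<open>Zeros of solutions and orthogonality\<close>

lemma sol0_zero:
  assumes s: "sol0 \<Lambda> y s" and z: "\<And>x. x \<in> {0..1} \<Longrightarrow> y x = 0" and x: "x \<in> {0..1}" shows "s x = 0"
proof -
  have "(y has_vector_derivative s x / complex_of_real (P x)) (at x within {0..1})" using s x by (simp add: sol_def)
  moreover have "(y has_vector_derivative 0) (at x within {0..1})"
    by (rule has_vector_derivative_transform[OF x _ has_vector_derivative_const[of 0]]) (use z in auto)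
  moreover have "at x within {0..1} \<noteq> bot" using x by (simp add: trivial_limit_within islimpt_Icc)
  ultimately have "s x / complex_of_real (P x) = 0" using vector_derivative_unique_within by blast
  then show ?thesis using P_nz by simp
qed

text \<open>The Wronskians with the two fundamental solutions are constant and carry the vanishing
  data from \<open>x\<close> back to 0.\<close>

lemma sol0_zero_data:
  assumes s: "sol0 \<Lambda> y s" and x: "x \<in> {0..1}" "y x = 0" "s x = 0" shows "y 0 = 0" "s 0 = 0"
  using wronskian[OF s Y1(1) x(1)] wronskian[OF s Y2(1) x(1)] x(2,3) by (simp_all add: Y1 Y2)

text \<open>At an accumulation point of zeros \<open>y\<close> vanishes together with its
  derivative, computed along the zeros; then \<open>s\<close> vanishes there too and the solution is
  trivial.\<close>

lemma sol0_finite_zeros: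
  assumes s: "sol0 \<Lambda> y s" and nz: "\<not> (y 0 = 0 \<and> s 0 = 0)"
  shows "finite {x\<in>{0..1}. y x = 0}"
proof (rule ccontr)
  let ?Z = "{x\<in>{0..1}. y x = 0}"
  assume "infinite ?Z"
  moreover have "?Z \<subseteq> {0..1}" by auto
  ultimately obtain x where x: "x \<in> {0..1}" "x islimpt ?Z"
    using compact_Icc[of "0::real" 1] unfolding compact_eq_Bolzano_Weierstrass by metis
  have "closed ?Z"
  proof -
    have "closed ({0..1} \<inter> y -` {0})" by (rule continuous_closed_preimage[OF sol_continuous(1)[OF s]]) auto
    moreover have "{0..1} \<inter> y -` {0} = ?Z" by auto
    ultimately show ?thesis by simp
  qed
  then have xZ: "x \<in> ?Z" using x(2) closed_limpt by blast
  have "(y has_vector_derivative s x / complex_of_real (P x)) (at x within ?Z)"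
    by (rule has_vector_derivative_within_subset[of _ _ _ "{0..1}"]) (use s x in \<open>auto simp: sol_def\<close>)
  moreover have "(y has_vector_derivative 0) (at x within ?Z)"
    by (rule has_vector_derivative_transform[OF xZ _ has_vector_derivative_const[of 0]]) auto
  moreover have "at x within ?Z \<noteq> bot" using x(2) by (simp add: trivial_limit_within)
  ultimately have "s x / complex_of_real (P x) = 0" using vector_derivative_unique_within by blast
  then have "s x = 0" using P_nz by simp
  then show False using sol0_zero_data[OF s x(1)] xZ nz by simp
qed

text \<open>A solution is coded by the triple \<open>(y 0, s 0, \<Lambda>)\<close>. The weighted L2
  product becomes a continuous function on a finite-dimensional space, in which limits of
  eigenfunctions can be taken.\<close>

definition weighted_ip :: "complex \<times> complex \<times> complex \<Rightarrow> complex \<times> complex \<times> complex \<Rightarrow> complex" where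
  "weighted_ip d e = integral {0..1} (\<lambda>x. P x * ((fst d * Y1 (snd (snd d)) x + fst (snd d) * Y2 (snd (snd d)) x) *
     cnj (fst e * Y1 (snd (snd e)) x + fst (snd e) * Y2 (snd (snd e)) x)))"

lemma weighted_ip_continuous: "continuous_on UNIV (\<lambda>p. weighted_ip (fst p) (snd p))"
proof -
  have "continuous_on UNIV (\<lambda>p. integral (cbox 0 1) (\<lambda>x. P x * ((fst (fst p) * Y1 (snd (snd (fst p))) x + fst (snd (fst p)) * Y2 (snd (snd (fst p))) x) *
     cnj (fst (snd p) * Y1 (snd (snd (snd p))) x + fst (snd (snd p)) * Y2 (snd (snd (snd p))) x))))"
  proof (rule integral_continuous_on_param, unfold split_beta)
    have "continuous_on (UNIV \<times> {0..1}) (\<lambda>p. P (snd p))"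
      by (rule continuous_on_compose2[OF P_cont continuous_on_snd[OF continuous_on_id]]) auto
    then show "continuous_on (UNIV \<times> cbox 0 1) (\<lambda>pa. P (snd pa) *
         ((fst (fst (fst pa)) * Y1 (snd (snd (fst (fst pa)))) (snd pa) + fst (snd (fst (fst pa))) * Y2 (snd (snd (fst (fst pa)))) (snd pa)) *
          cnj (fst (snd (fst pa)) * Y1 (snd (snd (snd (fst pa)))) (snd pa) + fst (snd (snd (fst pa))) * Y2 (snd (snd (snd (fst pa)))) (snd pa))))"
      by (intro continuous_intros) auto
  qed
  then show ?thesis unfolding weighted_ip_def by simp
qed

lemma weighted_ip_eq:
  assumes "sol0 \<Lambda> y s" "sol0 M z t"
  shows "weighted_ip (y 0, s 0, \<Lambda>) (z 0, t 0, M) = integral {0..1} (\<lambda>x. P x * (y x * cnj (z x)))"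
  unfolding weighted_ip_def
  by (rule Henstock_Kurzweil_Integration.integral_cong) (simp add: sol0_repr(1)[OF assms(1), symmetric] sol0_repr(1)[OF assms(2), symmetric])

text \<open>The potential terms cancel in the derivative of \<open>s cnj z - y cnj t\<close>. When
  the boundary terms cancel as well, this gives orthogonality for
  \<open>cnj M \<noteq> \<Lambda>\<close> and, with both solutions equal, reality of the
  parameter.\<close>

lemma lagrange_identity:
  assumes y: "sol0 \<Lambda> y s" and z: "sol0 M z t"
  shows "(cnj M - \<Lambda>) * weighted_ip (y 0, s 0, \<Lambda>) (z 0, t 0, M) = (s 1 * cnj (z 1) - y 1 * cnj (t 1)) - (s 0 * cnj (z 0) - y 0 * cnj (t 0))"
proof -
  have "((\<lambda>x. s x * cnj (z x) - y x * cnj (t x)) has_vector_derivative (cnj M - \<Lambda>) * (P x * (y x * cnj (z x)))) (at x within {0..1})" if x: "x \<in> {0..1}" for x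
  proof -
    note d1 = y[unfolded sol_def, rule_format, OF x, THEN conjunct1] y[unfolded sol_def, rule_format, OF x, THEN conjunct2]
    note d2 = sol0_cnj[OF z, unfolded sol_def, rule_format, OF x, THEN conjunct1] sol0_cnj[OF z, unfolded sol_def, rule_format, OF x, THEN conjunct2]
    show ?thesis
      by (rule has_vector_derivative_eq_rhs[OF has_vector_derivative_diff[OF has_vector_derivative_mult[OF d1(2) d2(1)] has_vector_derivative_mult[OF d1(1) d2(2)]]])
        (simp add: algebra_simps)
  qed
  then have "((\<lambda>x. (cnj M - \<Lambda>) * (P x * (y x * cnj (z x)))) has_integral ((s 1 * cnj (z 1) - y 1 * cnj (t 1)) - (s 0 * cnj (z 0) - y 0 * cnj (t 0)))) {0..1}"
    by (intro fundamental_theorem_of_calculus) auto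
  from integral_unique[OF this] show ?thesis unfolding weighted_ip_eq[OF y z] by simp
qed

lemma weighted_ip_pos:
  assumes y: "sol0 \<Lambda> y s" and z: "weighted_ip (y 0, s 0, \<Lambda>) (y 0, s 0, \<Lambda>) = 0"
  shows "y 0 = 0" "s 0 = 0"
proof -
  have c: "continuous_on {0..1} y" by (rule sol_continuous[OF y])
  have i: "(\<lambda>x. P x * (cmod (y x))\<^sup>2) integrable_on {0..1}" by (intro integrable_continuous_real continuous_intros P_cont c)
  have "integral {0..1} (\<lambda>x. P x * (y x * cnj (y x))) = integral {0..1} (\<lambda>x. complex_of_real (P x * (cmod (y x))\<^sup>2))"
    by (simp only: complex_norm_square of_real_mult)
  also have "\<dots> = complex_of_real (integral {0..1} (\<lambda>x. P x * (cmod (y x))\<^sup>2))"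
    using integral_linear[OF i bounded_linear_of_real[where 'a=complex]] by (simp add: o_def)
  finally have "integral {0..1} (\<lambda>x. P x * (cmod (y x))\<^sup>2) = 0" using z weighted_ip_eq[OF y y] by simp
  moreover have "continuous_on {0..1} (\<lambda>x. P x * (cmod (y x))\<^sup>2)" by (intro continuous_intros P_cont c)
  ultimately have "\<And>x. x \<in> {0..1} \<Longrightarrow> P x * (cmod (y x))\<^sup>2 = 0"
    using integral_eq_0_iff[of 0 1 "\<lambda>x. P x * (cmod (y x))\<^sup>2"] P_pos by (simp add: less_imp_le)
  then have "\<And>x. x \<in> {0..1} \<Longrightarrow> y x = 0" using P_nz by simp
  then show "y 0 = 0" "s 0 = 0" using sol0_zero[OF y] by auto
qed

end

text \<open>The interface between the two halves of the proof: from here on \<open>v\<close> is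
  known only through the transformed form. The normalisation \<open>h 0 = 0\<close> leaves boundary
  values at 0 unchanged; those at 1 are multiplied by \<open>exp (h 1)\<close> in passing to
  \<open>y\<close>.\<close>

locale singular_schroedinger =
  fixes v :: "(real \<Rightarrow> complex) \<Rightarrow> complex" and h q :: "real \<Rightarrow> real" and \<gamma> :: real
  assumes h0: "h 0 = 0" and h_cont: "continuous_on {0..1} h" and qc: "continuous_on {0..1} q" and qn: "\<And>x. q x \<ge> 0"
    and H1_exp: "\<And>c y. y \<in> H1 \<Longrightarrow> (\<lambda>x. complex_of_real (exp (c * h x)) * y x) \<in> H1"
    and form_eq: "\<And>g y k \<eta>. sqint g \<Longrightarrow> prim g y \<Longrightarrow> sqint k \<Longrightarrow> prim k \<eta> \<Longrightarrow>
       form_a v (\<lambda>x. complex_of_real (exp (- 1 * h x)) * y x) (\<lambda>x. complex_of_real (exp (- 1 * h x)) * \<eta> x) =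
       integral {0..1} (\<lambda>x. exp (-2 * h x) * (g x * cnj (k x)) + (\<gamma> * exp (-2 * h x) - q x) * (y x * cnj (\<eta> x)))"
begin

definition weight :: "real \<Rightarrow> real" where "weight x = exp (-2 * h x)"

sublocale sturm_liouville weight q
  by unfold_locales (auto simp: weight_def intro!: continuous_intros h_cont qc qn)

definition up :: "(real \<Rightarrow> complex) \<Rightarrow> real \<Rightarrow> complex" where
  "up \<psi> = (\<lambda>x. complex_of_real (exp (1 * h x)) * \<psi> x)"

definition down :: "(real \<Rightarrow> complex) \<Rightarrow> real \<Rightarrow> complex" where
  "down y = (\<lambda>x. complex_of_real (exp (- 1 * h x)) * y x)"

lemma up_down [simp]: "up (down y) = y" "down (up \<psi>) = \<psi>"
  by (auto simp: up_def down_def mult.assoc[symmetric] exp_minus simp flip: of_real_mult)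

lemma up_H1: "\<psi> \<in> H1 \<Longrightarrow> up \<psi> \<in> H1" and down_H1: "y \<in> H1 \<Longrightarrow> down y \<in> H1"
  unfolding up_def down_def by (rule H1_exp; assumption)+

lemma up_0 [simp]: "up \<psi> 0 = \<psi> 0" "down y 0 = y 0"
  by (simp_all add: up_def down_def h0)

text \<open>The second clause is the natural boundary condition in terms of the quasi-derivative.\<close>

definition bc :: "(complex \<times> complex) set \<Rightarrow> complex \<Rightarrow> complex \<Rightarrow> complex \<Rightarrow> complex \<Rightarrow> bool" where
  "bc L y0 s0 y1 s1 \<longleftrightarrow> (y0, complex_of_real (exp (- 1 * h 1)) * y1) \<in> L \<and>
     (\<forall>e\<in>L. s1 * cnj (complex_of_real (exp (1 * h 1)) * snd e) = s0 * cnj (fst e))"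

text \<open>The term \<open>\<gamma> P - q\<close> of the form changes sides and joins \<mu>, which
  turns the spectral parameter into \<open>\<mu> - \<gamma>\<close>. The source becomes
  \<open>down f\<close>, since the test function contributes one factor
  \<open>exp (- h)\<close>.\<close>

lemma down_form:
  fixes \<mu> :: complex
  assumes y: "y \<in> H1" and \<eta>: "\<eta> \<in> H1" and f: "sqint f"
  shows "form_a v (down y) (down \<eta>) = l2inner (\<lambda>x. f x + \<mu> * down y x) (down \<eta>) \<longleftrightarrow>
    integral {0..1} (\<lambda>x. weight x * (wderiv y x * cnj (wderiv \<eta> x))) =
    integral {0..1} (\<lambda>x. (down f x + (complex_of_real (q x) + (\<mu> - complex_of_real \<gamma>) * complex_of_real (weight x)) * y x) * cnj (\<eta> x))"
proof -
  note cy = H1_continuous[OF y] and c\<eta> = H1_continuous[OF \<eta>]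
  have sdy: "sqint (down y)" "sqint (down \<eta>)" using H1_continuous down_H1 y \<eta> sqint_continuous by blast+
  have sdf: "sqint (down f)" unfolding down_def by (intro sqint_mult_continuous f continuous_intros h_cont)
  have c\<eta>': "continuous_on {0..1} (\<lambda>x. cnj (\<eta> x))" by (intro continuous_intros c\<eta>)
  have a1: "(\<lambda>x. weight x * (wderiv y x * cnj (wderiv \<eta> x))) absolutely_integrable_on {0..1}"
    by (intro ai_mult_continuous(1) sqint_prod sqint_cnj wderiv y \<eta> continuous_intros P_cont)
  have a2: "(\<lambda>x. (complex_of_real \<gamma> * complex_of_real (weight x) - complex_of_real (q x)) * (y x * cnj (\<eta> x))) absolutely_integrable_on {0..1}"
    by (intro sqint_ai sqint_continuous continuous_intros cy c\<eta> P_cont qc)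
  have a3: "(\<lambda>x. (down f x + (complex_of_real (q x) + (\<mu> - complex_of_real \<gamma>) * complex_of_real (weight x)) * y x) * cnj (\<eta> x)) absolutely_integrable_on {0..1}"
    by (intro sqint_prod sqint_add sdf sqint_continuous continuous_intros cy c\<eta> P_cont qc)
  have l: "l2inner (\<lambda>x. f x + \<mu> * down y x) (down \<eta>) = integral {0..1} (\<lambda>x. (f x + \<mu> * down y x) * cnj (down \<eta> x))"
    by (rule l2inner_eq) (intro sqint_add sqint_cmult f sdy)+
  have "(\<lambda>x. (f x + \<mu> * down y x) * cnj (down \<eta> x)) = (\<lambda>x. (down f x + (complex_of_real (q x) + (\<mu> - complex_of_real \<gamma>) * complex_of_real (weight x)) * y x) * cnj (\<eta> x)
     + (complex_of_real \<gamma> * complex_of_real (weight x) - complex_of_real (q x)) * (y x * cnj (\<eta> x)))"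
  proof
    fix x
    have PP: "complex_of_real (weight x) = complex_of_real (exp (- 1 * h x)) * complex_of_real (exp (- 1 * h x))"
      by (simp add: weight_def exp_add[symmetric] flip: of_real_mult)
    show "(f x + \<mu> * down y x) * cnj (down \<eta> x) = (down f x + (complex_of_real (q x) + (\<mu> - complex_of_real \<gamma>) * complex_of_real (weight x)) * y x) * cnj (\<eta> x)
     + (complex_of_real \<gamma> * complex_of_real (weight x) - complex_of_real (q x)) * (y x * cnj (\<eta> x))"
      unfolding down_def PP by (simp add: algebra_simps)
  qed
  then have l': "l2inner (\<lambda>x. f x + \<mu> * down y x) (down \<eta>) =
     integral {0..1} (\<lambda>x. (down f x + (complex_of_real (q x) + (\<mu> - complex_of_real \<gamma>) * complex_of_real (weight x)) * y x) * cnj (\<eta> x)) +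
     integral {0..1} (\<lambda>x. (complex_of_real \<gamma> * complex_of_real (weight x) - complex_of_real (q x)) * (y x * cnj (\<eta> x)))"
    unfolding l using Henstock_Kurzweil_Integration.integral_add[OF ai_integrable[OF a3] ai_integrable[OF a2]] by simp
  have "form_a v (down y) (down \<eta>) = integral {0..1} (\<lambda>x. weight x * (wderiv y x * cnj (wderiv \<eta> x))) +
     integral {0..1} (\<lambda>x. (complex_of_real \<gamma> * complex_of_real (weight x) - complex_of_real (q x)) * (y x * cnj (\<eta> x)))"
    unfolding down_def form_eq[OF wderiv[OF y] wderiv[OF \<eta>], folded weight_def]
    using Henstock_Kurzweil_Integration.integral_add[OF ai_integrable[OF a1] ai_integrable[OF a2]] by simp
  then show ?thesis using l' by simp
qed

text \<open>The equation \<open>h \<psi> - \<mu> \<psi> = f\<close> as a first-order system. It is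
  used with \<open>f = 0\<close> for the kernels and with general \<open>f\<close> for the
  resolvent. The set \<open>?L\<close> is the boundary space in terms of the transformed
  functions.\<close>

lemma hL_iff:
  fixes \<mu> :: complex
  assumes f: "sqint f" and L0: "(0,0) \<in> L"
  shows "hL_graph L v \<psi> (\<lambda>x. f x + \<mu> * \<psi> x) \<longleftrightarrow>
    (\<exists>s. prim (\<lambda>x. - (down f x + (complex_of_real (q x) + (\<mu> - complex_of_real \<gamma>) * complex_of_real (weight x)) * up \<psi> x)) s \<and>
      prim (\<lambda>x. s x / complex_of_real (weight x)) (up \<psi>) \<and> bc L (up \<psi> 0) (s 0) (up \<psi> 1) (s 1))" (is "?l \<longleftrightarrow> (\<exists>s. ?p1 s \<and> ?p2 s \<and> ?b s)")
proof -
  let ?K = "\<lambda>x. down f x + (complex_of_real (q x) + (\<mu> - complex_of_real \<gamma>) * complex_of_real (weight x)) * up \<psi> x"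
  let ?L = "(\<lambda>e. (fst e, complex_of_real (exp (1 * h 1)) * snd e)) ` L"
  have L0': "(0,0) \<in> ?L" using L0 by force
  have sdf: "sqint (down f)" unfolding down_def by (intro sqint_mult_continuous f continuous_intros h_cont)
  have core: "?l \<longleftrightarrow> (\<psi> 0, \<psi> 1) \<in> L \<and> (\<forall>\<eta>\<in>H1. (\<eta> 0, \<eta> 1) \<in> ?L \<longrightarrow>
      integral {0..1} (\<lambda>x. weight x * (wderiv (up \<psi>) x * cnj (wderiv \<eta> x))) = integral {0..1} (\<lambda>x. ?K x * cnj (\<eta> x)))" (is "_ \<longleftrightarrow> ?w")
    if \<psi>: "\<psi> \<in> H1"
  proof -
    have s\<psi>: "sqint \<psi>" by (rule sqint_continuous[OF H1_continuous[OF \<psi>]])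
    have L2: "L2I (\<lambda>x. f x + \<mu> * \<psi> x)" unfolding L2I_iff by (intro sqint_add sqint_cmult f s\<psi>)
    have mem: "(down \<eta> 0, down \<eta> 1) \<in> L \<longleftrightarrow> (\<eta> 0, \<eta> 1) \<in> ?L" for \<eta>
    proof
      assume "(down \<eta> 0, down \<eta> 1) \<in> L"
      then show "(\<eta> 0, \<eta> 1) \<in> ?L"
        by (intro image_eqI[of _ _ "(down \<eta> 0, down \<eta> 1)"]) (simp_all add: down_def h0 exp_minus)
    next
      assume "(\<eta> 0, \<eta> 1) \<in> ?L"
      then obtain e where e: "e \<in> L" "\<eta> 0 = fst e" "\<eta> 1 = complex_of_real (exp (1 * h 1)) * snd e" by auto
      then have "(down \<eta> 0, down \<eta> 1) = e" by (simp add: down_def h0 exp_minus prod_eq_iff)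
      then show "(down \<eta> 0, down \<eta> 1) \<in> L" using e by simp
    qed
    have "?l \<longleftrightarrow> (\<psi> 0, \<psi> 1) \<in> L \<and> (\<forall>\<phi>\<in>H1_L L. form_a v \<psi> \<phi> = l2inner (\<lambda>x. f x + \<mu> * \<psi> x) \<phi>)"
      using L2 \<psi> by (simp add: hL_graph_def H1_L_def)
    also have "(\<forall>\<phi>\<in>H1_L L. form_a v \<psi> \<phi> = l2inner (\<lambda>x. f x + \<mu> * \<psi> x) \<phi>) \<longleftrightarrow>
       (\<forall>\<eta>\<in>H1. (\<eta> 0, \<eta> 1) \<in> ?L \<longrightarrow> form_a v \<psi> (down \<eta>) = l2inner (\<lambda>x. f x + \<mu> * \<psi> x) (down \<eta>))" (is "?a \<longleftrightarrow> ?b")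
    proof
      assume a: ?a
      show ?b
      proof (intro ballI impI)
        fix \<eta> assume "\<eta> \<in> H1" "(\<eta> 0, \<eta> 1) \<in> ?L"
        then have "down \<eta> \<in> H1_L L" using down_H1 mem[of \<eta>] by (simp add: H1_L_def)
        then show "form_a v \<psi> (down \<eta>) = l2inner (\<lambda>x. f x + \<mu> * \<psi> x) (down \<eta>)" using a by blast
      qed
    next
      assume b: ?b
      show ?a
      proof
        fix \<phi> assume "\<phi> \<in> H1_L L"
        then have H: "up \<phi> \<in> H1" and "(down (up \<phi>) 0, down (up \<phi>) 1) \<in> L" by (auto simp: H1_L_def up_H1)
        then have "(up \<phi> 0, up \<phi> 1) \<in> ?L" using mem[of "up \<phi>"] by blast
        then have "form_a v \<psi> (down (up \<phi>)) = l2inner (\<lambda>x. f x + \<mu> * \<psi> x) (down (up \<phi>))" using b H by blast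
        then show "form_a v \<psi> \<phi> = l2inner (\<lambda>x. f x + \<mu> * \<psi> x) \<phi>" by simp
      qed
    qed
    also have "(\<psi> 0, \<psi> 1) \<in> L \<and> ?b \<longleftrightarrow> ?w"
      using down_form[OF up_H1[OF \<psi>] _ f, of _ \<mu>] by simp
    finally show ?thesis .
  qed
  have bcL: "?b s \<longleftrightarrow> (\<psi> 0, \<psi> 1) \<in> L \<and> (\<forall>e\<in>?L. s 1 * cnj (snd e) = s 0 * cnj (fst e))" for s
  proof -
    have "complex_of_real (exp (- 1 * h 1)) * up \<psi> 1 = \<psi> 1"
      using fun_cong[OF up_down(2), of \<psi> 1] unfolding down_def .
    then show ?thesis unfolding bc_def by simp
  qed
  show ?thesis
  proof
    assume l: ?l
    then have \<psi>: "\<psi> \<in> H1" by (simp add: hL_graph_def H1_L_def)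
    have sK: "sqint ?K"
      by (intro sqint_add sdf sqint_continuous continuous_intros H1_continuous[OF up_H1[OF \<psi>]] P_cont qc)
    show "\<exists>s. ?p1 s \<and> ?p2 s \<and> ?b s"
      using core[OF \<psi>] l weak_iff[OF sK up_H1[OF \<psi>] L0'] bcL by blast
  next
    assume "\<exists>s. ?p1 s \<and> ?p2 s \<and> ?b s"
    then obtain s where s: "?p1 s" "?p2 s" "?b s" by blast
    \<comment> \<open>In this direction membership of \<open>\<psi>\<close> in H1 has to be
      recovered; it follows because \<open>up \<psi>\<close> has the continuous weak derivative
      \<open>s / weight\<close>.\<close>
    have cs: "continuous_on {0..1} (\<lambda>x. s x / complex_of_real (weight x))"
      by (intro continuous_intros prim_continuous[OF s(1)] P_cont) (use P_nz in auto)
    have uH: "up \<psi> \<in> H1" by (rule H1I[OF sqint_continuous[OF cs] s(2)])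
    then have \<psi>: "\<psi> \<in> H1" using down_H1[OF uH] by simp
    have sK: "sqint ?K"
      by (intro sqint_add sdf sqint_continuous continuous_intros H1_continuous[OF up_H1[OF \<psi>]] P_cont qc)
    show ?l
      using core[OF \<psi>] s weak_iff[OF sK uH L0'] bcL by blast
  qed
qed

lemma hL_kernel:
  fixes \<mu> :: complex
  assumes L0: "(0,0) \<in> L"
  shows "hL_graph L v \<psi> (\<lambda>x. \<mu> * \<psi> x) \<longleftrightarrow> (\<exists>s. sol0 (\<mu> - complex_of_real \<gamma>) (up \<psi>) s \<and> bc L (up \<psi> 0) (s 0) (up \<psi> 1) (s 1))"
proof -
  have z: "sqint (\<lambda>x::real. 0::complex)" by (rule sqint_continuous) simp
  have d0: "down (\<lambda>x. 0) = (\<lambda>x. 0)" by (simp add: down_def)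
  have e: "sol0 (\<mu> - complex_of_real \<gamma>) (up \<psi>) (\<lambda>x. s x + 0) \<longleftrightarrow> sol0 (\<mu> - complex_of_real \<gamma>) (up \<psi>) s" for s by simp
  have "hL_graph L v \<psi> (\<lambda>x. 0 + \<mu> * \<psi> x) \<longleftrightarrow> (\<exists>s. sol0 (\<mu> - complex_of_real \<gamma>) (up \<psi>) s \<and> bc L (up \<psi> 0) (s 0) (up \<psi> 1) (s 1))"
    using hL_iff[OF z L0, of \<psi> \<mu>] sol_iff_prim[OF prim_const[of 0], of "\<mu> - complex_of_real \<gamma>" "up \<psi>"] unfolding d0 e by blast
  then show ?thesis by simp
qed

text \<open>The boundary space is spanned by \<open>(\<alpha>, 1)\<close>, so the natural condition
  is tested on this vector alone. As \<alpha> is real, the essential and the natural condition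
  contain the same factor \<open>\<alpha> exp (- h 1)\<close>, once at \<open>y1\<close> and once at
  \<open>s0\<close>.\<close>

lemma bc_robin:
  assumes "\<alpha> \<noteq> 0"
  shows "bc (robin_L \<alpha>) y0 s0 y1 s1 \<longleftrightarrow> y0 = complex_of_real (\<alpha> * exp (- h 1)) * y1 \<and> s1 = complex_of_real (\<alpha> * exp (- h 1)) * s0"
proof -
  have e: "complex_of_real (exp (h 1)) * complex_of_real (exp (- h 1)) = 1" by (simp add: exp_minus)
  have "(\<forall>e\<in>robin_L \<alpha>. s1 * cnj (complex_of_real (exp (1 * h 1)) * snd e) = s0 * cnj (fst e)) \<longleftrightarrow>
     s1 * complex_of_real (exp (h 1)) = s0 * complex_of_real \<alpha>" (is "?l \<longleftrightarrow> ?r")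
  proof
    assume l: ?l
    have "(complex_of_real \<alpha>, 1) \<in> robin_L \<alpha>" by (simp add: robin_L_def)
    from bspec[OF l this] show ?r by simp
  next
    assume r: ?r
    show ?l
    proof
      fix e assume "e \<in> robin_L \<alpha>"
      then have "fst e = complex_of_real \<alpha> * snd e" by (simp add: robin_L_def)
      then show "s1 * cnj (complex_of_real (exp (1 * h 1)) * snd e) = s0 * cnj (fst e)"
        using arg_cong[OF r, of "\<lambda>t. t * cnj (snd e)"] by (simp add: mult.assoc)
    qed
  qed
  also have "\<dots> \<longleftrightarrow> s1 = complex_of_real (\<alpha> * exp (- h 1)) * s0"
    by (auto simp: exp_minus field_simps)
  finally show ?thesis unfolding bc_def by (auto simp: robin_L_def)
qed

lemma bc_separated:
  "bc ({0} \<times> UNIV) y0 s0 y1 s1 \<longleftrightarrow> y0 = 0 \<and> s1 = 0"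
  "bc (UNIV \<times> {0}) y0 s0 y1 s1 \<longleftrightarrow> y1 = 0 \<and> s0 = 0"
  "bc {(0,0)} y0 s0 y1 s1 \<longleftrightarrow> y0 = 0 \<and> y1 = 0"
  "bc UNIV y0 s0 y1 s1 \<longleftrightarrow> s0 = 0 \<and> s1 = 0"
proof -
  show "bc ({0} \<times> UNIV) y0 s0 y1 s1 \<longleftrightarrow> y0 = 0 \<and> s1 = 0"
    unfolding bc_def by (auto dest: spec[of _ 1])
  show "bc (UNIV \<times> {0}) y0 s0 y1 s1 \<longleftrightarrow> y1 = 0 \<and> s0 = 0"
    unfolding bc_def by (auto dest: spec[of _ 1])
  show "bc {(0,0)} y0 s0 y1 s1 \<longleftrightarrow> y0 = 0 \<and> y1 = 0"
    unfolding bc_def by auto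
  show "bc UNIV y0 s0 y1 s1 \<longleftrightarrow> s0 = 0 \<and> s1 = 0"
  proof
    assume "bc UNIV y0 s0 y1 s1"
    then have "\<And>e. s1 * cnj (complex_of_real (exp (1 * h 1)) * snd e) = s0 * cnj (fst e)" by (simp add: bc_def)
    from this[of "(1,0)"] this[of "(0,1)"] show "s0 = 0 \<and> s1 = 0" by simp
  qed (simp add: bc_def)
qed

end

subsection \<open>Spectrum under self-adjoint boundary conditions\<close>

text \<open>If the determinant were 0, then \<open>(m12, - m11)\<close> and
  \<open>(m22, - m21)\<close> would lie in the trivial kernel, the matrix would be 0, and
  \<open>(1, 0)\<close> would lie in the kernel. Otherwise Cramer's rule gives the solution.\<close>

lemma linear_system_2x2:
  fixes m11 m12 m21 m22 :: "'a::field"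
  assumes "\<And>p r. m11 * p + m12 * r = 0 \<Longrightarrow> m21 * p + m22 * r = 0 \<Longrightarrow> p = 0 \<and> r = 0"
  shows "\<exists>p r. m11 * p + m12 * r + R1 = 0 \<and> m21 * p + m22 * r + R2 = 0"
proof -
  define D where "D = m11 * m22 - m12 * m21"
  have D: "D \<noteq> 0"
  proof
    assume D0: "D = 0"
    have 1: "m12 = 0 \<and> - m11 = 0" by (rule assms) (use D0 in \<open>simp_all add: D_def algebra_simps\<close>)
    have 2: "m22 = 0 \<and> - m21 = 0" by (rule assms) (use D0 in \<open>simp_all add: D_def algebra_simps\<close>)
    have "(1::'a) = 0 \<and> (0::'a) = 0" by (rule assms) (use 1 2 in simp_all)
    then show False by simp
  qed
  have "m11 * ((m12 * R2 - m22 * R1) / D) + m12 * ((m21 * R1 - m11 * R2) / D) + R1 = 0"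
    "m21 * ((m12 * R2 - m22 * R1) / D) + m22 * ((m21 * R1 - m11 * R2) / D) + R2 = 0"
    using D by (simp_all add: divide_simps) (simp_all add: D_def algebra_simps)
  then show ?thesis by blast
qed

context singular_schroedinger
begin

text \<open>One set of boundary values supplies the natural condition, the other the element of
  \<open>L\<close> on which it is tested; the exponentials at 1 cancel. This is the symmetry of the
  operator at the level of boundary values.\<close>

lemma bc_symmetric:
  assumes "bc L y0 s0 y1 s1" "bc L z0 t0 z1 t1"
  shows "s1 * cnj z1 = s0 * cnj z0"
proof -
  have "(z0, complex_of_real (exp (- 1 * h 1)) * z1) \<in> L" using assms(2) by (simp add: bc_def)
  then have "s1 * cnj (complex_of_real (exp (1 * h 1)) * snd (z0, complex_of_real (exp (- 1 * h 1)) * z1)) = s0 * cnj (fst (z0, complex_of_real (exp (- 1 * h 1)) * z1))"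
    using assms(1) unfolding bc_def by blast
  then have "s1 * (complex_of_real (exp (h 1)) * complex_of_real (exp (- h 1)) * cnj z1) = s0 * cnj z0" by (simp add: mult.assoc)
  moreover have "complex_of_real (exp (h 1)) * complex_of_real (exp (- h 1)) = 1" by (simp add: exp_minus)
  ultimately show ?thesis by simp
qed

end

text \<open>The coupled condition and the four separated ones all amount to two linear equations for
  the four boundary values. With abstract coefficients the spectral theory is developed once for all
  of them; symmetry comes from the shape of \<open>bc\<close>.\<close>

locale self_adjoint_bc = singular_schroedinger +
  fixes L :: "(complex \<times> complex) set" and a1 a2 a3 a4 b1 b2 b3 b4 :: complex
  assumes L0: "(0,0) \<in> L"
    and bc_forms: "\<And>y0 s0 y1 s1. bc L y0 s0 y1 s1 \<longleftrightarrow>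
      a1 * y0 + a2 * s0 + a3 * y1 + a4 * s1 = 0 \<and> b1 * y0 + b2 * s0 + b3 * y1 + b4 * s1 = 0"
begin

text \<open>The pair \<open>(p, r)\<close> stands for the initial values \<open>(y 0, s 0)\<close>.
  The admissible pairs form a subspace of \<open>C^2\<close> isomorphic to the kernel of the
  operator minus \<mu>, for \<open>\<Lambda> = \<mu> - \<gamma>\<close>.\<close>

definition in_kernel :: "complex \<Rightarrow> complex \<Rightarrow> complex \<Rightarrow> bool" where
  "in_kernel \<Lambda> p r \<longleftrightarrow> bc L p r (p * Y1 \<Lambda> 1 + r * Y2 \<Lambda> 1) (p * S1 \<Lambda> 1 + r * S2 \<Lambda> 1)"

abbreviation "sh \<mu> \<equiv> \<mu> - complex_of_real \<gamma>"

lemma hL_kerD: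
  assumes "hL_graph L v \<psi> (\<lambda>x. \<mu> * \<psi> x)"
  obtains s where "sol0 (sh \<mu>) (up \<psi>) s" "in_kernel (sh \<mu>) (\<psi> 0) (s 0)"
proof -
  obtain s where s: "sol0 (sh \<mu>) (up \<psi>) s" "bc L (up \<psi> 0) (s 0) (up \<psi> 1) (s 1)"
    using assms unfolding hL_kernel[OF L0] by blast
  have "up \<psi> 1 = up \<psi> 0 * Y1 (sh \<mu>) 1 + s 0 * Y2 (sh \<mu>) 1" "s 1 = up \<psi> 0 * S1 (sh \<mu>) 1 + s 0 * S2 (sh \<mu>) 1"
    using sol0_repr[OF s(1), of 1] by auto
  then have "in_kernel (sh \<mu>) (\<psi> 0) (s 0)" using s(2) by (simp add: in_kernel_def)
  then show ?thesis using that s(1) by blast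
qed

lemma hL_kerI:
  assumes "in_kernel (sh \<mu>) p r"
  shows "hL_graph L v (down (\<lambda>x. p * Y1 (sh \<mu>) x + r * Y2 (sh \<mu>) x)) (\<lambda>x. \<mu> * down (\<lambda>x. p * Y1 (sh \<mu>) x + r * Y2 (sh \<mu>) x) x)"
  unfolding hL_kernel[OF L0] up_down
  by (rule exI[of _ "\<lambda>x. p * S1 (sh \<mu>) x + r * S2 (sh \<mu>) x"])
    (use assms sol0_fund[of "sh \<mu>" p r] in \<open>simp add: in_kernel_def Y1 Y2\<close>)

lemma up_zero_iff: "(\<forall>x\<in>{0..1}. \<psi> x = 0) \<longleftrightarrow> (\<forall>x\<in>{0..1}. up \<psi> x = 0)"
  by (simp add: up_def)

lemma sol0_zero_iff:
  assumes "sol0 \<Lambda> y s" shows "(\<forall>x\<in>{0..1}. y x = 0) \<longleftrightarrow> y 0 = 0 \<and> s 0 = 0"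
proof
  assume "\<forall>x\<in>{0..1}. y x = 0"
  then show "y 0 = 0 \<and> s 0 = 0" using sol0_zero[OF assms, of 0] by simp
next
  assume z: "y 0 = 0 \<and> s 0 = 0"
  show "\<forall>x\<in>{0..1}. y x = 0"
  proof
    fix x :: real assume "x \<in> {0..1}"
    from sol0_repr(1)[OF assms this] z show "y x = 0" by simp
  qed
qed

lemma ae_zero_up:
  assumes "sol0 \<Lambda> (up \<psi>) s" shows "ae_zero_I \<psi> \<longleftrightarrow> \<psi> 0 = 0 \<and> s 0 = 0"
proof -
  have "continuous_on {0..1} (\<lambda>x. complex_of_real (exp (- 1 * h x)) * up \<psi> x)"
    by (intro continuous_intros h_cont sol_continuous(1)[OF assms])
  then have "continuous_on {0..1} (down (up \<psi>))" by (simp only: down_def)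
  then have "continuous_on {0..1} \<psi>" by simp
  from ae_zero_I_iff[OF this] show ?thesis using up_zero_iff[of \<psi>] sol0_zero_iff[OF assms] by simp
qed

lemma eigenvalue_iff: "is_eigenvalue L v \<mu> \<longleftrightarrow> (\<exists>p r. in_kernel (sh \<mu>) p r \<and> \<not> (p = 0 \<and> r = 0))"
proof
  assume "is_eigenvalue L v \<mu>"
  then obtain \<psi> where \<psi>: "hL_graph L v \<psi> (\<lambda>x. \<mu> * \<psi> x)" "\<not> ae_zero_I \<psi>" unfolding is_eigenvalue_def is_eigenfunction_def by blast
  obtain s where "sol0 (sh \<mu>) (up \<psi>) s" "in_kernel (sh \<mu>) (\<psi> 0) (s 0)" by (rule hL_kerD[OF \<psi>(1)])
  then show "\<exists>p r. in_kernel (sh \<mu>) p r \<and> \<not> (p = 0 \<and> r = 0)" using ae_zero_up \<psi>(2) by blast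
next
  assume "\<exists>p r. in_kernel (sh \<mu>) p r \<and> \<not> (p = 0 \<and> r = 0)"
  then obtain p r where pr: "in_kernel (sh \<mu>) p r" "\<not> (p = 0 \<and> r = 0)" by blast
  let ?\<psi> = "down (\<lambda>x. p * Y1 (sh \<mu>) x + r * Y2 (sh \<mu>) x)"
  have s: "sol0 (sh \<mu>) (up ?\<psi>) (\<lambda>x. p * S1 (sh \<mu>) x + r * S2 (sh \<mu>) x)" using sol0_fund by simp
  have "\<not> ae_zero_I ?\<psi>" using ae_zero_up[OF s] pr(2) by (simp add: Y1 Y2)
  then show "is_eigenvalue L v \<mu>" unfolding is_eigenvalue_def is_eigenfunction_def using hL_kerI[OF pr(1)] by blast
qed

text \<open>Passing from initial values to solutions is linear and injective, and so is the
  multiplication by \<open>exp (- h)\<close>; independence of functions modulo null sets can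
  therefore be tested on initial values.\<close>

lemma eigdim_iff:
  "eigdim_ge L v \<mu> n \<longleftrightarrow> (\<exists>a b :: nat \<Rightarrow> complex. (\<forall>i<n. in_kernel (sh \<mu>) (a i) (b i)) \<and>
     (\<forall>c :: nat \<Rightarrow> complex. (\<Sum>i<n. c i * a i) = 0 \<and> (\<Sum>i<n. c i * b i) = 0 \<longrightarrow> (\<forall>i<n. c i = 0)))" (is "?l \<longleftrightarrow> ?r")
proof -
  let ?Y = "\<lambda>p r x. p * Y1 (sh \<mu>) x + r * Y2 (sh \<mu>) x"
  let ?S = "\<lambda>p r x. p * S1 (sh \<mu>) x + r * S2 (sh \<mu>) x"
  have key: "ae_zero_I (\<lambda>x. \<Sum>i<n. c i * \<psi>s i x) \<longleftrightarrow> (\<Sum>i<n. c i * a i) = 0 \<and> (\<Sum>i<n. c i * b i) = 0"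
    if "\<And>i x. i < n \<Longrightarrow> x \<in> {0..1} \<Longrightarrow> up (\<psi>s i) x = ?Y (a i) (b i) x" for \<psi>s and a b c :: "nat \<Rightarrow> complex"
  proof -
    let ?A = "\<Sum>i<n. c i * a i" and ?B = "\<Sum>i<n. c i * b i"
    have e: "down (?Y ?A ?B) x = (\<Sum>i<n. c i * \<psi>s i x)" if x: "x \<in> {0..1}" for x
    proof -
      have "?Y ?A ?B x = (\<Sum>i<n. c i * up (\<psi>s i) x)"
        using that \<open>\<And>i x. i < n \<Longrightarrow> x \<in> {0..1} \<Longrightarrow> up (\<psi>s i) x = ?Y (a i) (b i) x\<close>
        by (simp add: sum_distrib_right sum.distrib algebra_simps)
      also have "\<dots> = complex_of_real (exp (1 * h x)) * (\<Sum>i<n. c i * \<psi>s i x)"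
        by (simp add: up_def sum_distrib_left algebra_simps)
      finally show ?thesis by (simp add: down_def exp_minus)
    qed
    have "ae_zero_I (\<lambda>x. \<Sum>i<n. c i * \<psi>s i x) \<longleftrightarrow> ae_zero_I (down (?Y ?A ?B))"
    proof -
      have "(AE x in lebesgue. x \<in> {0<..<1} \<longrightarrow> (\<Sum>i<n. c i * \<psi>s i x) = 0) \<longleftrightarrow> (AE x in lebesgue. x \<in> {0<..<1} \<longrightarrow> down (?Y ?A ?B) x = 0)"
        by (rule AE_cong) (use e in auto)
      then show ?thesis by (simp add: ae_zero_I_def)
    qed
    also have "\<dots> \<longleftrightarrow> ?A = 0 \<and> ?B = 0"
      using ae_zero_up[of "sh \<mu>" "down (?Y ?A ?B)" "?S ?A ?B"] sol0_fund[of "sh \<mu>" ?A ?B] by (simp add: Y1 Y2)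
    finally show ?thesis .
  qed
  show ?thesis
  proof
    assume ?l
    then obtain \<psi>s where \<psi>s: "\<And>i. i < n \<Longrightarrow> hL_graph L v (\<psi>s i) (\<lambda>x. \<mu> * \<psi>s i x)"
      and ind: "\<And>c :: nat \<Rightarrow> complex. ae_zero_I (\<lambda>x. \<Sum>i<n. c i * \<psi>s i x) \<Longrightarrow> (\<forall>i<n. c i = 0)" unfolding eigdim_ge_def by blast
    have "\<exists>s. i < n \<longrightarrow> sol0 (sh \<mu>) (up (\<psi>s i)) s \<and> in_kernel (sh \<mu>) (\<psi>s i 0) (s 0)" for i
      using hL_kerD[OF \<psi>s] by metis
    then obtain s where s: "\<And>i. i < n \<Longrightarrow> sol0 (sh \<mu>) (up (\<psi>s i)) (s i)" "\<And>i. i < n \<Longrightarrow> in_kernel (sh \<mu>) (\<psi>s i 0) (s i 0)" by metis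
    have "up (\<psi>s i) x = ?Y (\<psi>s i 0) (s i 0) x" if "i < n" "x \<in> {0..1}" for i x
      using sol0_repr(1)[OF s(1)[OF that(1)] that(2)] by simp
    note k = key[where \<psi>s = \<psi>s and a = "\<lambda>i. \<psi>s i 0" and b = "\<lambda>i. s i 0", OF this]
    show ?r
    proof (rule exI[of _ "\<lambda>i. \<psi>s i 0"], rule exI[of _ "\<lambda>i. s i 0"], intro conjI allI impI)
      fix c :: "nat \<Rightarrow> complex" and j :: nat assume "(\<Sum>i<n. c i * \<psi>s i 0) = 0 \<and> (\<Sum>i<n. c i * s i 0) = 0" "j < n"
      then show "c j = 0" using ind[of c] k[where c=c] by blast
    qed (use s in auto)
  next
    assume ?r
    then obtain a b :: "nat \<Rightarrow> complex" where ab: "\<forall>i<n. in_kernel (sh \<mu>) (a i) (b i)"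
      "\<And>c. (\<Sum>i<n. c i * a i) = 0 \<Longrightarrow> (\<Sum>i<n. c i * b i) = 0 \<Longrightarrow> (\<forall>i<n. c i = 0)" by blast
    let ?\<psi>s = "\<lambda>i. down (?Y (a i) (b i))"
    have "up (?\<psi>s i) x = ?Y (a i) (b i) x" for i x by simp
    note k = key[where \<psi>s = ?\<psi>s and a = a and b = b, OF this]
    show ?l unfolding eigdim_ge_def
    proof (rule exI[of _ ?\<psi>s], intro conjI allI impI)
      fix i assume "i < n" then show "hL_graph L v (?\<psi>s i) (\<lambda>x. \<mu> * ?\<psi>s i x)" using hL_kerI ab(1) by blast
    next
      fix c :: "nat \<Rightarrow> complex" and i assume "ae_zero_I (\<lambda>x. \<Sum>i<n. c i * ?\<psi>s i x)" "i < n"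
      then show "c i = 0" using ab(2)[of c] k[where c=c] by blast
    qed
  qed
qed

lemma in_kernel_linear:
  "in_kernel \<Lambda> p r \<longleftrightarrow> (a1 + a3 * Y1 \<Lambda> 1 + a4 * S1 \<Lambda> 1) * p + (a2 + a3 * Y2 \<Lambda> 1 + a4 * S2 \<Lambda> 1) * r = 0 \<and>
    (b1 + b3 * Y1 \<Lambda> 1 + b4 * S1 \<Lambda> 1) * p + (b2 + b3 * Y2 \<Lambda> 1 + b4 * S2 \<Lambda> 1) * r = 0"
  unfolding in_kernel_def bc_forms by (simp add: algebra_simps)

lemma in_kernel_orthogonal:
  assumes "in_kernel \<Lambda> p r" "in_kernel M p' r'" shows "(cnj M - \<Lambda>) * weighted_ip (p, r, \<Lambda>) (p', r', M) = 0"
proof -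
  let ?y = "\<lambda>x. p * Y1 \<Lambda> x + r * Y2 \<Lambda> x" and ?s = "\<lambda>x. p * S1 \<Lambda> x + r * S2 \<Lambda> x"
  let ?z = "\<lambda>x. p' * Y1 M x + r' * Y2 M x" and ?t = "\<lambda>x. p' * S1 M x + r' * S2 M x"
  have 1: "?s 1 * cnj (?z 1) = r * cnj p'" and 2: "?t 1 * cnj (?y 1) = r' * cnj p"
    using bc_symmetric assms unfolding in_kernel_def by blast+
  have 3: "?y 1 * cnj (?t 1) = p * cnj r'"
    using arg_cong[OF 2, of cnj] by (simp only: complex_cnj_mult complex_cnj_cnj mult.commute)
  have "?y 0 = p" "?s 0 = r" "?z 0 = p'" "?t 0 = r'" by (simp_all add: Y1 Y2)
  then show ?thesis using lagrange_identity[OF sol0_fund[of \<Lambda> p r] sol0_fund[of M p' r']] 1 3 by simp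
qed

lemma weighted_ip_pos':
  assumes "weighted_ip (p, r, \<Lambda>) (p, r, \<Lambda>) = 0" shows "p = 0 \<and> r = 0"
proof -
  have 1: "p * Y1 \<Lambda> 0 + r * Y2 \<Lambda> 0 = p" "p * S1 \<Lambda> 0 + r * S2 \<Lambda> 0 = r" by (simp_all add: Y1 Y2)
  show ?thesis using weighted_ip_pos[OF sol0_fund[of \<Lambda> p r]] assms unfolding 1 by blast
qed

lemma in_kernel_real:
  assumes "in_kernel \<Lambda> p r" "\<not> (p = 0 \<and> r = 0)" shows "\<Lambda> \<in> \<real>"
  using in_kernel_orthogonal[OF assms(1,1)] weighted_ip_pos'[of p r \<Lambda>] assms(2) by (auto simp: Reals_cnj_iff)

lemma eigenvalue_real:
  assumes "is_eigenvalue L v \<mu>" shows "\<mu> \<in> \<real>"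
proof -
  obtain p r where "in_kernel (sh \<mu>) p r" "\<not> (p = 0 \<and> r = 0)" using assms unfolding eigenvalue_iff by blast
  then have "sh \<mu> \<in> \<real>" by (rule in_kernel_real)
  then have "sh \<mu> + complex_of_real \<gamma> \<in> \<real>" by (intro Reals_add Reals_of_real)
  then show ?thesis by simp
qed

lemma in_kernel_scale:
  assumes "in_kernel \<Lambda> p r" shows "in_kernel \<Lambda> (c * p) (c * r)"
proof -
  have "m * (c * p) + n * (c * r) = c * (m * p + n * r)" for m n by (simp add: algebra_simps)
  then show ?thesis using assms unfolding in_kernel_linear by simp
qed

lemma eigenvalues_no_limit: "\<not> \<mu> islimpt {\<mu>. is_eigenvalue L v \<mu>}"
proof
  assume "\<mu> islimpt {\<mu>. is_eigenvalue L v \<mu>}"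
  then obtain f where f: "\<And>n. is_eigenvalue L v (f n)" "\<And>n. f n \<noteq> \<mu>" "f \<longlonglongrightarrow> \<mu>"
    unfolding islimpt_sequential by auto
  have "\<exists>p r. in_kernel (sh (f n)) p r \<and> (p, r) \<in> sphere 0 1" for n
  proof -
    obtain p r where pr: "in_kernel (sh (f n)) p r" "\<not> (p = 0 \<and> r = 0)" using f(1)[of n] unfolding eigenvalue_iff by blast
    define c where "c = complex_of_real (1 / norm (p, r))"
    have nz: "norm (p, r) \<noteq> 0" using pr(2) by (auto simp: prod_eq_iff)
    have "(c * p, c * r) = (1 / norm (p, r)) *\<^sub>R (p, r)" by (simp add: c_def scaleR_conv_of_real)
    then have "norm (c * p, c * r) = 1" using nz by (simp only: norm_scaleR) simp
    then show ?thesis using in_kernel_scale[OF pr(1), of c] by auto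
  qed
  then obtain p r where pr: "\<And>n. in_kernel (sh (f n)) (p n) (r n)" "\<And>n. (p n, r n) \<in> sphere 0 1" by metis
  have "compact (sphere (0 :: complex \<times> complex) 1)" by simp
  then obtain l \<rho> where l: "l \<in> sphere 0 1" "strict_mono \<rho>" "((\<lambda>n. (p n, r n)) \<circ> \<rho>) \<longlonglongrightarrow> l"
    using pr(2) unfolding compact_def by (metis (no_types, lifting))
  define d where "d n = (p (\<rho> n), r (\<rho> n), sh (f (\<rho> n)))" for n
  define d0 where "d0 = (fst l, snd l, sh \<mu>)"
  have fl: "(\<lambda>n. f (\<rho> n)) \<longlonglongrightarrow> \<mu>" using LIMSEQ_subseq_LIMSEQ[OF f(3) l(2)] by (simp add: o_def)
  have dlim: "d \<longlonglongrightarrow> d0"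
    unfolding d_def d0_def using tendsto_fst[OF l(3)] tendsto_snd[OF l(3)] by (intro tendsto_Pair tendsto_diff fl tendsto_const) (simp_all add: o_def)
  have wl: "(\<lambda>n. weighted_ip (e n) (e' n)) \<longlonglongrightarrow> weighted_ip e0 e0'" if "e \<longlonglongrightarrow> e0" "e' \<longlonglongrightarrow> e0'" for e e' e0 e0'
    using continuous_on_tendsto_compose[OF weighted_ip_continuous tendsto_Pair[OF that]] by simp
  \<comment> \<open>An iterated limit: for fixed \<open>n\<close>, almost all eigenvalues of the
    sequence differ from \<open>f (\<rho> n)\<close>, so their triples are orthogonal to
    \<open>d n\<close>. Letting the second index and then the first tend to infinity makes
    \<open>d0\<close> orthogonal to itself, although its initial values have norm 1.\<close>
  have z1: "weighted_ip (d n) d0 = 0" for n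
  proof -
    have "\<forall>\<^sub>F m in sequentially. f (\<rho> m) \<noteq> f (\<rho> n)"
      by (rule tendsto_imp_eventually_ne[OF fl f(2)[symmetric]])
    then have "\<forall>\<^sub>F m in sequentially. weighted_ip (d n) (d m) = 0"
    proof eventually_elim
      case (elim m)
      have "sh (f (\<rho> m)) \<in> \<real>" using eigenvalue_real[OF f(1)] by simp
      then have "cnj (sh (f (\<rho> m))) - sh (f (\<rho> n)) \<noteq> 0" using elim by (simp add: Reals_cnj_iff)
      then show ?case using in_kernel_orthogonal[OF pr(1)[of "\<rho> n"] pr(1)[of "\<rho> m"]] by (simp add: d_def)
    qed
    then have "(\<lambda>m. weighted_ip (d n) (d m)) \<longlonglongrightarrow> 0" by (rule tendsto_eventually)
    moreover have "(\<lambda>m. weighted_ip (d n) (d m)) \<longlonglongrightarrow> weighted_ip (d n) d0" by (rule wl[OF tendsto_const dlim])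
    ultimately show ?thesis by (rule LIMSEQ_unique[symmetric])
  qed
  have "(\<lambda>n. weighted_ip (d n) d0) \<longlonglongrightarrow> weighted_ip d0 d0" by (rule wl[OF dlim tendsto_const])
  then have "weighted_ip d0 d0 = 0" unfolding z1 by (simp add: LIMSEQ_const_iff)
  then have "fst l = 0 \<and> snd l = 0" unfolding d0_def by (rule weighted_ip_pos')
  then have "l = 0" by (simp add: prod_eq_iff)
  then show False using l(1) by simp
qed

lemma nonvanishing: "eigenfunctions_ae_nonvanishing L v"
  unfolding eigenfunctions_ae_nonvanishing_def
proof (intro allI impI)
  fix \<mu> \<psi> assume "is_eigenfunction L v \<mu> \<psi>"
  then have \<psi>: "hL_graph L v \<psi> (\<lambda>x. \<mu> * \<psi> x)" "\<not> ae_zero_I \<psi>" by (auto simp: is_eigenfunction_def)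
  obtain s where s: "sol0 (sh \<mu>) (up \<psi>) s" by (rule hL_kerD[OF \<psi>(1)])
  have "finite {x\<in>{0..1}. up \<psi> x = 0}"
    by (rule sol0_finite_zeros[OF s]) (use ae_zero_up[OF s] \<psi>(2) in simp)
  then have "negligible {x\<in>{0..1}. up \<psi> x = 0}" by (rule negligible_finite)
  then have "AE x in lebesgue. x \<notin> {x\<in>{0..1}. up \<psi> x = 0}"
    unfolding negligible_iff_null_sets by (rule AE_not_in)
  then show "AE x in lebesgue. x \<in> {0<..<1} \<longrightarrow> \<psi> x \<noteq> 0"
    by eventually_elim (auto simp: up_def)
qed

section \<open>The resolvent equation and the spectrum\<close>

lemma hL_diff:
  assumes f: "sqint f" and 1: "hL_graph L v \<psi>1 (\<lambda>x. f x + \<mu> * \<psi>1 x)" and 2: "hL_graph L v \<psi>2 (\<lambda>x. f x + \<mu> * \<psi>2 x)"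
  shows "hL_graph L v (\<lambda>x. \<psi>1 x - \<psi>2 x) (\<lambda>x. \<mu> * (\<psi>1 x - \<psi>2 x))"
proof -
  let ?q = "\<lambda>x. complex_of_real (q x) + (\<mu> - complex_of_real \<gamma>) * complex_of_real (weight x)"
  obtain s1 where s1: "prim (\<lambda>x. - (down f x + ?q x * up \<psi>1 x)) s1" "prim (\<lambda>x. s1 x / complex_of_real (weight x)) (up \<psi>1)" "bc L (up \<psi>1 0) (s1 0) (up \<psi>1 1) (s1 1)"
    using 1 unfolding hL_iff[OF f L0] by blast
  obtain s2 where s2: "prim (\<lambda>x. - (down f x + ?q x * up \<psi>2 x)) s2" "prim (\<lambda>x. s2 x / complex_of_real (weight x)) (up \<psi>2)" "bc L (up \<psi>2 0) (s2 0) (up \<psi>2 1) (s2 1)"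
    using 2 unfolding hL_iff[OF f L0] by blast
  have u: "up (\<lambda>x. \<psi>1 x - \<psi>2 x) = (\<lambda>x. up \<psi>1 x + (-1) * up \<psi>2 x)" by (simp add: up_def algebra_simps fun_eq_iff)
  have "prim (\<lambda>x. - (0 + ?q x * up (\<lambda>x. \<psi>1 x - \<psi>2 x) x)) (\<lambda>x. s1 x + (-1) * s2 x)"
  proof (rule prim_cong[OF prim_add[OF s1(1) prim_cmult[OF s2(1), of "-1"]]])
    show "AE x in lebesgue. x \<in> {0..1} \<longrightarrow> - (down f x + ?q x * up \<psi>1 x) + (-1) * - (down f x + ?q x * up \<psi>2 x) = - (0 + ?q x * up (\<lambda>x. \<psi>1 x - \<psi>2 x) x)"
      by (intro AE_I2) (simp add: u algebra_simps)
  qed simp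
  moreover have "prim (\<lambda>x. (s1 x + (-1) * s2 x) / complex_of_real (weight x)) (up (\<lambda>x. \<psi>1 x - \<psi>2 x))"
    using prim_add[OF s1(2) prim_cmult[OF s2(2), of "-1"]] unfolding u by (simp add: add_divide_distrib diff_divide_distrib)
  moreover have "sol0 (sh \<mu>) (up (\<lambda>x. \<psi>1 x - \<psi>2 x)) (\<lambda>x. s1 x + (-1) * s2 x)"
    using sol_iff_prim[OF prim_const[of 0], of "sh \<mu>" "up (\<lambda>x. \<psi>1 x - \<psi>2 x)" "\<lambda>x. s1 x + (-1) * s2 x"] calculation by simp
  moreover have "bc L (up \<psi>1 0 + (-1) * up \<psi>2 0) (s1 0 + (-1) * s2 0) (up \<psi>1 1 + (-1) * up \<psi>2 1) (s1 1 + (-1) * s2 1)"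
  proof -
    have lin: "c1 * (w + (-1) * w') + c2 * (x + (-1) * x') + c3 * (y + (-1) * y') + c4 * (z + (-1) * z') =
      (c1 * w + c2 * x + c3 * y + c4 * z) - (c1 * w' + c2 * x' + c3 * y' + c4 * z')" for c1 c2 c3 c4 w w' x x' y y' z z' :: complex
      by (simp add: algebra_simps)
    show ?thesis using s1(3) s2(3) unfolding bc_forms lin by simp
  qed
  ultimately show ?thesis unfolding hL_kernel[OF L0] u by blast
qed

text \<open>A Fredholm alternative: if the kernel is trivial, a particular solution is corrected by
  a homogeneous one whose coefficients solve the inhomogeneous version of the two kernel equations.
  If it is not, uniqueness already fails for \<open>f = 0\<close>.\<close>

lemma spectrum_iff: "spectrum_h L v = {\<mu>. is_eigenvalue L v \<mu>}"
proof (intro set_eqI iffI; unfold mem_Collect_eq)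
  fix \<mu> assume "is_eigenvalue L v \<mu>"
  then obtain \<psi> where \<psi>: "hL_graph L v \<psi> (\<lambda>x. \<mu> * \<psi> x)" "\<not> ae_zero_I \<psi>" unfolding is_eigenvalue_def is_eigenfunction_def by blast
  have "sqint (\<lambda>x::real. 0::complex)" by (rule sqint_continuous) simp
  then have L2: "L2I (\<lambda>x. 0)" by (simp add: L2I_iff)
  have z: "hL_graph L v (\<lambda>x. 0) (\<lambda>x. 0 + \<mu> * 0)"
  proof -
    have "in_kernel (sh \<mu>) 0 0" by (simp add: in_kernel_linear)
    from hL_kerI[OF this] show ?thesis by (simp add: down_def)
  qed
  show "\<mu> \<in> spectrum_h L v"
  proof (rule ccontr)
    assume "\<mu> \<notin> spectrum_h L v"
    then have *: "\<And>f \<psi>1 \<psi>2. L2I f \<Longrightarrow> hL_graph L v \<psi>1 (\<lambda>x. f x + \<mu> * \<psi>1 x) \<Longrightarrow> hL_graph L v \<psi>2 (\<lambda>x. f x + \<mu> * \<psi>2 x) \<Longrightarrow> ae_zero_I (\<lambda>x. \<psi>1 x - \<psi>2 x)"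
      unfolding spectrum_h_def by blast
    have "ae_zero_I (\<lambda>x. \<psi> x - 0)" by (rule *[OF L2 _ z]) (use \<psi> in simp)
    then show False using \<psi>(2) by simp
  qed
next
  fix \<mu> assume "\<mu> \<in> spectrum_h L v"
  show "is_eigenvalue L v \<mu>"
  proof (rule ccontr)
    assume ne: "\<not> is_eigenvalue L v \<mu>"
    have ex: "\<exists>\<psi>. hL_graph L v \<psi> (\<lambda>x. f x + \<mu> * \<psi> x)" if f: "sqint f" for f
    proof -
      let ?\<Lambda> = "sh \<mu>"
      let ?m11 = "a1 + a3 * Y1 ?\<Lambda> 1 + a4 * S1 ?\<Lambda> 1" and ?m12 = "a2 + a3 * Y2 ?\<Lambda> 1 + a4 * S2 ?\<Lambda> 1"
      let ?m21 = "b1 + b3 * Y1 ?\<Lambda> 1 + b4 * S1 ?\<Lambda> 1" and ?m22 = "b2 + b3 * Y2 ?\<Lambda> 1 + b4 * S2 ?\<Lambda> 1"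
      have nk: "\<And>p r. ?m11 * p + ?m12 * r = 0 \<Longrightarrow> ?m21 * p + ?m22 * r = 0 \<Longrightarrow> p = 0 \<and> r = 0"
        using ne unfolding eigenvalue_iff in_kernel_linear by blast
      have sdf: "sqint (down f)" unfolding down_def by (intro sqint_mult_continuous f continuous_intros h_cont)
      define F where "F x = 0 + integral {0..x} (down f)" for x
      have pF: "prim (down f) F" unfolding F_def by (rule prim_integral[OF sqint_ai[OF sdf]])
      obtain y \<sigma> where y: "sol ?\<Lambda> F y \<sigma>" "y 0 = 0" "\<sigma> 0 = 0" using sol_exists[OF prim_continuous[OF pF], of ?\<Lambda> 0 0] by blast
      \<comment> \<open>\<open>R1\<close> and \<open>R2\<close> are the boundary defects of the
        particular solution. Its data at 0 vanish, and its quasi-derivative at 1 is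
        \<open>\<sigma> 1 - F 1\<close>.\<close>
      define R1 where "R1 = a3 * y 1 + a4 * (\<sigma> 1 - F 1)"
      define R2 where "R2 = b3 * y 1 + b4 * (\<sigma> 1 - F 1)"
      obtain p r where e1: "?m11 * p + ?m12 * r + R1 = 0" and e2: "?m21 * p + ?m22 * r + R2 = 0"
        using linear_system_2x2[of ?m11 ?m12 ?m21 ?m22 R1 R2] nk by blast
      define z where "z x = 1 * y x + 1 * (p * Y1 ?\<Lambda> x + r * Y2 ?\<Lambda> x)" for x
      define s where "s x = 1 * \<sigma> x + 1 * (p * S1 ?\<Lambda> x + r * S2 ?\<Lambda> x) - F x" for x
      have sol: "sol ?\<Lambda> F z (\<lambda>x. s x + F x)"
        using sol_lincomb[OF y(1) sol0_fund[of ?\<Lambda> p r], of 1 1] by (simp add: z_def[abs_def] s_def)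
      have F0: "F 0 = 0" by (simp add: F_def)
      have z01: "z 0 = p" "s 0 = r" by (simp_all add: z_def s_def y Y1 Y2 F0)
      have "bc L (z 0) (s 0) (z 1) (s 1)"
        unfolding bc_forms z01 using e1 e2 by (simp add: z_def s_def R1_def R2_def algebra_simps)
      moreover have "prim (\<lambda>x. - (down f x + (complex_of_real (q x) + sh \<mu> * complex_of_real (weight x)) * z x)) s \<and> prim (\<lambda>x. s x / complex_of_real (weight x)) z"
        using sol_iff_prim[OF pF, of "sh \<mu>" z s] sol by blast
      ultimately have "hL_graph L v (down z) (\<lambda>x. f x + \<mu> * down z x)"
        unfolding hL_iff[OF f L0] up_down by blast
      then show ?thesis by blast
    qed
    have un: "ae_zero_I (\<lambda>x. \<psi>1 x - \<psi>2 x)" if "sqint f" "hL_graph L v \<psi>1 (\<lambda>x. f x + \<mu> * \<psi>1 x)" "hL_graph L v \<psi>2 (\<lambda>x. f x + \<mu> * \<psi>2 x)" for f \<psi>1 \<psi>2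
      using hL_diff[OF that] ne unfolding is_eigenvalue_def is_eigenfunction_def by blast
    have "\<mu> \<notin> spectrum_h L v" unfolding spectrum_h_def L2I_iff using ex un by blast
    then show False using \<open>\<mu> \<in> spectrum_h L v\<close> by blast
  qed
qed

section \<open>Dimensions of the kernels\<close>

lemma eigdim_0: "eigdim_ge L v \<mu> 0"
  by (simp add: eigdim_iff)

lemma eigdim_mono: "eigdim_ge L v \<mu> (Suc n) \<Longrightarrow> eigdim_ge L v \<mu> n"
  unfolding eigdim_iff
proof (elim exE conjE)
  fix a b :: "nat \<Rightarrow> complex" assume k: "\<forall>i<Suc n. in_kernel (sh \<mu>) (a i) (b i)"
    and i: "\<forall>c. (\<Sum>i<Suc n. c i * a i) = 0 \<and> (\<Sum>i<Suc n. c i * b i) = 0 \<longrightarrow> (\<forall>i<Suc n. c i = 0)"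
  show "\<exists>a b. (\<forall>i<n. in_kernel (sh \<mu>) (a i) (b i)) \<and> (\<forall>c. (\<Sum>i<n. c i * a i) = 0 \<and> (\<Sum>i<n. c i * b i) = 0 \<longrightarrow> (\<forall>i<n. c i = 0))"
  proof (rule exI[of _ a], rule exI[of _ b], intro conjI allI impI)
    fix c :: "nat \<Rightarrow> complex" and j :: nat assume c: "(\<Sum>i<n. c i * a i) = 0 \<and> (\<Sum>i<n. c i * b i) = 0" and j: "j < n"
    have "(\<Sum>i<Suc n. (c(n := 0)) i * a i) = 0 \<and> (\<Sum>i<Suc n. (c(n := 0)) i * b i) = 0" using c by simp
    then have "(c(n := 0)) j = 0" using i j less_SucI by blast
    then show "c j = 0" using j by simp
  qed (use k in auto)
qed

lemma eigdim_1_iff: "eigdim_ge L v \<mu> 1 \<longleftrightarrow> is_eigenvalue L v \<mu>"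
proof
  assume "eigdim_ge L v \<mu> 1"
  then obtain a b :: "nat \<Rightarrow> complex" where k: "\<forall>i<1. in_kernel (sh \<mu>) (a i) (b i)"
    and i: "\<forall>c::nat \<Rightarrow> complex. (\<Sum>i<1. c i * a i) = 0 \<and> (\<Sum>i<1. c i * b i) = 0 \<longrightarrow> (\<forall>i<1. c i = 0)" unfolding eigdim_iff by blast
  have "\<not> (a 0 = 0 \<and> b 0 = 0)" using spec[OF i, of "\<lambda>_. 1"] by auto
  moreover have "in_kernel (sh \<mu>) (a 0) (b 0)" using k by simp
  ultimately show "is_eigenvalue L v \<mu>" unfolding eigenvalue_iff by blast
next
  assume "is_eigenvalue L v \<mu>"
  then obtain p r where "in_kernel (sh \<mu>) p r" "\<not> (p = 0 \<and> r = 0)" unfolding eigenvalue_iff by blast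
  then show "eigdim_ge L v \<mu> 1" unfolding eigdim_iff
    by (intro exI[of _ "\<lambda>_. p"] exI[of _ "\<lambda>_. r"]) auto
qed

lemma eigdim_2D:
  assumes "eigdim_ge L v \<mu> 2"
  obtains p r p' r' where "in_kernel (sh \<mu>) p r" "in_kernel (sh \<mu>) p' r'" "p * r' - p' * r \<noteq> 0"
proof -
  obtain a b :: "nat \<Rightarrow> complex" where k: "\<And>i. i < 2 \<Longrightarrow> in_kernel (sh \<mu>) (a i) (b i)"
    and i: "\<And>c::nat \<Rightarrow> complex. (\<Sum>i<2. c i * a i) = 0 \<Longrightarrow> (\<Sum>i<2. c i * b i) = 0 \<Longrightarrow> (\<forall>i<2. c i = 0)" using assms unfolding eigdim_iff by blast
  have i': "c = 0 \<and> d = 0" if "c * a 0 + d * a 1 = 0" "c * b 0 + d * b 1 = 0" for c d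
  proof -
    have "\<forall>i<2. (if i = (0::nat) then c else d) = 0" by (rule i) (use that in \<open>simp_all add: lessThan_nat_numeral numeral_2_eq_2\<close>)
    from this[rule_format, of 0] this[rule_format, of 1] show ?thesis by simp
  qed
  have "a 0 * b 1 - a 1 * b 0 \<noteq> 0"
  proof
    assume d: "a 0 * b 1 - a 1 * b 0 = 0"
    have 1: "b 1 = 0 \<and> b 0 = 0" using i'[of "b 1" "- b 0"] d by (simp add: algebra_simps)
    have 2: "a 1 = 0 \<and> a 0 = 0" using i'[of "a 1" "- a 0"] d by (simp add: algebra_simps)
    show False using i'[of 1 0] 1 2 by simp
  qed
  then show ?thesis using that k[of 0] k[of 1] by simp
qed

lemma eigdim_2I:
  assumes "in_kernel (sh \<mu>) 1 0" "in_kernel (sh \<mu>) 0 1" shows "eigdim_ge L v \<mu> 2"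
  unfolding eigdim_iff
  by (rule exI[of _ "\<lambda>i. if i = 0 then 1 else 0"], rule exI[of _ "\<lambda>i. if i = 0 then 0 else 1"])
    (use assms in \<open>auto simp: lessThan_nat_numeral numeral_2_eq_2 less_Suc_eq\<close>)

lemma eigdim_3: "\<not> eigdim_ge L v \<mu> 3"
proof
  assume "eigdim_ge L v \<mu> 3"
  then obtain a b :: "nat \<Rightarrow> complex"
    where i: "\<And>c::nat \<Rightarrow> complex. (\<Sum>i<3. c i * a i) = 0 \<Longrightarrow> (\<Sum>i<3. c i * b i) = 0 \<Longrightarrow> (\<forall>i<3. c i = 0)" unfolding eigdim_iff by blast
  have i': "c = 0 \<and> d = 0 \<and> e = 0" if "c * a 0 + d * a 1 + e * a 2 = 0" "c * b 0 + d * b 1 + e * b 2 = 0" for c d e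
  proof -
    have "\<forall>i<3. (if i = (0::nat) then c else if i = 1 then d else e) = 0"
      by (rule i) (use that in \<open>simp_all add: numeral_3_eq_3 numeral_2_eq_2\<close>)
    from this[rule_format, of 0] this[rule_format, of 1] this[rule_format, of 2] show ?thesis by simp
  qed
  \<comment> \<open>The coefficients form the cross product of \<open>a\<close> and
    \<open>b\<close>, which always gives a linear relation among three vectors of
    \<open>C^2\<close>. Once it is 0, the first two vectors are dependent by themselves.\<close>
  have c: "a 1 * b 2 - a 2 * b 1 = 0 \<and> a 2 * b 0 - a 0 * b 2 = 0 \<and> a 0 * b 1 - a 1 * b 0 = 0"
    by (rule i') (simp_all add: algebra_simps)
  have 1: "a 1 = 0 \<and> a 0 = 0" using i'[of "a 1" "- a 0" 0] c by (simp add: algebra_simps)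
  have 2: "b 1 = 0 \<and> b 0 = 0" using i'[of "b 1" "- b 0" 0] c by (simp add: algebra_simps)
  show False using i'[of 1 0 0] 1 2 by simp
qed

lemma multiplicity_exists: "\<exists>n. multiplicity_h L v \<mu> n"
proof (rule ccontr)
  assume "\<nexists>n. multiplicity_h L v \<mu> n"
  then have "eigdim_ge L v \<mu> n \<Longrightarrow> eigdim_ge L v \<mu> (Suc n)" for n unfolding multiplicity_h_def by blast
  then have "eigdim_ge L v \<mu> n" for n by (induction n) (use eigdim_0 in auto)
  then show False using eigdim_3 by blast
qed

lemma discrete: "discrete_spectrum L v"
  unfolding discrete_spectrum_def spectrum_iff using eigenvalues_no_limit multiplicity_exists by blast

lemma simple_if_parallel:
  assumes "\<And>\<Lambda> p r p' r'. in_kernel \<Lambda> p r \<Longrightarrow> in_kernel \<Lambda> p' r' \<Longrightarrow> p * r' - p' * r = 0" "is_eigenvalue L v \<mu>"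
  shows "multiplicity_h L v \<mu> 1"
proof -
  have "\<not> eigdim_ge L v \<mu> 2"
  proof
    assume "eigdim_ge L v \<mu> 2"
    then obtain p r p' r' where "in_kernel (sh \<mu>) p r" "in_kernel (sh \<mu>) p' r'" "p * r' - p' * r \<noteq> 0" by (rule eigdim_2D)
    then show False using assms(1) by blast
  qed
  then show ?thesis using assms(2) eigdim_1_iff unfolding multiplicity_h_def by (simp add: numeral_2_eq_2)
qed

end

subsection \<open>The discriminant\<close>

context sturm_liouville
begin

section \<open>Real fundamental systems and their Gram matrices\<close>

definition "ry1 l x = Re (Y1 (complex_of_real l) x)"
definition "ry2 l x = Re (Y2 (complex_of_real l) x)"
definition "rs1 l x = Re (S1 (complex_of_real l) x)"
definition "rs2 l x = Re (S2 (complex_of_real l) x)"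

lemma fund_of_real:
  assumes "x \<in> {0..1}"
  shows "Y1 (complex_of_real l) x = complex_of_real (ry1 l x)" "Y2 (complex_of_real l) x = complex_of_real (ry2 l x)"
    "S1 (complex_of_real l) x = complex_of_real (rs1 l x)" "S2 (complex_of_real l) x = complex_of_real (rs2 l x)"
  using fund_real[OF assms, of l] by (simp_all add: ry1_def ry2_def rs1_def rs2_def)

lemma real_init: "ry1 l 0 = 1" "ry2 l 0 = 0" "rs1 l 0 = 0" "rs2 l 0 = 1"
  by (simp_all add: ry1_def ry2_def rs1_def rs2_def Y1 Y2)

lemma real_det: "x \<in> {0..1} \<Longrightarrow> ry1 l x * rs2 l x - ry2 l x * rs1 l x = 1"
  using fund_det[of x "complex_of_real l"] unfolding fund_of_real[of x l]
  by (metis of_real_1 of_real_diff of_real_eq_iff of_real_mult fund_of_real)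

definition rsol :: "real \<Rightarrow> (real \<Rightarrow> real) \<Rightarrow> (real \<Rightarrow> real) \<Rightarrow> bool" where
  "rsol l y s \<longleftrightarrow> (\<forall>x\<in>{0..1}. (y has_vector_derivative (s x / P x)) (at x within {0..1}) \<and>
     (s has_vector_derivative (- (q x + l * P x) * y x)) (at x within {0..1}))"

lemma rsol_Re:
  assumes "sol0 (complex_of_real l) y s" shows "rsol l (\<lambda>x. Re (y x)) (\<lambda>x. Re (s x))"
  unfolding rsol_def
proof (intro ballI conjI)
  fix x :: real assume x: "x \<in> {0..1}"
  note d = assms[unfolded sol_def, rule_format, OF x]
  show "((\<lambda>x. Re (y x)) has_vector_derivative Re (s x) / P x) (at x within {0..1})"
    using bounded_linear.has_vector_derivative[OF bounded_linear_Re d[THEN conjunct1]] by simp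
  show "((\<lambda>x. Re (s x)) has_vector_derivative - (q x + l * P x) * Re (y x)) (at x within {0..1})"
    using bounded_linear.has_vector_derivative[OF bounded_linear_Re d[THEN conjunct2]] by (simp add: algebra_simps)
qed

lemma rsol_fund: "rsol l (\<lambda>x. u * ry1 l x + w * ry2 l x) (\<lambda>x. u * rs1 l x + w * rs2 l x)"
  using rsol_Re[OF sol0_fund[of "complex_of_real l" "complex_of_real u" "complex_of_real w"]]
  by (simp add: ry1_def ry2_def rs1_def rs2_def)

lemma rsol1: "rsol l (ry1 l) (rs1 l)" using rsol_fund[of l 1 0] by simp
lemma rsol2: "rsol l (ry2 l) (rs2 l)" using rsol_fund[of l 0 1] by simp

lemma rsol_continuous:
  assumes "rsol l y s" shows "continuous_on {0..1} y" "continuous_on {0..1} s"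
  using assms unfolding rsol_def continuous_on_eq_continuous_within
  by (auto intro: has_vector_derivative_continuous)

lemma rfund_joint [continuous_intros]:
  fixes f :: "'t::topological_space \<Rightarrow> real" and g :: "'t \<Rightarrow> real"
  assumes "continuous_on T f" "continuous_on T g" "\<And>t. t \<in> T \<Longrightarrow> g t \<in> {0..1}"
  shows "continuous_on T (\<lambda>t. ry1 (f t) (g t))" "continuous_on T (\<lambda>t. ry2 (f t) (g t))"
    "continuous_on T (\<lambda>t. rs1 (f t) (g t))" "continuous_on T (\<lambda>t. rs2 (f t) (g t))"
  unfolding ry1_def ry2_def rs1_def rs2_def using assms by (auto intro!: continuous_intros)

lemma rsol_fund_nonzero:
  assumes "\<And>x. x \<in> {0..1} \<Longrightarrow> u * ry1 l x + w * ry2 l x = 0" shows "u = 0 \<and> w = 0"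
proof -
  have "complex_of_real u * Y1 (complex_of_real l) x + complex_of_real w * Y2 (complex_of_real l) x = 0" if "x \<in> {0..1}" for x
    unfolding fund_of_real[OF that] using assms[OF that] by (simp flip: of_real_mult of_real_add)
  from sol0_zero[OF sol0_fund this, of 0] this[of 0] show ?thesis by (simp add: Y1 Y2)
qed

text \<open>For \<open>l = m\<close> these are the entries of the Gram matrix of the fundamental
  system in the weighted space. For distinct parameters they are the divided differences produced by
  the Lagrange identity, and take the place of derivatives in the parameter.\<close>

definition gram :: "real \<Rightarrow> real \<Rightarrow> (real \<Rightarrow> real \<Rightarrow> real) \<Rightarrow> (real \<Rightarrow> real \<Rightarrow> real) \<Rightarrow> real" where
  "gram l m f g = integral {0..1} (\<lambda>x. P x * (f l x * g m x))"

lemma rlagrange: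
  assumes y: "rsol l (f l) (s l)" and z: "rsol m (g m) (t m)"
  shows "f l 1 * t m 1 - s l 1 * g m 1 = f l 0 * t m 0 - s l 0 * g m 0 - (m - l) * gram l m f g"
proof -
  have "((\<lambda>x. f l x * t m x - s l x * g m x) has_vector_derivative (- (m - l)) * (P x * (f l x * g m x))) (at x within {0..1})" if x: "x \<in> {0..1}" for x
  proof -
    note d1 = y[unfolded rsol_def, rule_format, OF x, THEN conjunct1] y[unfolded rsol_def, rule_format, OF x, THEN conjunct2]
    note d2 = z[unfolded rsol_def, rule_format, OF x, THEN conjunct1] z[unfolded rsol_def, rule_format, OF x, THEN conjunct2]
    show ?thesis
      by (rule has_vector_derivative_eq_rhs[OF has_vector_derivative_diff[OF has_vector_derivative_mult[OF d1(1) d2(2)] has_vector_derivative_mult[OF d1(2) d2(1)]]])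
        (simp add: algebra_simps)
  qed
  then have "((\<lambda>x. (- (m - l)) * (P x * (f l x * g m x))) has_integral ((f l 1 * t m 1 - s l 1 * g m 1) - (f l 0 * t m 0 - s l 0 * g m 0))) {0..1}"
    by (intro fundamental_theorem_of_calculus) auto
  from integral_unique[OF this]
  have "- (m - l) * gram l m f g = (f l 1 * t m 1 - s l 1 * g m 1) - (f l 0 * t m 0 - s l 0 * g m 0)"
    unfolding gram_def by (simp only: integral_mult_right)
  then show ?thesis by linarith
qed

lemma gram_continuous:
  assumes "f \<in> {ry1, ry2}" "g \<in> {ry1, ry2}"
  shows "continuous_on UNIV (\<lambda>m. gram l m f g)"
proof -
  have "continuous_on UNIV (\<lambda>m. integral (cbox 0 1) (\<lambda>x. P x * (f l x * g m x)))"
  proof (rule integral_continuous_on_param, unfold split_beta)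
    have cP: "continuous_on (UNIV \<times> {0..1}) (\<lambda>p. P (snd p))"
      by (rule continuous_on_compose2[OF P_cont continuous_on_snd[OF continuous_on_id]]) auto
    have c1: "continuous_on (UNIV \<times> {0..1}) (\<lambda>p. f l (snd p))" and c2: "continuous_on (UNIV \<times> {0..1}) (\<lambda>p. g (fst p) (snd p))"
      using assms by (auto intro!: continuous_intros)
    show "continuous_on (UNIV \<times> cbox 0 1) (\<lambda>p. P (snd p) * (f l (snd p) * g (fst p) (snd p)))"
      using cP c1 c2 by (intro continuous_on_mult) auto
  qed
  then show ?thesis by (simp add: gram_def)
qed

text \<open>The expression is the weighted square integral of the solution with initial values
  \<open>(u, w)\<close>, which is not identically 0.\<close>

lemma gram_quadratic:
  assumes "\<not> (u = 0 \<and> w = 0)"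
  shows "0 < u\<^sup>2 * gram l l ry1 ry1 + 2 * u * w * gram l l ry1 ry2 + w\<^sup>2 * gram l l ry2 ry2"
proof -
  let ?y = "\<lambda>x. u * ry1 l x + w * ry2 l x"
  have c1: "continuous_on {0..1} (ry1 l)" "continuous_on {0..1} (ry2 l)"     using rsol_continuous(1)[OF rsol1[of l]] rsol_continuous(1)[OF rsol2[of l]] by auto
  have cy: "continuous_on {0..1} (\<lambda>x. P x * (?y x)\<^sup>2)" by (intro continuous_intros P_cont c1)
  have i: "(\<lambda>x. P x * (ry1 l x * ry1 l x)) integrable_on {0..1}" "(\<lambda>x. P x * (ry1 l x * ry2 l x)) integrable_on {0..1}" "(\<lambda>x. P x * (ry2 l x * ry2 l x)) integrable_on {0..1}"
    by (intro integrable_continuous_real continuous_intros P_cont c1)+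
  have "((\<lambda>x. u\<^sup>2 * (P x * (ry1 l x * ry1 l x)) + 2 * u * w * (P x * (ry1 l x * ry2 l x)) + w\<^sup>2 * (P x * (ry2 l x * ry2 l x)))
     has_integral (u\<^sup>2 * gram l l ry1 ry1 + 2 * u * w * gram l l ry1 ry2 + w\<^sup>2 * gram l l ry2 ry2)) {0..1}"
    unfolding gram_def by (intro has_integral_add has_integral_mult_right integrable_integral i)
  moreover have "(\<lambda>x. u\<^sup>2 * (P x * (ry1 l x * ry1 l x)) + 2 * u * w * (P x * (ry1 l x * ry2 l x)) + w\<^sup>2 * (P x * (ry2 l x * ry2 l x))) = (\<lambda>x. P x * (?y x)\<^sup>2)"
    by (rule ext) (simp add: power2_eq_square algebra_simps)
  ultimately have e: "integral {0..1} (\<lambda>x. P x * (?y x)\<^sup>2) = u\<^sup>2 * gram l l ry1 ry1 + 2 * u * w * gram l l ry1 ry2 + w\<^sup>2 * gram l l ry2 ry2"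
    by (simp add: integral_unique)
  have "integral {0..1} (\<lambda>x. P x * (?y x)\<^sup>2) \<ge> 0"
    using P_pos by (intro Henstock_Kurzweil_Integration.integral_nonneg integrable_continuous_real cy) (simp add: less_imp_le)
  moreover have "integral {0..1} (\<lambda>x. P x * (?y x)\<^sup>2) \<noteq> 0"
  proof
    assume "integral {0..1} (\<lambda>x. P x * (?y x)\<^sup>2) = 0"
    then have "\<And>x. x \<in> {0..1} \<Longrightarrow> P x * (?y x)\<^sup>2 = 0"
      using integral_eq_0_iff[OF cy] P_pos by (simp add: less_imp_le)
    then have "\<And>x. x \<in> {0..1} \<Longrightarrow> ?y x = 0" using P_nz by simp
    from rsol_fund_nonzero[OF this] assms show False by blast
  qed
  ultimately show ?thesis using e by linarith
qed

text \<open>The trace of the unimodular matrix \<open>diag(\<beta>, 1/\<beta>) M(l)\<close>, where \<open>M(l)\<close> is the monodromy matrix;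
  \<open>full_degenerate\<close> says that this product is the identity.\<close>

definition disc :: "real \<Rightarrow> real \<Rightarrow> real" where
  "disc \<beta> l = \<beta> * ry1 l 1 + rs2 l 1 / \<beta>"

definition full_degenerate :: "real \<Rightarrow> real \<Rightarrow> bool" where
  "full_degenerate \<beta> l \<longleftrightarrow> \<beta> * ry1 l 1 = 1 \<and> ry2 l 1 = 0 \<and> rs1 l 1 = 0 \<and> rs2 l 1 = \<beta>"

section \<open>The discriminant near the value 2\<close>

lemma disc_continuous: "\<beta> \<noteq> 0 \<Longrightarrow> continuous_on UNIV (disc \<beta>)"
  unfolding disc_def by (auto intro!: continuous_intros)

text \<open>The four Lagrange identities between the parameters \<open>l\<close> and
  \<open>m\<close> are linear in the entries at \<open>m\<close> and are solved with the determinant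
  1 of the matrix at \<open>l\<close>. The formulas are exact for all \<open>m\<close>, so local
  statements only require continuity of the Gram entries.\<close>

lemma monodromy_perturbation:
  shows "ry1 m 1 = ry1 l 1 + (m - l) * (ry1 l 1 * gram l m ry2 ry1 - ry2 l 1 * gram l m ry1 ry1)"
    "ry2 m 1 = ry2 l 1 + (m - l) * (ry1 l 1 * gram l m ry2 ry2 - ry2 l 1 * gram l m ry1 ry2)"
    "rs1 m 1 = rs1 l 1 + (m - l) * (rs1 l 1 * gram l m ry2 ry1 - rs2 l 1 * gram l m ry1 ry1)"
    "rs2 m 1 = rs2 l 1 + (m - l) * (rs1 l 1 * gram l m ry2 ry2 - rs2 l 1 * gram l m ry1 ry2)"
proof -
  define a b c d where "a = ry1 l 1" and "b = ry2 l 1" and "c = rs1 l 1" and "d = rs2 l 1"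
  define a' b' c' d' where "a' = ry1 m 1" and "b' = ry2 m 1" and "c' = rs1 m 1" and "d' = rs2 m 1"
  define I11 I12 I21 I22 e where "I11 = gram l m ry1 ry1" and "I12 = gram l m ry1 ry2" and "I21 = gram l m ry2 ry1" and "I22 = gram l m ry2 ry2" and "e = m - l"
  note defs = a_def b_def c_def d_def a'_def b'_def c'_def d'_def I11_def I12_def I21_def I22_def e_def
  have det: "a * d - b * c = 1" using real_det[of 1 l] by (simp add: defs)
  have 1: "a * c' - c * a' = - (e * I11)" using rlagrange[where f = ry1 and g = ry1 and s = rs1 and t = rs1, OF rsol1[of l] rsol1[of m]] by (simp add: defs real_init)
  have 2: "a * d' - c * b' = 1 - e * I12" using rlagrange[where f = ry1 and g = ry2 and s = rs1 and t = rs2, OF rsol1[of l] rsol2[of m]] by (simp add: defs real_init)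
  have 3: "b * c' - d * a' = - 1 - e * I21" using rlagrange[where f = ry2 and g = ry1 and s = rs2 and t = rs1, OF rsol2[of l] rsol1[of m]] by (simp add: defs real_init)
  have 4: "b * d' - d * b' = - (e * I22)" using rlagrange[where f = ry2 and g = ry2 and s = rs2 and t = rs2, OF rsol2[of l] rsol2[of m]] by (simp add: defs real_init)
  have "a' = (a * d - b * c) * a'" using det by simp
  also have "\<dots> = b * (a * c' - c * a') - a * (b * c' - d * a')" by (simp add: algebra_simps)
  finally show "ry1 m 1 = ry1 l 1 + (m - l) * (ry1 l 1 * gram l m ry2 ry1 - ry2 l 1 * gram l m ry1 ry1)"
    unfolding 1 3 by (simp add: defs algebra_simps)
  have "b' = (a * d - b * c) * b'" using det by simp
  also have "\<dots> = b * (a * d' - c * b') - a * (b * d' - d * b')" by (simp add: algebra_simps)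
  finally show "ry2 m 1 = ry2 l 1 + (m - l) * (ry1 l 1 * gram l m ry2 ry2 - ry2 l 1 * gram l m ry1 ry2)"
    unfolding 2 4 by (simp add: defs algebra_simps)
  have "c' = (a * d - b * c) * c'" using det by simp
  also have "\<dots> = d * (a * c' - c * a') - c * (b * c' - d * a')" by (simp add: algebra_simps)
  finally show "rs1 m 1 = rs1 l 1 + (m - l) * (rs1 l 1 * gram l m ry2 ry1 - rs2 l 1 * gram l m ry1 ry1)"
    unfolding 1 3 by (simp add: defs algebra_simps)
  have "d' = (a * d - b * c) * d'" using det by simp
  also have "\<dots> = d * (a * d' - c * b') - c * (b * d' - d * b')" by (simp add: algebra_simps)
  finally show "rs2 m 1 = rs2 l 1 + (m - l) * (rs1 l 1 * gram l m ry2 ry2 - rs2 l 1 * gram l m ry1 ry2)"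
    unfolding 2 4 by (simp add: defs algebra_simps)
qed

lemma continuous_sign_near:
  fixes T :: "real \<Rightarrow> real"
  assumes "continuous_on UNIV T" "0 < \<sigma> * T l" obtains e where "e > 0" "\<And>m. \<bar>m - l\<bar> < e \<Longrightarrow> 0 < \<sigma> * T m"
proof -
  have "continuous_on UNIV (\<lambda>m. \<sigma> * T m)" by (intro continuous_intros assms(1))
  then have "isCont (\<lambda>m. \<sigma> * T m) l" by (simp add: continuous_on_eq_continuous_at)
  then have "((\<lambda>m. \<sigma> * T m) \<longlongrightarrow> \<sigma> * T l) (nhds l)" by (simp add: continuous_at tendsto_nhds_iff)
  then have "\<forall>\<^sub>F m in nhds l. 0 < \<sigma> * T m" by (rule order_tendstoD(1)[OF _ assms(2)])
  then show ?thesis using that unfolding eventually_nhds_metric dist_real_def by blast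
qed

lemma disc_simple_crossing:
  assumes \<beta>: "\<beta> \<noteq> 0" and 2: "disc \<beta> l = 2" and nd: "\<not> full_degenerate \<beta> l"
  obtains e \<sigma> where "e > 0" "\<And>m. m \<noteq> l \<Longrightarrow> \<bar>m - l\<bar> < e \<Longrightarrow> 0 < \<sigma> * ((m - l) * (disc \<beta> m - 2))"
proof -
  define a b c d where "a = ry1 l 1" and "b = ry2 l 1" and "c = rs1 l 1" and "d = rs2 l 1"
  note defs = a_def b_def c_def d_def
  \<comment> \<open>The divided difference of \<open>disc \<beta>\<close> at \<open>l\<close>,
    extended continuously to \<open>m = l\<close>; the claim amounts to
    \<open>T l \<noteq> 0\<close>.\<close>
  define T where "T m = \<beta> * (a * gram l m ry2 ry1 - b * gram l m ry1 ry1) + (c * gram l m ry2 ry2 - d * gram l m ry1 ry2) / \<beta>" for m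
  have D: "disc \<beta> m - 2 = (m - l) * T m" for m
  proof -
    have "disc \<beta> m - disc \<beta> l = (m - l) * T m"
      unfolding disc_def T_def defs monodromy_perturbation[of m l] using \<beta> by (simp add: field_simps)
    then show ?thesis using 2 by simp
  qed
  have cT: "continuous_on UNIV T" unfolding T_def by (intro continuous_intros gram_continuous) (use \<beta> in auto)
  \<comment> \<open>Entries of \<open>diag(\<beta>, 1/\<beta>) M(l)\<close> minus the identity.
    Trace 2 makes the remaining diagonal entry \<open>- n11\<close>, and determinant 1 then makes
    the matrix nilpotent, which is \<open>nn\<close>.\<close>
  define n11 n12 n21 where "n11 = \<beta> * a - 1" and "n12 = \<beta> * b" and "n21 = c / \<beta>"
  have det: "a * d - b * c = 1" using real_det[of 1 l] by (simp add: defs)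
  have n22: "d / \<beta> - 1 = - n11" using 2 by (simp add: disc_def defs n11_def)
  then have d: "d = \<beta> * (1 - n11)" using \<beta> by (simp add: field_simps)
  have nn: "n11\<^sup>2 + n12 * n21 = 0"
  proof -
    have "n12 * n21 = b * c" using \<beta> by (simp add: n12_def n21_def)
    moreover have "a * d = (1 + n11) * (1 - n11)" unfolding d by (simp add: n11_def algebra_simps)
    ultimately show ?thesis using det by (simp add: power2_eq_square algebra_simps)
  qed
  define A B C where "A = gram l l ry1 ry1" and "B = gram l l ry2 ry2" and "C = gram l l ry1 ry2"
  have C': "gram l l ry2 ry1 = C" by (simp add: gram_def C_def mult.commute mult.left_commute)
  have Tl: "T l = 2 * n11 * C - n12 * A + n21 * B"
  proof -
    have "T l = C * (\<beta> * a - d / \<beta>) - \<beta> * b * A + c / \<beta> * B"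
      unfolding T_def C' A_def[symmetric] B_def[symmetric] C_def[symmetric] by (simp add: algebra_simps diff_divide_distrib add_divide_distrib)
    also have "\<beta> * a - d / \<beta> = 2 * n11" using n22 by (simp add: n11_def)
    finally show ?thesis by (simp add: n12_def n21_def)
  qed
  have Q: "0 < u\<^sup>2 * A + 2 * u * w * C + w\<^sup>2 * B" if "\<not> (u = 0 \<and> w = 0)" for u w
    using gram_quadratic[OF that, of l] by (simp add: A_def B_def C_def)
  have "T l \<noteq> 0"
  proof (cases "n12 = 0")
    case True
    then have n11: "n11 = 0" using nn by simp
    have "n21 \<noteq> 0"
    proof
      assume "n21 = 0"
      then have "full_degenerate \<beta> l"
        using True n11 d \<beta> by (simp add: full_degenerate_def n11_def n12_def n21_def defs)
      then show False using nd by simp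
    qed
    moreover have "B > 0" using Q[of 0 1] by simp
    ultimately show ?thesis using Tl True n11 by simp
  next
    case False
    \<comment> \<open>The vector \<open>(n12, - n11)\<close> spans the kernel of the nilpotent
      matrix, so it holds the initial values of the eigenfunction. Up to the factor
      \<open>- n12\<close>, \<open>T l\<close> is the weighted square integral of that
      eigenfunction.\<close>
    have "- n12 * T l = n12\<^sup>2 * A + 2 * n12 * (- n11) * C + (- n12 * n21) * B"
      unfolding Tl by (simp add: power2_eq_square algebra_simps)
    also have "- n12 * n21 = (- n11)\<^sup>2" using nn by simp
    finally have "0 < - n12 * T l" using Q[of n12 "- n11"] False by simp
    then show ?thesis by auto
  qed
  then have "0 < T l * T l" by (simp add: zero_less_mult_iff linorder_neq_iff) linarith
  then obtain e where e: "e > 0" "\<And>m. \<bar>m - l\<bar> < e \<Longrightarrow> 0 < T l * T m" using continuous_sign_near[OF cT] by blast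
  show ?thesis
  proof (rule that[OF e(1), of "T l"])
    fix m assume m: "m \<noteq> l" "\<bar>m - l\<bar> < e"
    have "T l * ((m - l) * (disc \<beta> m - 2)) = (m - l)\<^sup>2 * (T l * T m)" unfolding D by (simp add: power2_eq_square)
    moreover have "0 < (m - l)\<^sup>2 * (T l * T m)" by (rule mult_pos_pos[OF _ e(2)[OF m(2)]]) (use m(1) in simp)
    ultimately show "0 < T l * ((m - l) * (disc \<beta> m - 2))" by metis
  qed
qed

text \<open>Unimodularity of the monodromy matrix gives \<open>D - 2 = - (m - l)\<^sup>2 G m\<close> with a function \<open>G\<close> that is
  positive near \<open>l\<close> by the strict Cauchy--Schwarz inequality.\<close>

lemma disc_double_touch:
  assumes \<beta>: "\<beta> \<noteq> 0" and fd: "full_degenerate \<beta> l"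
  obtains e where "e > 0" "\<And>m. m \<noteq> l \<Longrightarrow> \<bar>m - l\<bar> < e \<Longrightarrow> disc \<beta> m < 2"
proof -
  define G where "G m = gram l m ry1 ry1 * gram l m ry2 ry2 - gram l m ry1 ry2 * gram l m ry2 ry1" for m
  have cG: "continuous_on UNIV G" unfolding G_def by (intro continuous_intros gram_continuous) auto
  define A B C where "A = gram l l ry1 ry1" and "B = gram l l ry2 ry2" and "C = gram l l ry1 ry2"
  have C': "gram l l ry2 ry1 = C" by (simp add: gram_def C_def mult.commute mult.left_commute)
  have Q: "0 < u\<^sup>2 * A + 2 * u * w * C + w\<^sup>2 * B" if "\<not> (u = 0 \<and> w = 0)" for u w
    using gram_quadratic[OF that, of l] by (simp add: A_def B_def C_def)
  have B: "B > 0" using Q[of 0 1] by simp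
  \<comment> \<open>This argument completes the square: the quadratic form takes the value
    \<open>B\<close> times the determinant of the Gram matrix.\<close>
  have "0 < B\<^sup>2 * A + 2 * B * (- C) * C + (- C)\<^sup>2 * B" using Q[of B "- C"] B by simp
  also have "\<dots> = B * (A * B - C * C)" by (simp add: power2_eq_square algebra_simps)
  finally have "0 < A * B - C * C" using B by (simp add: zero_less_mult_iff)
  then have "0 < 1 * G l" by (simp add: G_def A_def B_def C' C_def)
  then obtain e where e: "e > 0" "\<And>m. \<bar>m - l\<bar> < e \<Longrightarrow> 0 < 1 * G m" using continuous_sign_near[OF cG] by blast
  show ?thesis
  proof (rule that[OF e(1)])
    fix m assume m: "m \<noteq> l" "\<bar>m - l\<bar> < e"
    define \<epsilon> where "\<epsilon> = m - l"
    define I11 I12 I21 I22 where "I11 = gram l m ry1 ry1" and "I12 = gram l m ry1 ry2" and "I21 = gram l m ry2 ry1" and "I22 = gram l m ry2 ry2"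
    have l1: "ry1 l 1 = 1 / \<beta>" "ry2 l 1 = 0" "rs1 l 1 = 0" "rs2 l 1 = \<beta>"
      using fd \<beta> by (auto simp: full_degenerate_def field_simps)
    have m1: "ry1 m 1 = (1 + \<epsilon> * I21) / \<beta>" "ry2 m 1 = \<epsilon> * I22 / \<beta>" "rs1 m 1 = - \<epsilon> * \<beta> * I11" "rs2 m 1 = \<beta> * (1 - \<epsilon> * I12)"
      using monodromy_perturbation[of m l] unfolding l1 by (simp_all add: \<epsilon>_def I11_def I12_def I21_def I22_def algebra_simps add_divide_distrib diff_divide_distrib)
    have "ry1 m 1 * rs2 m 1 - ry2 m 1 * rs1 m 1 = 1" by (rule real_det) simp
    then have "(1 + \<epsilon> * I21) * (1 - \<epsilon> * I12) + \<epsilon> * I22 * \<epsilon> * I11 = 1" unfolding m1 using \<beta> by simp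
    then have "\<epsilon> * (I21 - I12) = - (\<epsilon>\<^sup>2 * (I11 * I22 - I12 * I21))" by (simp add: power2_eq_square algebra_simps)
    moreover have "disc \<beta> m - 2 = \<epsilon> * (I21 - I12)" unfolding disc_def m1 using \<beta> by (simp add: field_simps)
    moreover have "0 < \<epsilon>\<^sup>2 * (I11 * I22 - I12 * I21)"
      using e(2)[OF m(2)] m(1) by (simp add: G_def \<epsilon>_def I11_def I12_def I21_def I22_def)
    ultimately show "disc \<beta> m < 2" by linarith
  qed
qed

section \<open>The discriminant at both ends of the real line\<close>

lemma very_negative:
  obtains R where "R > 0" "\<And>l x. l < - R \<Longrightarrow> x \<in> {0..1} \<Longrightarrow> q x + l * P x < 0"
proof -
  have c: "continuous_on {0..1} (\<lambda>x. q x / P x)" using P_nz by (intro continuous_intros q_cont P_cont) auto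
  have "bounded ((\<lambda>x. q x / P x) ` {0..1})" by (rule compact_imp_bounded[OF compact_continuous_image[OF c]]) simp
  then obtain R where R: "R > 0" "\<forall>y\<in>(\<lambda>x. q x / P x) ` {0..1}. norm y \<le> R" unfolding bounded_pos by blast
  show ?thesis
  proof (rule that[OF R(1)])
    fix l x :: real assume l: "l < - R" and x: "x \<in> {0..1}"
    have "norm (q x / P x) \<le> R" using R(2) x by blast
    then have "q x / P x \<le> R" unfolding real_norm_def by linarith
    then have "q x \<le> R * P x" using P_pos[of x] by (simp add: field_simps)
    also have "\<dots> < - l * P x" using l P_pos[of x] by (intro mult_strict_right_mono) auto
    finally show "q x + l * P x < 0" by simp
  qed
qed

text \<open>The derivative of \<open>s y\<close> is \<open>s^2 / P - (q + l P) y^2\<close>, a sum of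
  two nonnegative terms; equal values of \<open>s y\<close> at 0 and \<open>x0\<close> force both to
  vanish. The free end point \<open>x0\<close> also allows comparison up to an interior zero of
  \<open>y\<close>.\<close>

lemma energy_zero:
  assumes neg: "\<And>x. x \<in> {0..1} \<Longrightarrow> q x + l * P x < 0" and s: "rsol l y s" and x0: "x0 \<in> {0..1}"
    and bd: "s x0 * y x0 = s 0 * y 0" and x: "x \<in> {0..x0}" "x0 > 0"
  shows "y x = 0"
proof -
  let ?e = "\<lambda>x. (s x)\<^sup>2 / P x - (q x + l * P x) * (y x)\<^sup>2"
  note cy = rsol_continuous[OF s]
  have dd: "((\<lambda>x. s x * y x) has_vector_derivative ?e x) (at x within {0..1})" if "x \<in> {0..1}" for x
  proof -
    note d1 = s[unfolded rsol_def, rule_format, OF that, THEN conjunct1] s[unfolded rsol_def, rule_format, OF that, THEN conjunct2]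
    show ?thesis
      by (rule has_vector_derivative_eq_rhs[OF has_vector_derivative_mult[OF d1(2) d1(1)]]) (simp add: power2_eq_square algebra_simps)
  qed
  have "(?e has_integral (s x0 * y x0 - s 0 * y 0)) {0..x0}"
  proof (rule fundamental_theorem_of_calculus)
    show "((\<lambda>x. s x * y x) has_vector_derivative ?e x) (at x within {0..x0})" if "x \<in> {0..x0}" for x
      by (rule has_vector_derivative_within_subset[OF dd]) (use that x0 in auto)
  qed (use x0 in auto)
  then have z: "integral {0..x0} ?e = 0" using bd by (simp add: integral_unique)
  have c: "continuous_on {0..x0} ?e"
    by (rule continuous_on_subset[of "{0..1}"]) (use x0 P_nz in \<open>auto intro!: continuous_intros cy P_cont q_cont\<close>)
  have nn: "0 \<le> - (q x + l * P x) * (y x)\<^sup>2" "0 \<le> (s x)\<^sup>2 / P x" if "x \<in> {0..x0}" for x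
    using neg[of x] P_pos[of x] that x0 by (auto intro!: mult_nonneg_nonneg)
  have "?e x = 0"
  proof -
    have "\<forall>x\<in>{0..x0}. ?e x = 0"
      using integral_eq_0_iff[OF c] z nn x(2) by (force simp: algebra_simps)
    then show ?thesis using x(1) by blast
  qed
  then have "- (q x + l * P x) * (y x)\<^sup>2 = 0" using nn[OF x(1)] by linarith
  then show ?thesis using neg[of x] x x0 by auto
qed

text \<open>At the value 2 there is a nonzero solution with \<open>y 0 = \<beta> y 1\<close> and
  \<open>s 1 = \<beta> s 0\<close>. Under these conditions \<open>s y\<close> has the same value at
  0 and 1, which the energy identity excludes.\<close>

lemma disc_negative_ne2:
  assumes neg: "\<And>x. x \<in> {0..1} \<Longrightarrow> q x + l * P x < 0" and \<beta>: "\<beta> \<noteq> 0"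
  shows "disc \<beta> l \<noteq> 2"
proof
  assume 2: "disc \<beta> l = 2"
  define a b c d where "a = ry1 l 1" and "b = ry2 l 1" and "c = rs1 l 1" and "d = rs2 l 1"
  note defs = a_def b_def c_def d_def
  have det: "a * d - b * c = 1" using real_det[of 1 l] by (simp add: defs)
  have D: "\<beta> * a + d / \<beta> = 2" using 2 by (simp add: disc_def defs)
  then have d: "d = \<beta> * (2 - \<beta> * a)" using \<beta> by (simp add: field_simps)
  obtain u w where uw: "\<not> (u = 0 \<and> w = 0)" "u = \<beta> * (u * a + w * b)" "u * c + w * d = \<beta> * w"
  proof (cases "b = 0 \<and> \<beta> * a = 1")
    case True
    then have "d = \<beta>" using d by simp
    then show ?thesis using that[of 0 1] True by simp
  next
    case False
    have "\<beta> * (b * \<beta> * c + (1 - \<beta> * a) * d) = \<beta> * (\<beta> * (1 - \<beta> * a))"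
    proof -
      have "b * c = a * d - 1" using det by simp
      moreover have "b * \<beta> * c + (1 - \<beta> * a) * d = \<beta> * (b * c) + (1 - \<beta> * a) * d" by (simp add: algebra_simps)
      ultimately have "b * \<beta> * c + (1 - \<beta> * a) * d = \<beta> * (a * d - 1) + (1 - \<beta> * a) * d" by simp
      also have "\<dots> = d - \<beta>" by (simp add: algebra_simps)
      also have "\<dots> = \<beta> * (1 - \<beta> * a)" unfolding d by (simp add: algebra_simps)
      finally show ?thesis by simp
    qed
    then have "\<beta> * b * c + (1 - \<beta> * a) * d = \<beta> * (1 - \<beta> * a)" using \<beta> by (simp add: mult.commute)
    \<comment> \<open>The vector is read off from the first equation of the eigenvector system; the
      second one follows from trace 2 and determinant 1. If this vector is 0, \<open>(0, 1)\<close>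
      serves instead.\<close>
    then show ?thesis using that[of "\<beta> * b" "1 - \<beta> * a"] False \<beta> by (auto simp: algebra_simps)
  qed
  let ?y = "\<lambda>x. u * ry1 l x + w * ry2 l x" and ?s = "\<lambda>x. u * rs1 l x + w * rs2 l x"
  have 0: "?y 0 = u" "?s 0 = w" by (simp_all add: real_init)
  have 1: "?y 1 = u * a + w * b" "?s 1 = \<beta> * w" using uw(3) by (simp_all add: defs)
  have "w * u = w * (\<beta> * (u * a + w * b))" using uw(2) by simp
  then have "?s 1 * ?y 1 = ?s 0 * ?y 0" unfolding 0 1 by (simp add: algebra_simps)
  from energy_zero[OF neg rsol_fund _ this] have "?y x = 0" if "x \<in> {0..1}" for x using that by simp
  from rsol_fund_nonzero[OF this] uw(1) show False by blast
qed

text \<open>As \<open>\<beta>\<close> varies, \<open>\<beta> (D - 2)\<close> is a quadratic polynomial with positive leading coefficient and without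
  nonzero real roots.\<close>

lemma disc_negative_sign:
  assumes neg: "\<And>x. x \<in> {0..1} \<Longrightarrow> q x + l * P x < 0" and \<beta>: "\<beta> \<noteq> 0"
  shows "0 < \<beta> * (disc \<beta> l - 2)"
proof (rule ccontr)
  define a d where "a = ry1 l 1" and "d = rs2 l 1"
  have a: "a > 0"
  proof (rule ccontr)
    assume "\<not> a > 0"
    \<comment> \<open>Otherwise the solution starting with \<open>y = 1\<close> and
      \<open>s = 0\<close> has a zero in the interval. Up to that zero \<open>s y\<close> has the
      boundary values 0 and 0, against the energy identity.\<close>
    then have "\<exists>x. 0 \<le> x \<and> x \<le> 1 \<and> ry1 l x = 0"
      using rsol_continuous(1)[OF rsol1[of l]] by (intro IVT2') (auto simp: a_def real_init)
    then obtain x0 where x0: "0 \<le> x0" "x0 \<le> 1" "ry1 l x0 = 0" by blast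
    have "x0 \<noteq> 0" using x0(3) real_init(1)[of l] by auto
    then have "ry1 l 0 = 0" using energy_zero[OF neg rsol1[of l], of x0 0] x0 by (simp add: real_init)
    then show False by (simp add: real_init)
  qed
  have f: "\<beta> * (disc \<beta> l - 2) = a * \<beta>\<^sup>2 - 2 * \<beta> + d" using \<beta> by (simp add: disc_def a_def d_def power2_eq_square field_simps)
  assume "\<not> 0 < \<beta> * (disc \<beta> l - 2)"
  then have "a * (a * \<beta>\<^sup>2 - 2 * \<beta> + d) \<le> 0" using f a by (simp add: mult_le_0_iff)
  \<comment> \<open>Multiplication by \<open>a\<close> completes the square. A value of the wrong
    sign, or 0, forces real roots, with \<beta> between them or equal to one of them.\<close>
  then have sq: "(1 - a * \<beta>)\<^sup>2 \<le> 1 - a * d" by (simp add: power2_eq_square algebra_simps)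
  define r where "r = sqrt (1 - a * d)"
  have "0 \<le> 1 - a * d" using sq zero_le_power2[of "1 - a * \<beta>"] by linarith
  then have r: "r * r = 1 - a * d" "r \<ge> 0" by (simp_all add: r_def)
  have r1: "\<bar>1 - a * \<beta>\<bar> \<le> r" using real_sqrt_le_mono[OF sq] by (simp add: r_def)
  have root: "disc t l = 2" if t: "t = (1 + \<tau> * r) / a" "\<tau> * \<tau> = 1" "t \<noteq> 0" for t \<tau>
  proof -
    have "a * t = 1 + \<tau> * r" using t a by simp
    then have "(a * t - 1) * (a * t - 1) = (\<tau> * \<tau>) * (r * r)" by (simp add: mult.commute mult.left_commute)
    then have "a * (a * t * t - 2 * t + d) = 0" using r t(2) by (simp add: algebra_simps)
    then have "a * t * t + d = 2 * t" using a by simp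
    then show ?thesis using t(3) by (simp add: disc_def a_def[symmetric] d_def[symmetric] field_simps)
  qed
  show False
  \<comment> \<open>One nonzero root suffices for a contradiction. For positive \<beta> the larger
    root is positive in any case; for negative \<beta> the distance of \<open>a * \<beta>\<close>
    from 1 exceeds 1, so \<open>r > 1\<close> and the smaller root is negative.\<close>
  proof (cases "\<beta> > 0")
    case True
    have "(1 + 1 * r) / a \<noteq> 0" using a r(2) by simp
    from disc_negative_ne2[OF neg this] root[OF refl _ this] show False by simp
  next
    case False
    then have "a * \<beta> < 0" using \<beta> a by (simp add: mult_less_0_iff)
    then have "r > 1" using r1 by simp
    then have ne: "(1 + (-1) * r) / a \<noteq> 0" using a by simp
    from disc_negative_ne2[OF neg this] root[OF refl _ this] show False by simp
  qed
qed

text \<open>Pruefer argument: \<open>\<zeta> = s + i \<kappa> y\<close> turns around the origin with angular speed at least a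
  multiple of \<open>\<kappa>\<close>, and \<open>exp (G \<kappa>) = \<zeta> 1\<close> for the integral \<open>G\<close> of its logarithmic derivative.\<close>

lemma dirichlet_eigenvalues:
  assumes "K > 0"
  obtains N :: nat and \<kappa> :: "nat \<Rightarrow> real" where "\<And>n. n \<ge> N \<Longrightarrow> \<kappa> n \<ge> K"
    "\<And>n. n \<ge> N \<Longrightarrow> ry2 ((\<kappa> n)\<^sup>2) 1 = 0" "\<And>n. n \<ge> N \<Longrightarrow> 0 < (-1)^n * rs2 ((\<kappa> n)\<^sup>2) 1"
proof -
  obtain B where B: "B > 0" "\<And>x. x \<in> {0..1} \<Longrightarrow> 1 / P x \<le> B" "\<And>x. x \<in> {0..1} \<Longrightarrow> P x \<le> B"
    by (rule coefficient_bound[of 0]) blast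
  \<comment> \<open>As \<open>B\<close> bounds both \<open>P\<close> and \<open>1 / P\<close> from
    above, \<open>m\<close> bounds both from below.\<close>
  define m where "m = 1 / B"
  have m: "m > 0" "\<And>x. x \<in> {0..1} \<Longrightarrow> m \<le> P x" "\<And>x. x \<in> {0..1} \<Longrightarrow> m \<le> 1 / P x"
    using B P_pos by (auto simp: m_def field_simps)
  define \<zeta> where "\<zeta> k x = complex_of_real (rs2 (k\<^sup>2) x) + \<i> * complex_of_real (k * ry2 (k\<^sup>2) x)" for k x
  define \<zeta>' where "\<zeta>' k x = complex_of_real (- (q x + k\<^sup>2 * P x) * ry2 (k\<^sup>2) x) + \<i> * complex_of_real (k * (rs2 (k\<^sup>2) x / P x))" for k x
  have nz: "\<zeta> k x \<noteq> 0" if "k > 0" "x \<in> {0..1}" for k x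
  proof
    assume "\<zeta> k x = 0"
    then have "rs2 (k\<^sup>2) x = 0" "k * ry2 (k\<^sup>2) x = 0" by (auto simp: \<zeta>_def complex_eq_iff)
    then show False using real_det[OF that(2), of "k\<^sup>2"] that(1) by simp
  qed
  have d\<zeta>: "(\<zeta> k has_vector_derivative \<zeta>' k x) (at x within {0..1})" if "x \<in> {0..1}" for k x
  proof -
    note d = rsol2[of "k\<^sup>2", unfolded rsol_def, rule_format, OF that]
    note d' = d[folded has_real_derivative_iff_has_vector_derivative]
    show ?thesis unfolding \<zeta>_def \<zeta>'_def
      by (intro has_vector_derivative_add has_vector_derivative_mult_right has_vector_derivative_of_real DERIV_cmult d'[THEN conjunct1] d'[THEN conjunct2])
  qed
  have Im: "k * m \<le> Im (\<zeta>' k x / \<zeta> k x)" if "k > 0" "x \<in> {0..1}" for k x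
  proof -
    let ?s = "rs2 (k\<^sup>2) x" and ?y = "ry2 (k\<^sup>2) x"
    have pos: "0 < ?s\<^sup>2 + (k * ?y)\<^sup>2"
      using nz[OF that] by (auto simp: \<zeta>_def complex_eq_iff sum_power2_gt_zero_iff)
    have "Im (\<zeta>' k x / \<zeta> k x) = k * (?s\<^sup>2 * (1 / P x) + (q x + k\<^sup>2 * P x) * ?y\<^sup>2) / (?s\<^sup>2 + (k * ?y)\<^sup>2)"
      by (simp add: \<zeta>_def \<zeta>'_def Im_divide power2_eq_square algebra_simps)
    moreover have "m * (?s\<^sup>2 + (k * ?y)\<^sup>2) \<le> ?s\<^sup>2 * (1 / P x) + (q x + k\<^sup>2 * P x) * ?y\<^sup>2"
    proof -
      have "m * ?s\<^sup>2 \<le> 1 / P x * ?s\<^sup>2" by (rule mult_right_mono[OF m(3)[OF that(2)]]) simp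
      moreover have "m * (k\<^sup>2 * ?y\<^sup>2) \<le> P x * (k\<^sup>2 * ?y\<^sup>2)" by (rule mult_right_mono[OF m(2)[OF that(2)]]) simp
      moreover have "0 \<le> q x * ?y\<^sup>2" using q_nonneg by simp
      ultimately show ?thesis by (simp add: power_mult_distrib algebra_simps)
    qed
    ultimately show ?thesis using pos that(1) by (simp add: pos_le_divide_eq mult.assoc)
  qed
  have cl: "continuous_on ({0<..} \<times> {0..1}) (\<lambda>p. \<zeta>' (fst p) (snd p) / \<zeta> (fst p) (snd p))"
  proof (rule continuous_on_divide)
    have cP: "continuous_on ({0<..} \<times> {0..1}) (\<lambda>p. P (snd p))" and cq: "continuous_on ({0<..} \<times> {0..1}) (\<lambda>p. q (snd p))"
      by (rule continuous_on_compose2[OF P_cont continuous_on_snd[OF continuous_on_id]], auto)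
        (rule continuous_on_compose2[OF q_cont continuous_on_snd[OF continuous_on_id]], auto)
    show "continuous_on ({0<..} \<times> {0..1}) (\<lambda>p. \<zeta>' (fst p) (snd p))" unfolding \<zeta>'_def
      by (intro continuous_intros cP cq) (use P_nz in auto)
    show "continuous_on ({0<..} \<times> {0..1}) (\<lambda>p. \<zeta> (fst p) (snd p))" unfolding \<zeta>_def
      by (intro continuous_intros) auto
  qed (use nz in auto)
  have clk: "continuous_on {0..1} (\<lambda>x. \<zeta>' k x / \<zeta> k x)" if "k > 0" for k
    by (rule continuous_on_compose2[OF cl, of "{0..1}" "\<lambda>x. (k, x)", simplified]) (use that in \<open>auto intro!: continuous_intros\<close>)
  define G where "G k = integral (cbox 0 1) (\<lambda>x. \<zeta>' k x / \<zeta> k x)" for k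
  have cG: "continuous_on {0<..} G" unfolding G_def
    by (rule integral_continuous_on_param) (use cl in \<open>simp add: split_beta\<close>)
  have eG: "exp (G k) = \<zeta> k 1" if k: "k > 0" for k
  proof -
    define g where "g x = integral {0..x} (\<lambda>x. \<zeta>' k x / \<zeta> k x)" for x
    have dg: "(g has_vector_derivative \<zeta>' k x / \<zeta> k x) (at x within {0..1})" if "x \<in> {0..1}" for x
      unfolding g_def by (rule integral_has_vector_derivative[OF clk[OF k] that])
    have de: "((\<lambda>x. exp (- g x)) has_vector_derivative - (\<zeta>' k x / \<zeta> k x) * exp (- g x)) (at x within {0..1})" if "x \<in> {0..1}" for x
      using field_vector_diff_chain_within[of "\<lambda>x. - g x" "- (\<zeta>' k x / \<zeta> k x)" x "{0..1}" exp "exp (- g x)"]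
        has_vector_derivative_minus[OF dg[OF that]] DERIV_exp[of "- g x"]
      by (simp add: o_def has_field_derivative_at_within)
    have "(\<lambda>x. \<zeta> k x * exp (- g x)) 1 = (\<lambda>x. \<zeta> k x * exp (- g x)) 0"
    proof (rule constant01)
      fix x :: real assume x: "x \<in> {0..1}"
      show "((\<lambda>x. \<zeta> k x * exp (- g x)) has_vector_derivative 0) (at x within {0..1})"
        by (rule has_vector_derivative_eq_rhs[OF has_vector_derivative_mult[OF d\<zeta>[OF x] de[OF x]]]) (use nz[OF k x] in \<open>simp add: field_simps\<close>)
    qed simp
    moreover have "\<zeta> k 0 = 1" "g 0 = 0" "g 1 = G k" by (simp_all add: \<zeta>_def real_init g_def G_def)
    ultimately show ?thesis by (simp add: exp_minus field_simps)
  qed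
  have Th: "k * m \<le> Im (G k)" if k: "k > 0" for k
  proof -
    have i: "(\<lambda>x. \<zeta>' k x / \<zeta> k x) integrable_on {0..1}" by (rule integrable_continuous_real[OF clk[OF k]])
    have "integral {0..1} (\<lambda>x::real. k * m) \<le> integral {0..1} (\<lambda>x. Im (\<zeta>' k x / \<zeta> k x))"
      by (rule integral_le) (use i Im[OF k] integrable_linear[OF i bounded_linear_Im] in \<open>auto simp: o_def\<close>)
    also have "\<dots> = Im (G k)" using integral_linear[OF i bounded_linear_Im] by (simp add: G_def o_def)
    finally show ?thesis by simp
  qed
  \<comment> \<open>The total angle \<open>Im (G k)\<close> is continuous in \<open>k\<close> and
    unbounded, so from \<open>K\<close> on it attains all multiples of pi with factor at least
    \<open>N\<close>. At the \<open>n\<close>-th of them \<zeta> is real with the sign of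
    \<open>(-1)^n\<close>, that is, \<open>y\<close> vanishes at 1 and \<open>s\<close> has that
    sign.\<close>
  obtain N :: nat where N: "Im (G K) / pi \<le> N" using real_arch_simple by blast
  have "\<exists>k. k \<ge> K \<and> Im (G k) = n * pi" if n: "n \<ge> N" for n :: nat
  proof -
    define k1 where "k1 = max K (n * pi / m)"
    have "n * pi = (n * pi / m) * m" using m(1) by simp
    also have "\<dots> \<le> k1 * m" using m(1) by (intro mult_right_mono) (auto simp: k1_def)
    also have "\<dots> \<le> Im (G k1)" using Th[of k1] assms by (simp add: k1_def)
    finally have u: "n * pi \<le> Im (G k1)" .
    have "Im (G K) \<le> N * pi" using N pi_gt_zero by (simp add: pos_divide_le_eq)
    also have "\<dots> \<le> n * pi" using n pi_gt_zero by (intro mult_right_mono) auto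
    finally have l: "Im (G K) \<le> n * pi" .
    have "continuous_on {K..k1} (\<lambda>k. Im (G k))"
      by (intro continuous_intros continuous_on_subset[OF cG]) (use assms in auto)
    from IVT'[of "\<lambda>k. Im (G k)", OF l u _ this] show ?thesis by (auto simp: k1_def)
  qed
  then obtain \<kappa> :: "nat \<Rightarrow> real" where \<kappa>: "\<And>n. n \<ge> N \<Longrightarrow> \<kappa> n \<ge> K" "\<And>n. n \<ge> N \<Longrightarrow> Im (G (\<kappa> n)) = n * pi" by metis
  have z: "\<zeta> (\<kappa> n) 1 = complex_of_real (exp (Re (G (\<kappa> n))) * (-1)^n)" if "n \<ge> N" for n
  proof -
    have "\<zeta> (\<kappa> n) 1 = exp (G (\<kappa> n))" using eG[of "\<kappa> n"] \<kappa>(1)[OF that] assms by simp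
    also have "\<dots> = complex_of_real (exp (Re (G (\<kappa> n)))) * cis (n * pi)" unfolding exp_eq_polar \<kappa>(2)[OF that] ..
    also have "cis (n * pi) = complex_of_real ((-1)^n)" by (simp add: complex_eq_iff)
    finally show ?thesis by simp
  qed
  show ?thesis
  proof (rule that[OF \<kappa>(1)])
    fix n assume n: "n \<ge> N"
    have k: "\<kappa> n > 0" using \<kappa>(1)[OF n] assms by simp
    have "Im (\<zeta> (\<kappa> n) 1) = 0" using z[OF n] by (simp flip: of_real_power of_real_mult del: of_real_mult)
    then show "ry2 ((\<kappa> n)\<^sup>2) 1 = 0" using k by (simp add: \<zeta>_def)
    have "Re (\<zeta> (\<kappa> n) 1) = exp (Re (G (\<kappa> n))) * (-1)^n" unfolding z[OF n] Re_complex_of_real ..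
    then have "rs2 ((\<kappa> n)\<^sup>2) 1 = exp (Re (G (\<kappa> n))) * (-1)^n" by (simp add: \<zeta>_def)
    moreover have "(-1)^n * (-1)^n = (1::real)" by (simp flip: power_mult_distrib)
    ultimately have "(-1)^n * rs2 ((\<kappa> n)\<^sup>2) 1 = exp (Re (G (\<kappa> n)))" by (simp add: mult.assoc mult.left_commute)
    then show "0 < (-1)^n * rs2 ((\<kappa> n)\<^sup>2) 1" by simp
  qed
qed

text \<open>When \<open>ry2\<close> vanishes at 1 the monodromy matrix is triangular with
  determinant 1, so the discriminant is \<open>t + 1/t\<close> with
  \<open>t = rs2 l 1 / \<beta>\<close>. It is at least 2 or at most -2 according to the sign of
  \<open>t\<close>, which alternates along the parameters found above, and the intermediate value
  theorem applies.\<close>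

lemma disc_infinitely_often_2:
  assumes \<beta>: "\<beta> \<noteq> 0" shows "\<exists>l>R. disc \<beta> l = 2"
proof -
  define K where "K = \<bar>R\<bar> + 1"
  have K: "K \<ge> 1" by (simp add: K_def)
  obtain N :: nat and \<kappa> :: "nat \<Rightarrow> real" where \<kappa>: "\<And>n. n \<ge> N \<Longrightarrow> \<kappa> n \<ge> K"
    "\<And>n. n \<ge> N \<Longrightarrow> ry2 ((\<kappa> n)\<^sup>2) 1 = 0" "\<And>n. n \<ge> N \<Longrightarrow> 0 < (-1)^n * rs2 ((\<kappa> n)\<^sup>2) 1"
    by (rule dirichlet_eigenvalues[of K]) (use K in auto)
  have big: "(\<kappa> n)\<^sup>2 > R" if "n \<ge> N" for n
  proof -
    have "\<kappa> n \<ge> 1" "\<kappa> n > R" using \<kappa>(1)[OF that] K by (auto simp: K_def)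
    then have "\<kappa> n * 1 \<le> \<kappa> n * \<kappa> n" by (intro mult_left_mono) auto
    then show ?thesis using \<open>\<kappa> n > R\<close> by (simp add: power2_eq_square)
  qed
  have D: "\<exists>t. disc \<beta> ((\<kappa> n)\<^sup>2) = 1 / t + t \<and> t = rs2 ((\<kappa> n)\<^sup>2) 1 / \<beta>" if "n \<ge> N" for n
  proof -
    have "ry1 ((\<kappa> n)\<^sup>2) 1 * rs2 ((\<kappa> n)\<^sup>2) 1 = 1" using real_det[of 1 "(\<kappa> n)\<^sup>2"] \<kappa>(2)[OF that] by simp
    then have "ry1 ((\<kappa> n)\<^sup>2) 1 = 1 / rs2 ((\<kappa> n)\<^sup>2) 1" by (metis mult_zero_right nonzero_eq_divide_eq zero_neq_one)
    then show ?thesis using \<beta> by (simp add: disc_def)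
  qed
  have ge: "1 / t + t \<ge> 2" if "t > 0" for t :: real
  proof -
    have "0 \<le> (t - 1)\<^sup>2 / t" using that by simp
    also have "\<dots> = 1 / t + t - 2" using that by (simp add: power2_eq_square field_simps)
    finally show ?thesis by simp
  qed
  have lt: "1 / t + t \<le> 2" if "t < 0" for t :: real using that by (smt (verit) divide_less_0_1_iff)
  \<comment> \<open>Two consecutive indices beyond \<open>N\<close> of known parity; the sign of
    \<beta> decides which of them makes \<open>t\<close> positive.\<close>
  define n1 where "n1 = (if \<beta> > 0 then 2 * N else 2 * N + 1)"
  define n2 where "n2 = (if \<beta> > 0 then 2 * N + 1 else 2 * N)"
  have nN: "n1 \<ge> N" "n2 \<ge> N" by (auto simp: n1_def n2_def)
  have s1: "rs2 ((\<kappa> n1)\<^sup>2) 1 / \<beta> > 0" using \<kappa>(3)[OF nN(1)] \<beta> by (auto simp: n1_def zero_less_divide_iff split: if_splits)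
  have s2: "rs2 ((\<kappa> n2)\<^sup>2) 1 / \<beta> < 0" using \<kappa>(3)[OF nN(2)] \<beta> by (auto simp: n2_def divide_less_0_iff split: if_splits)
  have d1: "disc \<beta> ((\<kappa> n1)\<^sup>2) \<ge> 2" using D[OF nN(1)] ge[OF s1] by auto
  have d2: "disc \<beta> ((\<kappa> n2)\<^sup>2) \<le> 2" using D[OF nN(2)] lt[OF s2] by auto
  have "\<exists>l. min ((\<kappa> n1)\<^sup>2) ((\<kappa> n2)\<^sup>2) \<le> l \<and> disc \<beta> l = 2"
  proof (cases "(\<kappa> n1)\<^sup>2 \<le> (\<kappa> n2)\<^sup>2")
    case True
    from IVT2'[OF d2 d1 True continuous_on_subset[OF disc_continuous[OF \<beta>]]] show ?thesis using True by auto
  next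
    case False
    then have "(\<kappa> n2)\<^sup>2 \<le> (\<kappa> n1)\<^sup>2" by simp
    from IVT'[OF d2 d1 this continuous_on_subset[OF disc_continuous[OF \<beta>]]] show ?thesis using False by auto
  qed
  then show ?thesis using big[OF nN(1)] big[OF nN(2)] by (meson less_le_trans min_less_iff_conj)
qed

text \<open>The solutions are bounded below by the energy argument and isolated by the local
  analysis at simple and double points, so they cannot accumulate in a bounded interval.\<close>

lemma disc_finite_below:
  assumes \<beta>: "\<beta> \<noteq> 0" shows "finite {l. l \<le> t \<and> disc \<beta> l = 2}"
proof (rule ccontr)
  let ?Z = "{l. l \<le> t \<and> disc \<beta> l = 2}"
  assume inf: "infinite ?Z"
  obtain R where R: "R > 0" "\<And>l x. l < - R \<Longrightarrow> x \<in> {0..1} \<Longrightarrow> q x + l * P x < 0" by (rule very_negative) blast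
  have "?Z \<subseteq> {-R..t}"
  proof
    fix l assume l: "l \<in> ?Z"
    then have "\<not> l < - R" using disc_negative_ne2[OF R(2) \<beta>, of l] by blast
    then show "l \<in> {-R..t}" using l by simp
  qed
  then obtain x where x: "x islimpt ?Z" using inf compact_Icc[of "-R" t] unfolding compact_eq_Bolzano_Weierstrass by blast
  have "closed ({..t} \<inter> disc \<beta> -` {2})"
    by (intro closed_Int closed_vimage closed_atMost closed_singleton disc_continuous \<beta>)
  moreover have "?Z = {..t} \<inter> disc \<beta> -` {2}" by auto
  ultimately have "x \<in> ?Z" using x closed_limpt by metis
  then have x2: "disc \<beta> x = 2" by simp
  have "\<exists>e>0. \<forall>m. m \<noteq> x \<longrightarrow> \<bar>m - x\<bar> < e \<longrightarrow> disc \<beta> m \<noteq> 2"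
  proof (cases "full_degenerate \<beta> x")
    case True
    obtain e where "e > 0" "\<And>m. m \<noteq> x \<Longrightarrow> \<bar>m - x\<bar> < e \<Longrightarrow> disc \<beta> m < 2" by (rule disc_double_touch[OF \<beta> True]) blast
    then show ?thesis by force
  next
    case False
    obtain e \<sigma> where "e > 0" "\<And>m. m \<noteq> x \<Longrightarrow> \<bar>m - x\<bar> < e \<Longrightarrow> 0 < \<sigma> * ((m - x) * (disc \<beta> m - 2))" by (rule disc_simple_crossing[OF \<beta> x2 False]) blast
    then show ?thesis by force
  qed
  then obtain e where e: "e > 0" "\<And>m. m \<noteq> x \<Longrightarrow> \<bar>m - x\<bar> < e \<Longrightarrow> disc \<beta> m \<noteq> 2" by blast
  then show False using x unfolding islimpt_approachable dist_real_def by blast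
qed

end

subsection \<open>Counting eigenvalues\<close>

lemma same_sign_no_zero:
  fixes f :: "real \<Rightarrow> real"
  assumes c: "continuous_on UNIV f" and "u \<le> t" and nz: "\<And>x. u \<le> x \<Longrightarrow> x \<le> t \<Longrightarrow> f x \<noteq> 0"
  shows "0 < f u * f t"
proof (rule ccontr)
  assume n: "\<not> 0 < f u * f t"
  have c': "continuous_on {u..t} f" by (rule continuous_on_subset[OF c]) simp
  have "f u \<noteq> 0" "f t \<noteq> 0" using nz assms(2) by auto
  then have "(f u < 0 \<and> f t > 0) \<or> (f u > 0 \<and> f t < 0)" using n by (auto simp: zero_less_mult_iff)
  then show False
  proof
    assume "f u < 0 \<and> f t > 0"
    then have "\<exists>x\<ge>u. x \<le> t \<and> f x = 0" by (intro IVT' c' assms(2)) auto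
    then show False using nz by blast
  next
    assume "f u > 0 \<and> f t < 0"
    then have "\<exists>x\<ge>u. x \<le> t \<and> f x = 0" by (intro IVT2' c' assms(2)) auto
    then show False using nz by blast
  qed
qed

text \<open>Induction on the number of zeros up to \<open>t\<close>: the largest one is discarded by
  moving to a point just to its left, and the signs on its two sides are compared. Beyond this zero
  the sign is constant up to \<open>t\<close>; \<beta> records the sign to the left of all
  zeros.\<close>

lemma sign_change_parity:
  fixes f :: "real \<Rightarrow> real" and simple :: "real \<Rightarrow> bool"
  assumes c: "continuous_on UNIV f" and fin: "\<And>t. finite {l. l \<le> t \<and> f l = 0}"
    and cross: "\<And>l. f l = 0 \<Longrightarrow> simple l \<Longrightarrow> \<exists>e>0. \<exists>\<sigma>. \<forall>m. m \<noteq> l \<longrightarrow> \<bar>m - l\<bar> < e \<longrightarrow> 0 < \<sigma> * ((m - l) * f m)"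
    and touch: "\<And>l. f l = 0 \<Longrightarrow> \<not> simple l \<Longrightarrow> \<exists>e>0. \<forall>m. m \<noteq> l \<longrightarrow> \<bar>m - l\<bar> < e \<longrightarrow> f m < 0"
    and low: "\<And>l. l < - R \<Longrightarrow> 0 < \<beta> * f l"
  shows "f t \<noteq> 0 \<Longrightarrow> 0 < \<beta> * f t * (-1) ^ card {l. l < t \<and> f l = 0 \<and> simple l}"
proof (induction "card {l. l \<le> t \<and> f l = 0}" arbitrary: t)
  case 0
  then have e: "{l. l \<le> t \<and> f l = 0} = {}" using fin[of t] by simp
  then have e': "{l. l < t \<and> f l = 0 \<and> simple l} = {}" by auto
  define u where "u = min t (- R - 1)"
  have "0 < f u * f t" by (rule same_sign_no_zero[OF c]) (use e in \<open>auto simp: u_def\<close>)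
  moreover have "0 < \<beta> * f u" by (rule low) (simp add: u_def)
  ultimately show ?case unfolding e' by (auto simp: zero_less_mult_iff)
next
  case (Suc n)
  let ?Z = "\<lambda>t. {l. l \<le> t \<and> f l = 0}"
  have ne: "?Z t \<noteq> {}"
  proof
    assume "?Z t = {}"
    then show False using Suc(2) by (simp only: card.empty)
  qed
  define x where "x = Max (?Z t)"
  have xZ: "x \<in> ?Z t" unfolding x_def by (rule Max_in[OF fin ne])
  then have xt: "x < t" "f x = 0" using Suc(3) by (auto simp: less_le)
  have xmax: "l \<le> x" if "l \<le> t" "f l = 0" for l unfolding x_def by (rule Max_ge[OF fin]) (use that in simp)
  have "\<exists>e>0. (\<forall>m. m \<noteq> x \<longrightarrow> \<bar>m - x\<bar> < e \<longrightarrow> f m \<noteq> 0) \<and>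
    (\<forall>m m'. \<bar>m - x\<bar> < e \<longrightarrow> \<bar>m' - x\<bar> < e \<longrightarrow> m < x \<longrightarrow> x < m' \<longrightarrow> (if simple x then f m * f m' < 0 else 0 < f m * f m'))"
  proof (cases "simple x")
    case True
    obtain e \<sigma> where e: "e > 0" "\<And>m. m \<noteq> x \<Longrightarrow> \<bar>m - x\<bar> < e \<Longrightarrow> 0 < \<sigma> * ((m - x) * f m)" using cross[OF xt(2) True] by blast
    have "f m * f m' < 0" if "\<bar>m - x\<bar> < e" "\<bar>m' - x\<bar> < e" "m < x" "x < m'" for m m'
    proof -
      have "0 < \<sigma> * ((m - x) * f m)" "0 < \<sigma> * ((m' - x) * f m')" using e(2) that by auto
      then show ?thesis using that(3,4) by (auto simp: zero_less_mult_iff mult_less_0_iff)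
    qed
    moreover have "f m \<noteq> 0" if "m \<noteq> x" "\<bar>m - x\<bar> < e" for m using e(2)[OF that] by auto
    ultimately show ?thesis using e(1) True by auto
  next
    case False
    obtain e where e: "e > 0" "\<And>m. m \<noteq> x \<Longrightarrow> \<bar>m - x\<bar> < e \<Longrightarrow> f m < 0" using touch[OF xt(2) False] by blast
    have "0 < f m * f m'" if "\<bar>m - x\<bar> < e" "\<bar>m' - x\<bar> < e" "m < x" "x < m'" for m m'
      using e(2)[of m] e(2)[of m'] that by (auto simp: zero_less_mult_iff)
    moreover have "f m \<noteq> 0" if "m \<noteq> x" "\<bar>m - x\<bar> < e" for m using e(2)[OF that] by auto
    ultimately show ?thesis using e(1) False by auto
  qed
  then obtain e where e: "e > 0" "\<And>m. m \<noteq> x \<Longrightarrow> \<bar>m - x\<bar> < e \<Longrightarrow> f m \<noteq> 0"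
    "\<And>m m'. \<bar>m - x\<bar> < e \<Longrightarrow> \<bar>m' - x\<bar> < e \<Longrightarrow> m < x \<Longrightarrow> x < m' \<Longrightarrow> (if simple x then f m * f m' < 0 else 0 < f m * f m')" by blast
  define m where "m = x - e / 2"
  \<comment> \<open>The cap at \<open>t\<close> keeps the segment from \<open>m'\<close> to
    \<open>t\<close> free of zeros and nonempty.\<close>
  define m' where "m' = min t (x + e / 2)"
  have mm: "\<bar>m - x\<bar> < e" "\<bar>m' - x\<bar> < e" "m < x" "x < m'" "m' \<le> t" using e(1) xt by (auto simp: m_def m'_def)
  have "0 < f m' * f t" by (rule same_sign_no_zero[OF c mm(5)]) (use xmax mm(4) in force)
  have Zm: "?Z m = ?Z t - {x}"
  proof (intro set_eqI iffI)
    fix l assume l: "l \<in> ?Z t - {x}"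
    then have "l < x" using xmax[of l] by auto
    moreover have "\<not> \<bar>l - x\<bar> < e" using e(2)[of l] l by auto
    ultimately show "l \<in> ?Z m" using l e(1) by (auto simp: m_def)
  next
    fix l assume "l \<in> ?Z m" then show "l \<in> ?Z t - {x}" using mm(3) xt by auto
  qed
  have "n = card (?Z m)" unfolding Zm using Suc(2) xZ fin[of t] by simp
  moreover have fm: "f m \<noteq> 0" using e(2)[of m] mm by auto
  ultimately have IH: "0 < \<beta> * f m * (-1) ^ card {l. l < m \<and> f l = 0 \<and> simple l}" by (rule Suc(1))
  have below: "{l. l < m \<and> f l = 0 \<and> simple l} = {l. l < t \<and> f l = 0 \<and> simple l} - {x}"
  proof -
    have "{l. l < m \<and> f l = 0 \<and> simple l} = {l \<in> ?Z m. simple l}" using fm by (auto simp: less_le)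
    also have "\<dots> = {l \<in> ?Z t. simple l} - {x}" unfolding Zm by auto
    also have "{l \<in> ?Z t. simple l} = {l. l < t \<and> f l = 0 \<and> simple l}" using Suc(3) by (auto simp: less_le)
    finally show ?thesis .
  qed
  have fint: "finite {l. l < t \<and> f l = 0 \<and> simple l}" by (rule finite_subset[OF _ fin[of t]]) auto
  show ?case
  proof (cases "simple x")
    case True
    then have "card {l. l < t \<and> f l = 0 \<and> simple l} = Suc (card {l. l < m \<and> f l = 0 \<and> simple l})"
      unfolding below using xt fint by (intro card.remove) auto
    moreover have "f m * f m' < 0" using e(3)[OF mm(1-4)] True by simp
    ultimately show ?thesis using IH \<open>0 < f m' * f t\<close> by (auto simp: zero_less_mult_iff mult_less_0_iff)
  next
    case False
    then have "card {l. l < t \<and> f l = 0 \<and> simple l} = card {l. l < m \<and> f l = 0 \<and> simple l}"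
      unfolding below by simp
    moreover have "0 < f m * f m'" using e(3)[OF mm(1-4)] False by simp
    ultimately show ?thesis using IH \<open>0 < f m' * f t\<close> by (auto simp: zero_less_mult_iff mult_less_0_iff)
  qed
qed

section \<open>Parity of the number of simple eigenvalues below a double one\<close>

context sturm_liouville
begin

text \<open>Immediately below a double eigenvalue \<open>disc \<beta> - 2\<close> is negative, while
  its sign at very negative parameters is that of \<beta>; the simple eigenvalues account for the
  sign changes between the two.\<close>

lemma double_parity:
  assumes \<beta>: "\<beta> \<noteq> 0" and fd: "full_degenerate \<beta> \<mu>"
  shows "even (card {l. l < \<mu> \<and> disc \<beta> l = 2 \<and> \<not> full_degenerate \<beta> l}) \<longleftrightarrow> \<beta> < 0"
proof -
  let ?f = "\<lambda>l. disc \<beta> l - 2"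
  let ?S = "\<lambda>t. {l. l < t \<and> ?f l = 0 \<and> \<not> full_degenerate \<beta> l}"
  obtain R where R: "R > 0" "\<And>l x. l < - R \<Longrightarrow> x \<in> {0..1} \<Longrightarrow> q x + l * P x < 0" by (rule very_negative) blast
  obtain e where e: "e > 0" "\<And>m. m \<noteq> \<mu> \<Longrightarrow> \<bar>m - \<mu>\<bar> < e \<Longrightarrow> disc \<beta> m < 2" by (rule disc_double_touch[OF \<beta> fd]) blast
  define t where "t = \<mu> - e / 2"
  have ft: "?f t < 0" using e(2)[of t] e(1) by (simp add: t_def)
  have "0 < \<beta> * ?f t * (-1) ^ card (?S t)"
  proof (rule sign_change_parity[where R = R and simple = "\<lambda>l. \<not> full_degenerate \<beta> l"])
    show "continuous_on UNIV ?f" by (intro continuous_intros disc_continuous \<beta>)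
    show "finite {l. l \<le> t \<and> ?f l = 0}" for t using disc_finite_below[OF \<beta>, of t] by simp
    show "\<exists>e>0. \<exists>\<sigma>. \<forall>m. m \<noteq> l \<longrightarrow> \<bar>m - l\<bar> < e \<longrightarrow> 0 < \<sigma> * ((m - l) * ?f m)" if "?f l = 0" "\<not> full_degenerate \<beta> l" for l
      using that by - (rule disc_simple_crossing[OF \<beta>, of l], auto)
    show "\<exists>e>0. \<forall>m. m \<noteq> l \<longrightarrow> \<bar>m - l\<bar> < e \<longrightarrow> ?f m < 0" if "?f l = 0" "\<not> \<not> full_degenerate \<beta> l" for l
      using that by - (rule disc_double_touch[OF \<beta>, of l], auto)
    show "0 < \<beta> * ?f l" if "l < - R" for l by (rule disc_negative_sign[OF R(2)[OF that] \<beta>])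
  qed (use ft in simp)
  moreover have "?S t = {l. l < \<mu> \<and> disc \<beta> l = 2 \<and> \<not> full_degenerate \<beta> l}"
  proof (intro set_eqI iffI)
    fix l assume "l \<in> ?S t" then show "l \<in> {l. l < \<mu> \<and> disc \<beta> l = 2 \<and> \<not> full_degenerate \<beta> l}" using e(1) by (simp add: t_def)
  next
    fix l assume l: "l \<in> {l. l < \<mu> \<and> disc \<beta> l = 2 \<and> \<not> full_degenerate \<beta> l}"
    then have "\<not> \<bar>l - \<mu>\<bar> < e" using e(2)[of l] by auto
    then show "l \<in> ?S t" using l e(1) by (auto simp: t_def)
  qed
  ultimately have "0 < \<beta> * ?f t * (-1) ^ card {l. l < \<mu> \<and> disc \<beta> l = 2 \<and> \<not> full_degenerate \<beta> l}" by simp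
  moreover have "0 < \<beta> * ?f t \<longleftrightarrow> \<beta> < 0" using ft by (auto simp: zero_less_mult_iff)
  moreover have "\<beta> * ?f t < 0 \<longleftrightarrow> \<not> \<beta> < 0" using ft \<beta> by (auto simp: mult_less_0_iff)
  ultimately show ?thesis by (cases "even (card {l. l < \<mu> \<and> disc \<beta> l = 2 \<and> \<not> full_degenerate \<beta> l})") simp_all
qed

end

text \<open>The sequence is the generalised inverse of the counting function \<open>cnt\<close>:
  \<open>lam k\<close> is the least element of \<open>E\<close> up to which at least
  \<open>k\<close> elements are counted with multiplicity. The value at index 0 is the least element
  of \<open>E\<close> and stays outside the counted indices.\<close>

lemma listing_exists:
  fixes E :: "real set" and d :: "real \<Rightarrow> nat"
  assumes d: "\<And>l. l \<in> E \<Longrightarrow> 1 \<le> d l" and fin: "\<And>t. finite {l\<in>E. l \<le> t}" and unb: "\<And>R. \<exists>l\<in>E. R < l"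
  obtains lam :: "nat \<Rightarrow> real" where "\<And>k. lam k \<le> lam (Suc k)" "\<And>k. lam k \<in> E"
    "\<And>l. l \<in> E \<Longrightarrow> finite {k. 1 \<le> k \<and> lam k = l} \<and> card {k. 1 \<le> k \<and> lam k = l} = d l"
proof -
  define cnt where "cnt t = (\<Sum>l\<in>{l\<in>E. l \<le> t}. d l)" for t
  have unbc: "\<exists>t\<in>E. k \<le> cnt t" for k
  proof (induction k)
    case 0 then show ?case using unb[of 0] by auto
  next
    case (Suc k)
    then obtain t where t: "t \<in> E" "k \<le> cnt t" by blast
    obtain u where u: "u \<in> E" "t < u" using unb by blast
    have "cnt t + d u = (\<Sum>l\<in>insert u {l\<in>E. l \<le> t}. d l)"
      unfolding cnt_def using u fin[of t] by (subst sum.insert) auto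
    also have "\<dots> \<le> cnt u" unfolding cnt_def by (rule sum_mono2[OF fin]) (use u in auto)
    finally show ?case using d[OF u(1)] t(2) u(1) by (intro bexI[of _ u]) auto
  qed
  have "\<exists>t\<in>E. k \<le> cnt t \<and> (\<forall>s\<in>E. s < t \<longrightarrow> cnt s < k)" for k
  proof -
    obtain t0 where t0: "t0 \<in> E" "k \<le> cnt t0" using unbc by blast
    let ?A = "{t\<in>E. t \<le> t0 \<and> k \<le> cnt t}"
    have fA: "finite ?A" by (rule finite_subset[OF _ fin[of t0]]) auto
    have "Min ?A \<in> ?A" by (rule Min_in[OF fA]) (use t0 in auto)
    moreover have "cnt s < k" if "s \<in> E" "s < Min ?A" for s
    proof (rule ccontr)
      assume "\<not> cnt s < k"
      then have "s \<in> ?A" using that \<open>Min ?A \<in> ?A\<close> by auto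
      then show False using Min_le[OF fA, of s] that(2) by simp
    qed
    ultimately show ?thesis by blast
  qed
  then obtain lam where lam: "\<And>k. lam k \<in> E" "\<And>k. k \<le> cnt (lam k)" "\<And>k s. s \<in> E \<Longrightarrow> s < lam k \<Longrightarrow> cnt s < k" by metis
  show ?thesis
  proof (rule that[OF _ lam(1)])
    show "lam k \<le> lam (Suc k)" for k
    proof (rule ccontr)
      assume "\<not> lam k \<le> lam (Suc k)"
      then have "cnt (lam (Suc k)) < k" using lam(1,3) by auto
      then show False using lam(2)[of "Suc k"] by simp
    qed
    fix l assume l: "l \<in> E"
    define c0 where "c0 = (\<Sum>l\<in>{s\<in>E. s < l}. d l)"
    have f0: "finite {s\<in>E. s < l}" by (rule finite_subset[OF _ fin[of l]]) auto
    have cl: "cnt l = c0 + d l"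
    proof -
      have "{s\<in>E. s \<le> l} = insert l {s\<in>E. s < l}" using l by auto
      then show ?thesis unfolding cnt_def c0_def using f0 by simp
    qed
    \<comment> \<open>With \<open>c0\<close> elements counted strictly below \<open>l\<close>, the
      value \<open>l\<close> occupies precisely the next \<open>d l\<close> indices.\<close>
    have "{k. 1 \<le> k \<and> lam k = l} = {c0<..c0 + d l}"
    proof (intro set_eqI iffI)
      fix k assume "k \<in> {k. 1 \<le> k \<and> lam k = l}"
      then have k: "1 \<le> k" "lam k = l" by auto
      have "c0 < k"
      proof (cases "{s\<in>E. s < l} = {}")
        case True then show ?thesis using k(1) unfolding c0_def True by simp
      next
        case False
        define s where "s = Max {s\<in>E. s < l}"
        have s: "s \<in> {s\<in>E. s < l}" unfolding s_def by (rule Max_in[OF f0 False])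
        have "{t\<in>E. t < l} = {t\<in>E. t \<le> s}"
          using s Max_ge[OF f0] unfolding s_def[symmetric] by auto
        then have "c0 = cnt s" by (simp add: c0_def cnt_def)
        then show ?thesis using lam(3)[of s k] s k(2) by simp
      qed
      then show "k \<in> {c0<..c0 + d l}" using lam(2)[of k] k(2) cl by simp
    next
      fix k assume k: "k \<in> {c0<..c0 + d l}"
      have "lam k = l"
      proof (rule antisym)
        show "lam k \<le> l" using lam(3)[OF l, of k] k cl by force
        show "l \<le> lam k"
        proof (rule ccontr)
          assume "\<not> l \<le> lam k"
          then have "cnt (lam k) \<le> c0" unfolding cnt_def c0_def by (intro sum_mono2[OF f0]) auto
          then show False using lam(2)[of k] k by simp
        qed
      qed
      then show "k \<in> {k. 1 \<le> k \<and> lam k = l}" using k by auto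
    qed
    then show "finite {k. 1 \<le> k \<and> lam k = l} \<and> card {k. 1 \<le> k \<and> lam k = l} = d l" by simp
  qed
qed

text \<open>A tie at \<open>k\<close> exhausts the block of a double value, so the smaller values
  occupy exactly the indices from 1 to \<open>k - 1\<close>. Thus \<open>k - 1\<close> is the sum of
  their multiplicities, in which the double ones cancel modulo 2.\<close>

lemma listing_tie_parity:
  fixes lam :: "nat \<Rightarrow> real" and E :: "real set" and d :: "real \<Rightarrow> nat"
  assumes mono: "\<And>k. 1 \<le> k \<Longrightarrow> lam k \<le> lam (Suc k)"
    and fin: "\<And>l. finite {k. 1 \<le> k \<and> lam k = l}"
    and card: "\<And>l. card {k. 1 \<le> k \<and> lam k = l} = (if l \<in> E then d l else 0)"
    and d: "\<And>l. l \<in> E \<Longrightarrow> d l = 1 \<or> d l = 2"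
    and k: "1 \<le> k" and tie: "lam k = lam (Suc k)"
  shows "lam k \<in> E" "d (lam k) = 2" "even (card {l\<in>E. l < lam k \<and> d l = 1}) \<longleftrightarrow> odd k"
proof -
  let ?K = "\<lambda>l. {k. 1 \<le> k \<and> lam k = l}"
  have mono': "lam i \<le> lam j" if "1 \<le> i" "i \<le> j" for i j
    using that(2)
  proof (induction j rule: dec_induct)
    case (step n)
    show ?case by (rule order_trans[OF step.IH mono]) (use step.hyps that(1) in simp)
  qed simp
  define \<mu> where "\<mu> = lam k"
  have sub: "{k, Suc k} \<subseteq> ?K \<mu>" using k tie by (auto simp: \<mu>_def)
  have c2: "2 \<le> card (?K \<mu>)" using card_mono[OF fin sub] by simp
  then show E: "lam k \<in> E" using card[of \<mu>] unfolding \<mu>_def by (auto split: if_splits)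
  show d2: "d (lam k) = 2" using c2 card[of \<mu>] d[OF E] E by (auto simp: \<mu>_def)
  have K\<mu>: "?K \<mu> = {k, Suc k}"
    by (rule card_seteq[OF fin sub, symmetric]) (use card[of \<mu>] E d2 in \<open>simp add: \<mu>_def\<close>)
  have lt: "{i. 1 \<le> i \<and> lam i < \<mu>} = {1..<k}"
  proof (intro set_eqI iffI)
    fix i assume "i \<in> {i. 1 \<le> i \<and> lam i < \<mu>}"
    then show "i \<in> {1..<k}" using mono'[of k i] k by (force simp: \<mu>_def not_less)
  next
    fix i assume i: "i \<in> {1..<k}"
    then have "lam i \<le> \<mu>" using mono'[of i k] by (simp add: \<mu>_def)
    moreover have "i \<notin> ?K \<mu>" unfolding K\<mu> using i by auto
    ultimately show "i \<in> {i. 1 \<le> i \<and> lam i < \<mu>}" using i by auto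
  qed
  let ?B = "{l\<in>E. l < \<mu>}"
  have surj: "?B = lam ` {1..<k}"
  proof (intro set_eqI iffI)
    fix l assume l: "l \<in> ?B"
    then have "card (?K l) \<noteq> 0" using card[of l] d[of l] by auto
    then have "?K l \<noteq> {}" by (metis card.empty)
    then obtain i where i: "1 \<le> i" "lam i = l" by blast
    then have "i \<in> {i. 1 \<le> i \<and> lam i < \<mu>}" using l by simp
    then have "i \<in> {1..<k}" unfolding lt .
    then show "l \<in> lam ` {1..<k}" using i(2) by blast
  next
    fix l assume "l \<in> lam ` {1..<k}"
    then obtain i where i: "i \<in> {1..<k}" "l = lam i" by blast
    then have "i \<in> {i. 1 \<le> i \<and> lam i < \<mu>}" unfolding lt by blast
    then have i': "1 \<le> i" "lam i < \<mu>" by simp_all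
    have "lam i \<in> E"
    proof (rule ccontr)
      assume "lam i \<notin> E"
      then have "card (?K (lam i)) = 0" using card[of "lam i"] by simp
      then have "?K (lam i) = {}" using fin[of "lam i"] by (simp only: card_0_eq)
      then show False using i'(1) by blast
    qed
    then show "l \<in> ?B" using i(2) i'(2) by simp
  qed
  then have fB: "finite ?B" by simp
  have "k - 1 = card {1..<k}" by simp
  also have "{1..<k} = (\<Union>l\<in>?B. ?K l)"
  proof (intro set_eqI iffI)
    fix i assume i: "i \<in> {1..<k}"
    then have "lam i \<in> ?B" unfolding surj by (rule imageI)
    then show "i \<in> (\<Union>l\<in>?B. ?K l)" using i by auto
  next
    fix i assume "i \<in> (\<Union>l\<in>?B. ?K l)"
    then have "i \<in> {i. 1 \<le> i \<and> lam i < \<mu>}" by auto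
    then show "i \<in> {1..<k}" unfolding lt .
  qed
  also have "card \<dots> = (\<Sum>l\<in>?B. card (?K l))"
    by (rule card_UN_disjoint) (use fB fin in auto)
  also have "\<dots> = (\<Sum>l\<in>?B. d l)" by (rule sum.cong) (use card in auto)
  finally have k1: "k - 1 = (\<Sum>l\<in>?B. d l)" .
  have "even (\<Sum>l\<in>?B. d l) \<longleftrightarrow> even (card {l\<in>?B. odd (d l)})" by (rule even_sum_iff[OF fB])
  moreover have "{l\<in>?B. odd (d l)} = {l\<in>E. l < \<mu> \<and> d l = 1}" by (auto dest: d)
  ultimately have "even (k - 1) \<longleftrightarrow> even (card {l\<in>E. l < \<mu> \<and> d l = 1})" using k1 by simp
  then show "even (card {l\<in>E. l < lam k \<and> d l = 1}) \<longleftrightarrow> odd k" using k by (auto simp: \<mu>_def even_diff_nat)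
qed

lemma (in self_adjoint_bc) multiplicity_unique:
  assumes "multiplicity_h L v \<mu> n" "multiplicity_h L v \<mu> m" shows "n = m"
proof -
  have down: "eigdim_ge L v \<mu> (j + i) \<Longrightarrow> eigdim_ge L v \<mu> j" for i j
  proof (induction i)
    case (Suc i)
    then have "eigdim_ge L v \<mu> (j + i)" by (intro eigdim_mono[of \<mu> "j + i"]) simp
    then show ?case by (rule Suc.IH)
  qed simp
  have "\<not> a < b" if "multiplicity_h L v \<mu> a" "multiplicity_h L v \<mu> b" for a b
  proof
    assume "a < b"
    then obtain i where "b = Suc a + i" using less_iff_Suc_add by auto
    then show False using that down[of "Suc a" i] unfolding multiplicity_h_def by simp
  qed
  from this[OF assms] this[OF assms(2,1)] show ?thesis by simp
qed

section \<open>The coupled boundary condition\<close>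

locale robin_bc = singular_schroedinger +
  fixes \<alpha> :: real assumes \<alpha>: "\<alpha> \<noteq> 0"
begin

definition "\<beta> = \<alpha> * exp (- h 1)"

lemma \<beta>: "\<beta> \<noteq> 0" "0 < \<beta> \<longleftrightarrow> 0 < \<alpha>" "\<beta> < 0 \<longleftrightarrow> \<alpha> < 0"
  using \<alpha> unfolding \<beta>_def by (simp_all add: zero_less_mult_iff mult_less_0_iff)

sublocale self_adjoint_bc v h q \<gamma> "robin_L \<alpha>" 1 0 "- complex_of_real \<beta>" 0 0 "- complex_of_real \<beta>" 0 1
proof
  show "(0, 0) \<in> robin_L \<alpha>" by (simp add: robin_L_def)
  show "bc (robin_L \<alpha>) y0 s0 y1 s1 \<longleftrightarrow> 1 * y0 + 0 * s0 + - complex_of_real \<beta> * y1 + 0 * s1 = 0 \<and> 0 * y0 + - complex_of_real \<beta> * s0 + 0 * y1 + 1 * s1 = 0" for y0 s0 y1 s1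
  proof -
    have "1 * y0 + 0 * s0 + - complex_of_real \<beta> * y1 + 0 * s1 = y0 - complex_of_real \<beta> * y1"
      "0 * y0 + - complex_of_real \<beta> * s0 + 0 * y1 + 1 * s1 = s1 - complex_of_real \<beta> * s0" by simp_all
    then show ?thesis unfolding bc_robin[OF \<alpha>] \<beta>_def[symmetric] by simp
  qed
qed

lemma in_kernel_robin:
  "in_kernel (complex_of_real l) p r \<longleftrightarrow> complex_of_real (1 - \<beta> * ry1 l 1) * p - complex_of_real (\<beta> * ry2 l 1) * r = 0 \<and>
     complex_of_real (rs1 l 1) * p + complex_of_real (rs2 l 1 - \<beta>) * r = 0"
  unfolding in_kernel_linear by (simp add: fund_of_real algebra_simps)

text \<open>The determinant of the two kernel equations is
  \<open>\<beta> * (disc \<beta> l - 2)\<close>, because the monodromy matrix has determinant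
  1.\<close>

lemma eigenvalue_robin: "is_eigenvalue (robin_L \<alpha>) v \<mu> \<longleftrightarrow> (\<exists>l. \<mu> = complex_of_real (l + \<gamma>) \<and> disc \<beta> l = 2)"
proof -
  have key: "(\<exists>p r. in_kernel (complex_of_real l) p r \<and> \<not> (p = 0 \<and> r = 0)) \<longleftrightarrow> disc \<beta> l = 2" for l
  proof -
    define a b c d where "a = ry1 l 1" and "b = ry2 l 1" and "c = rs1 l 1" and "d = rs2 l 1"
    note defs = a_def b_def c_def d_def
    have det: "a * d - b * c = 1" using real_det[of 1 l] by (simp add: defs)
    have dt: "(1 - \<beta> * a) * (d - \<beta>) + \<beta> * b * c = \<beta> * (disc \<beta> l - 2)"
    proof -
      have "(1 - \<beta> * a) * (d - \<beta>) + \<beta> * b * c = d + \<beta> * \<beta> * a - \<beta> - \<beta> * (a * d - b * c)" by (simp add: algebra_simps)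
      also have "\<dots> = \<beta> * (disc \<beta> l - 2)" unfolding det using \<beta>(1) by (simp add: disc_def defs algebra_simps)
      finally show ?thesis .
    qed
    show ?thesis
    proof
      assume "\<exists>p r. in_kernel (complex_of_real l) p r \<and> \<not> (p = 0 \<and> r = 0)"
      then obtain p r where pr: "complex_of_real (1 - \<beta> * a) * p - complex_of_real (\<beta> * b) * r = 0"
        "complex_of_real c * p + complex_of_real (d - \<beta>) * r = 0" "\<not> (p = 0 \<and> r = 0)" unfolding in_kernel_robin defs by blast
      define D where "D = complex_of_real ((1 - \<beta> * a) * (d - \<beta>) + \<beta> * b * c)"
      have "D * p = complex_of_real (d - \<beta>) * (complex_of_real (1 - \<beta> * a) * p - complex_of_real (\<beta> * b) * r) + complex_of_real (\<beta> * b) * (complex_of_real c * p + complex_of_real (d - \<beta>) * r)"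
        by (simp add: D_def algebra_simps)
      then have "D * p = 0" using pr by simp
      moreover have "D * r = complex_of_real (1 - \<beta> * a) * (complex_of_real c * p + complex_of_real (d - \<beta>) * r) - complex_of_real c * (complex_of_real (1 - \<beta> * a) * p - complex_of_real (\<beta> * b) * r)"
        by (simp add: D_def algebra_simps)
      then have "D * r = 0" using pr by simp
      ultimately have "D = 0" using pr(3) by auto
      then have "(1 - \<beta> * a) * (d - \<beta>) + \<beta> * b * c = 0" unfolding D_def of_real_eq_0_iff .
      then show "disc \<beta> l = 2" using dt \<beta>(1) by simp
    next
      assume 2: "disc \<beta> l = 2"
      then have z: "(1 - \<beta> * a) * (d - \<beta>) + \<beta> * b * c = 0" using dt by simp
      show "\<exists>p r. in_kernel (complex_of_real l) p r \<and> \<not> (p = 0 \<and> r = 0)"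
      proof (cases "b = 0 \<and> 1 - \<beta> * a = 0")
        case True
        have "\<beta> * a + d / \<beta> = 2" using 2 by (simp add: disc_def defs)
        moreover have "\<beta> * a = 1" using True by simp
        ultimately have "d / \<beta> = 1" by linarith
        then have "d - \<beta> = 0" using \<beta>(1) by simp
        then show ?thesis using True unfolding in_kernel_robin defs by (intro exI[of _ 0] exI[of _ 1]) simp
      next
        case False
        show ?thesis
        proof (intro exI conjI)
          have z': "complex_of_real (c * (\<beta> * b) + (d - \<beta>) * (1 - \<beta> * a)) = 0" using z by (simp only: of_real_eq_0_iff) (simp add: algebra_simps)
          show "in_kernel (complex_of_real l) (complex_of_real (\<beta> * b)) (complex_of_real (1 - \<beta> * a))"
            unfolding in_kernel_robin defs[symmetric] using z' unfolding of_real_mult of_real_add by simp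
          show "\<not> (complex_of_real (\<beta> * b) = 0 \<and> complex_of_real (1 - \<beta> * a) = 0)"
            using False \<beta>(1) unfolding of_real_eq_0_iff by simp
        qed
      qed
    qed
  qed
  show ?thesis
  proof
    assume e: "is_eigenvalue (robin_L \<alpha>) v \<mu>"
    obtain m where m: "\<mu> = complex_of_real m" using eigenvalue_real[OF e] by (auto elim: Reals_cases)
    then have "sh \<mu> = complex_of_real (m - \<gamma>)" by simp
    then have "disc \<beta> (m - \<gamma>) = 2" using e key[of "m - \<gamma>"] unfolding eigenvalue_iff by metis
    then show "\<exists>l. \<mu> = complex_of_real (l + \<gamma>) \<and> disc \<beta> l = 2" using m by (intro exI[of _ "m - \<gamma>"]) simp
  next
    assume "\<exists>l. \<mu> = complex_of_real (l + \<gamma>) \<and> disc \<beta> l = 2"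
    then obtain l where l: "\<mu> = complex_of_real (l + \<gamma>)" "disc \<beta> l = 2" by blast
    then have "sh \<mu> = complex_of_real l" by simp
    then show "is_eigenvalue (robin_L \<alpha>) v \<mu>" using key[of l] l(2) unfolding eigenvalue_iff by metis
  qed
qed

text \<open>Two independent initial values span \<open>C^2\<close>, so both kernel equations hold
  identically and all their coefficients vanish; this is \<open>full_degenerate\<close>.\<close>

lemma eigdim_2_robin: "eigdim_ge (robin_L \<alpha>) v (complex_of_real (l + \<gamma>)) 2 \<longleftrightarrow> full_degenerate \<beta> l"
proof -
  have sh: "sh (complex_of_real (l + \<gamma>)) = complex_of_real l" by simp
  have fd: "full_degenerate \<beta> l \<longleftrightarrow> in_kernel (complex_of_real l) 1 0 \<and> in_kernel (complex_of_real l) 0 1"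
    unfolding in_kernel_robin full_degenerate_def using \<beta>(1) by (auto simp flip: of_real_mult)
  show ?thesis
  proof
    assume "eigdim_ge (robin_L \<alpha>) v (complex_of_real (l + \<gamma>)) 2"
    then obtain p r p' r' where k: "in_kernel (complex_of_real l) p r" "in_kernel (complex_of_real l) p' r'" "p * r' - p' * r \<noteq> 0"
      unfolding sh[symmetric] by (rule eigdim_2D)
    have z: "m = 0 \<and> n = 0" if "m * p + n * r = 0" "m * p' + n * r' = 0" for m n
    proof -
      have "m * (p * r' - p' * r) = (m * p + n * r) * r' - (m * p' + n * r') * r" by (simp add: algebra_simps)
      moreover have "n * (p * r' - p' * r) = (m * p' + n * r') * p - (m * p + n * r) * p'" by (simp add: algebra_simps)
      ultimately show ?thesis using that k(3) by simp
    qed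
    have "complex_of_real (1 - \<beta> * ry1 l 1) = 0 \<and> - complex_of_real (\<beta> * ry2 l 1) = 0"
      by (rule z) (use k(1,2) in \<open>simp_all add: in_kernel_robin\<close>)
    moreover have "complex_of_real (rs1 l 1) = 0 \<and> complex_of_real (rs2 l 1 - \<beta>) = 0"
      by (rule z) (use k(1,2) in \<open>simp_all add: in_kernel_robin\<close>)
    ultimately have "1 - \<beta> * ry1 l 1 = 0" "\<beta> * ry2 l 1 = 0" "rs1 l 1 = 0" "rs2 l 1 - \<beta> = 0"
      unfolding of_real_eq_0_iff neg_equal_0_iff_equal by auto
    then show "full_degenerate \<beta> l" using \<beta>(1) by (simp add: full_degenerate_def)
  next
    assume "full_degenerate \<beta> l"
    then show "eigdim_ge (robin_L \<alpha>) v (complex_of_real (l + \<gamma>)) 2" using fd sh by (intro eigdim_2I) simp_all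
  qed
qed

definition mult :: "real \<Rightarrow> nat" where
  "mult \<mu> = (if full_degenerate \<beta> (\<mu> - \<gamma>) then 2 else 1)"

definition eigenvalues :: "real set" where "eigenvalues = {\<mu>. disc \<beta> (\<mu> - \<gamma>) = 2}"

lemma multiplicity_robin: "multiplicity_h (robin_L \<alpha>) v (complex_of_real \<mu>) (if \<mu> \<in> eigenvalues then mult \<mu> else 0)"
  "z \<notin> \<real> \<Longrightarrow> multiplicity_h (robin_L \<alpha>) v z 0"
proof -
  have e: "is_eigenvalue (robin_L \<alpha>) v (complex_of_real \<mu>) \<longleftrightarrow> \<mu> \<in> eigenvalues"
    unfolding eigenvalue_robin eigenvalues_def of_real_eq_iff by (auto intro: exI[of _ "\<mu> - \<gamma>"])
  have 2: "eigdim_ge (robin_L \<alpha>) v (complex_of_real \<mu>) 2 \<longleftrightarrow> full_degenerate \<beta> (\<mu> - \<gamma>)"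
    using eigdim_2_robin[of "\<mu> - \<gamma>"] by simp
  show "multiplicity_h (robin_L \<alpha>) v (complex_of_real \<mu>) (if \<mu> \<in> eigenvalues then mult \<mu> else 0)"
    unfolding multiplicity_h_def mult_def
    using e 2 eigdim_0 eigdim_1_iff[of "complex_of_real \<mu>"] eigdim_3[of "complex_of_real \<mu>"] by (auto simp: numeral_2_eq_2 numeral_3_eq_3)
  assume "z \<notin> \<real>"
  then have "\<not> is_eigenvalue (robin_L \<alpha>) v z" using eigenvalue_real by blast
  then show "multiplicity_h (robin_L \<alpha>) v z 0" using eigdim_0 eigdim_1_iff[of z] by (simp add: multiplicity_h_def)
qed

text \<open>It ensures that the assertion about all listings is not vacuous. The eigenvalues are
  finitely many below each bound and unbounded above, so they form an infinite sequence.\<close>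

lemma eigenvalues_listing: "\<exists>lam. eigenvalue_list (robin_L \<alpha>) v lam"
proof -
  have f: "finite {l \<in> eigenvalues. l \<le> t}" for t
  proof -
    have "{l \<in> eigenvalues. l \<le> t} \<subseteq> (\<lambda>l. l + \<gamma>) ` {l. l \<le> t - \<gamma> \<and> disc \<beta> l = 2}"
      by (force simp: eigenvalues_def intro!: image_eqI[of _ _ "_ - \<gamma>"])
    then show ?thesis using disc_finite_below[OF \<beta>(1)] finite_subset by blast
  qed
  have u: "\<exists>l\<in>eigenvalues. R < l" for R
  proof -
    obtain l where "l > R - \<gamma>" "disc \<beta> l = 2" using disc_infinitely_often_2[OF \<beta>(1), of "R - \<gamma>"] by blast
    then show ?thesis by (intro bexI[of _ "l + \<gamma>"]) (auto simp: eigenvalues_def)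
  qed
  obtain lam :: "nat \<Rightarrow> real" where lam: "\<And>k. lam k \<le> lam (Suc k)" "\<And>k. lam k \<in> eigenvalues"
    "\<And>l. l \<in> eigenvalues \<Longrightarrow> finite {k. 1 \<le> k \<and> lam k = l} \<and> card {k. 1 \<le> k \<and> lam k = l} = mult l"
    by (rule listing_exists[of eigenvalues mult]) (use f u in \<open>auto simp: mult_def\<close>)
  have "finite {k. k \<ge> 1 \<and> complex_of_real (lam k) = z} \<and>
        multiplicity_h (robin_L \<alpha>) v z (card {k. k \<ge> 1 \<and> complex_of_real (lam k) = z})" for z
  proof (cases "z \<in> \<real>")
    case False
    then have e: "{k. k \<ge> 1 \<and> complex_of_real (lam k) = z} = {}" by auto
    show ?thesis unfolding e using multiplicity_robin(2)[OF False] by simp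
  next
    case True
    then obtain l where l: "z = complex_of_real l" by (rule Reals_cases)
    have e: "{k. k \<ge> 1 \<and> complex_of_real (lam k) = z} = {k. k \<ge> 1 \<and> lam k = l}" by (simp add: l)
    show ?thesis
    proof (cases "l \<in> eigenvalues")
      case True then show ?thesis unfolding e using lam(3)[OF True] multiplicity_robin(1)[of l] l by simp
    next
      case False
      then have e0: "{k. k \<ge> 1 \<and> lam k = l} = {}" using lam(2) by auto
      show ?thesis unfolding e e0 using multiplicity_robin(1)[of l] l False by simp
    qed
  qed
  then show ?thesis unfolding eigenvalue_list_def using lam(1) by blast
qed

text \<open>Equality of \<open>lam j\<close> and \<open>lam (Suc j)\<close> occurs only at a double
  eigenvalue. The two parity statements together say that \<open>j\<close> is then odd for negative
  \<beta> and even for positive \<beta>; at indices of the other parity the inequality is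
  strict.\<close>

lemma eigenvalues_order:
  assumes l: "eigenvalue_list (robin_L \<alpha>) v lam" and k: "k \<ge> 1"
  shows "\<alpha> \<ge> 0 \<longrightarrow> lam (2*k - 1) < lam (2*k)" "\<alpha> \<le> 0 \<longrightarrow> lam (2*k) < lam (2*k + 1)"
proof -
  have mono: "\<And>k. 1 \<le> k \<Longrightarrow> lam k \<le> lam (Suc k)" using l by (simp add: eigenvalue_list_def)
  have m: "finite {k. k \<ge> 1 \<and> lam k = x}" "multiplicity_h (robin_L \<alpha>) v (complex_of_real x) (card {k. k \<ge> 1 \<and> lam k = x})" for x
  proof -
    have "finite {k. k \<ge> 1 \<and> complex_of_real (lam k) = complex_of_real x} \<and>
        multiplicity_h (robin_L \<alpha>) v (complex_of_real x) (card {k. k \<ge> 1 \<and> complex_of_real (lam k) = complex_of_real x})"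
      using l unfolding eigenvalue_list_def by blast
    then show "finite {k. k \<ge> 1 \<and> lam k = x}" "multiplicity_h (robin_L \<alpha>) v (complex_of_real x) (card {k. k \<ge> 1 \<and> lam k = x})" by simp_all
  qed
  have card: "card {k. 1 \<le> k \<and> lam k = x} = (if x \<in> eigenvalues then mult x else 0)" for x
    by (rule multiplicity_unique[OF m(2) multiplicity_robin(1)])
  have tie: "even (card {x\<in>eigenvalues. x < lam j \<and> mult x = 1}) \<longleftrightarrow> odd j" "full_degenerate \<beta> (lam j - \<gamma>)" if "1 \<le> j" "lam j = lam (Suc j)" for j
  proof -
    note t = listing_tie_parity[OF mono m(1) card _ that]
    show "even (card {x\<in>eigenvalues. x < lam j \<and> mult x = 1}) \<longleftrightarrow> odd j" by (rule t(3)) (auto simp: mult_def)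
    have "mult (lam j) = 2" by (rule t(2)) (auto simp: mult_def)
    then show "full_degenerate \<beta> (lam j - \<gamma>)" by (auto simp: mult_def split: if_splits)
  qed
  have par: "\<beta> < 0 \<longleftrightarrow> odd j" if j: "1 \<le> j" "lam j = lam (Suc j)" for j
  proof -
    have "{x\<in>eigenvalues. x < lam j \<and> mult x = 1} = (\<lambda>l. l + \<gamma>) ` {l. l < lam j - \<gamma> \<and> disc \<beta> l = 2 \<and> \<not> full_degenerate \<beta> l}"
    proof (intro set_eqI iffI)
      fix x assume "x \<in> {x\<in>eigenvalues. x < lam j \<and> mult x = 1}"
      then show "x \<in> (\<lambda>l. l + \<gamma>) ` {l. l < lam j - \<gamma> \<and> disc \<beta> l = 2 \<and> \<not> full_degenerate \<beta> l}"
        by (intro image_eqI[of _ _ "x - \<gamma>"]) (auto simp: eigenvalues_def mult_def split: if_splits)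
    next
      fix x assume "x \<in> (\<lambda>l. l + \<gamma>) ` {l. l < lam j - \<gamma> \<and> disc \<beta> l = 2 \<and> \<not> full_degenerate \<beta> l}"
      then show "x \<in> {x\<in>eigenvalues. x < lam j \<and> mult x = 1}" by (auto simp: eigenvalues_def mult_def)
    qed
    then have "card {x\<in>eigenvalues. x < lam j \<and> mult x = 1} = card {l. l < lam j - \<gamma> \<and> disc \<beta> l = 2 \<and> \<not> full_degenerate \<beta> l}"
      by (simp add: card_image)
    then show ?thesis using tie[OF j] double_parity[OF \<beta>(1) tie(2)[OF j]] by simp
  qed
  show "\<alpha> \<ge> 0 \<longrightarrow> lam (2*k - 1) < lam (2*k)"
  proof
    assume "\<alpha> \<ge> 0"
    then have "\<not> \<beta> < 0" using \<beta>(3) by simp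
    moreover have s: "Suc (2*k - 1) = 2*k" using k by simp
    moreover have "1 \<le> 2*k - 1" "odd (2*k - 1)" using k by auto
    ultimately have "lam (2*k - 1) \<noteq> lam (2*k)" using par[of "2*k - 1"] unfolding s by blast
    moreover have "lam (2*k - 1) \<le> lam (2*k)" using mono[OF \<open>1 \<le> 2*k - 1\<close>] unfolding s .
    ultimately show "lam (2*k - 1) < lam (2*k)" by simp
  qed
  show "\<alpha> \<le> 0 \<longrightarrow> lam (2*k) < lam (2*k + 1)"
  proof
    assume "\<alpha> \<le> 0"
    then have "\<beta> < 0" using \<beta>(3) \<alpha> by simp
    then have "lam (2*k) \<noteq> lam (Suc (2*k))" using par[of "2*k"] k by auto
    then show "lam (2*k) < lam (2*k + 1)" using mono[of "2*k"] k by simp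
  qed
qed

end

section \<open>The separated boundary conditions and the conclusion\<close>

context singular_schroedinger
begin

text \<open>Each separated condition fixes \<open>y 0 = 0\<close> or \<open>s 0 = 0\<close>. Hence
  all admissible initial values lie on one line, which is what \<open>par\<close> expresses, and
  kernels have dimension at most 1.\<close>

lemma separated_case:
  assumes "self_adjoint_bc v h q \<gamma> L a1 a2 a3 a4 b1 b2 b3 b4"
    and par: "\<And>p r p' r' y1 s1 y1' s1'. bc L p r y1 s1 \<Longrightarrow> bc L p' r' y1' s1' \<Longrightarrow> p * r' - p' * r = 0"
  shows "discrete_spectrum L v \<and> eigenfunctions_ae_nonvanishing L v \<and>
            (\<forall>\<mu>. is_eigenvalue L v \<mu> \<longrightarrow> multiplicity_h L v \<mu> 1)"
proof -
  interpret B: self_adjoint_bc v h q \<gamma> L a1 a2 a3 a4 b1 b2 b3 b4 by fact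
  have "p * r' - p' * r = 0" if "B.in_kernel \<Lambda> p r" "B.in_kernel \<Lambda> p' r'" for \<Lambda> p r p' r'
    using that unfolding B.in_kernel_def by (rule par)
  then show ?thesis using B.discrete B.nonvanishing B.simple_if_parallel by blast
qed

lemma separated_boundary_conditions:
  assumes "L \<in> {{0} \<times> UNIV, UNIV \<times> {0}, {(0, 0)}, UNIV}"
  shows "discrete_spectrum L v \<and> eigenfunctions_ae_nonvanishing L v \<and>
            (\<forall>\<mu>. is_eigenvalue L v \<mu> \<longrightarrow> multiplicity_h L v \<mu> 1)"
proof -
  note ax = self_adjoint_bc.intro[OF singular_schroedinger_axioms self_adjoint_bc_axioms.intro]
  consider "L = {0} \<times> UNIV" | "L = UNIV \<times> {0}" | "L = {(0, 0)}" | "L = UNIV" using assms by blast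
  then show ?thesis
  proof cases
    case 1
    \<comment> \<open>Each of the two equations lists its coefficients in the order
      \<open>y 0\<close>, \<open>s 0\<close>, \<open>y 1\<close>, \<open>s 1\<close>.\<close>
    have "self_adjoint_bc v h q \<gamma> L 1 0 0 0 0 0 0 1" by (rule ax) (auto simp: 1 bc_separated)
    then show ?thesis by (rule separated_case) (auto simp: 1 bc_separated)
  next
    case 2
    have "self_adjoint_bc v h q \<gamma> L 0 1 0 0 0 0 1 0" by (rule ax) (auto simp: 2 bc_separated)
    then show ?thesis by (rule separated_case) (auto simp: 2 bc_separated)
  next
    case 3
    have "self_adjoint_bc v h q \<gamma> L 1 0 0 0 0 0 1 0" by (rule ax) (auto simp: 3 bc_separated)
    then show ?thesis by (rule separated_case) (auto simp: 3 bc_separated)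
  next
    case 4
    have "self_adjoint_bc v h q \<gamma> L 0 1 0 0 0 0 0 1" by (rule ax) (auto simp: 4 bc_separated)
    then show ?thesis by (rule separated_case) (auto simp: 4 bc_separated)
  qed
qed

end

lemma singular_schroedinger_exists:
  assumes "v \<in> Vpot" obtains h q \<gamma> where "singular_schroedinger v h q \<gamma>"
proof (rule form_reduction[OF assms])
  fix h q :: "real \<Rightarrow> real" and \<gamma> :: real
  assume 1: "h 0 = 0" "continuous_on {0..1} h" "continuous_on {0..1} q" "\<And>x. q x \<ge> 0"
    "\<And>c y. y \<in> H1 \<Longrightarrow> (\<lambda>x. complex_of_real (exp (c * h x)) * y x) \<in> H1"
    "\<And>g y k \<eta>. sqint g \<Longrightarrow> prim g y \<Longrightarrow> sqint k \<Longrightarrow> prim k \<eta> \<Longrightarrow>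
       form_a v (\<lambda>x. complex_of_real (exp (- 1 * h x)) * y x) (\<lambda>x. complex_of_real (exp (- 1 * h x)) * \<eta> x) =
       integral {0..1} (\<lambda>x. exp (-2 * h x) * (g x * cnj (k x)) + (\<gamma> * exp (-2 * h x) - q x) * (y x * cnj (\<eta> x)))"
  have "singular_schroedinger v h q \<gamma>" by (rule singular_schroedinger.intro) (fact 1)+
  then show thesis by (rule that)
qed

theorem theorem2p6:
  fixes v :: "(real \<Rightarrow> complex) \<Rightarrow> complex"
  assumes "v \<in> Vpot"
  shows "(\<forall>\<alpha>::real. \<alpha> \<noteq> 0 \<longrightarrow>
            discrete_spectrum (robin_L \<alpha>) v \<and>
            eigenfunctions_ae_nonvanishing (robin_L \<alpha>) v \<and>
            (\<exists>lam. eigenvalue_list (robin_L \<alpha>) v lam) \<and>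
            (\<forall>lam. eigenvalue_list (robin_L \<alpha>) v lam \<longrightarrow>
               (\<forall>k::nat\<ge>1. (\<alpha> \<ge> 0 \<longrightarrow> lam (2*k - 1) < lam (2*k)) \<and>
                            (\<alpha> \<le> 0 \<longrightarrow> lam (2*k) < lam (2*k + 1)))))
       \<and> (\<forall>L \<in> {{0} \<times> UNIV, UNIV \<times> {0}, {(0, 0)}, UNIV :: (complex \<times> complex) set}.
            discrete_spectrum L v \<and>
            eigenfunctions_ae_nonvanishing L v \<and>
            (\<forall>\<mu>. is_eigenvalue L v \<mu> \<longrightarrow> multiplicity_h L v \<mu> 1))"
proof -
  obtain h q \<gamma> where S: "singular_schroedinger v h q \<gamma>" by (rule singular_schroedinger_exists[OF assms])
  interpret singular_schroedinger v h q \<gamma> by (rule S)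
  have "discrete_spectrum (robin_L \<alpha>) v \<and> eigenfunctions_ae_nonvanishing (robin_L \<alpha>) v \<and>
            (\<exists>lam. eigenvalue_list (robin_L \<alpha>) v lam) \<and>
            (\<forall>lam. eigenvalue_list (robin_L \<alpha>) v lam \<longrightarrow>
               (\<forall>k::nat\<ge>1. (\<alpha> \<ge> 0 \<longrightarrow> lam (2*k - 1) < lam (2*k)) \<and>
                            (\<alpha> \<le> 0 \<longrightarrow> lam (2*k) < lam (2*k + 1))))" if "\<alpha> \<noteq> 0" for \<alpha>
  proof -
    interpret R: robin_bc v h q \<gamma> \<alpha> by unfold_locales (rule that)
    show ?thesis using R.discrete R.nonvanishing R.eigenvalues_listing R.eigenvalues_order by blast
  qed
  then show ?thesis using separated_boundary_conditions by blast
qed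

end
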